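(* Let $\mu$ be a probability measure supported on a subset $F$ of $[0,1]$. Let $\mathcal{A}=(q_n)_{n\in\mathbb{N}}$ be an increasing sequence of natural numbers that (i) satisfies $\log q_n> C\,n^{1/B}$ for all $n\ge2$, for some constants $B\ge1$ and $C>0$, and (ii) is $\alpha$-separated for some $\alpha\in(0,1)$. Let $\gamma\in[0,1]$ and let $\psi:\mathbb{N}\to[0,1]$ be a real, positive function. Suppose there exists a constant $A>2B$ such that $\widehat{\mu}(t)=O\big((\log|t|)^{-A}\big)$ as $|t|\to\infty$. Then for any $\varepsilon>0$, $$R(x,N)=2\Psi(N)+O\Big(\big(\Psi(N)+E(N)\big)^{1/2}\big(\log(\Psi(N)+E(N)+2)\big)^{2+\varepsilon}\Big)$$ for $\mu$-almost all $x\in F$, where $\Psi(N):=\sum_{n=1}^N\psi(q_n)$ and $$E(N):=\sum_{1\le m<n\le N}(q_m,q_n)\min\Big(\frac{\psi(q_m)}{q_m},\frac{\psi(q_n)}{q_n}\Big),$$ $(q_m,q_n)$ denoting the greatest common divisor.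
   Context: $\widehat{\mu}(t)=\int e^{-2\pi i t x}\,d\mu(x)$. $\|\alpha\|$ denotes the distance to the nearest integer, and $R(x,N)=\#\{1\le n\le N:\ \|q_nx-\gamma\|\le\psi(q_n)\}$. An increasing sequence $(q_n)$ of natural numbers is called $\alpha$-separated (for $\alpha\in(0,1)$) if there is $m_0\in\mathbb{N}$ such that for all integers $m_0\le m<n$: if $1\le|sq_m-tq_n|<q_m^{\alpha}$ for some $s,t\in\mathbb{N}$, then $s>m^{12}$.
   Formalization: The formal theorem additionally assumes ψ(q_n) ≤ 1/2 for all n ≥ 1; without it the claim fails, e.g. for Lebesgue measure, q_n = 2^n, ψ = 1, where R(x,N) = N but 2Ψ(N) = 2N and E(N) ≤ N. *)

theory Defs
  imports "HOL-Probability.Probability" "HOL-Library.Landau_Symbols"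
begin

(* All sequences are indexed from 1; the value at index 0 is never used. *)

definition fourier :: "real measure \<Rightarrow> real \<Rightarrow> complex" where
  "fourier \<mu> t = (\<integral>x. exp (- 2 * of_real pi * \<i> * of_real t * of_real x) \<partial>\<mu>)"

definition dist_nearest_int :: "real \<Rightarrow> real" where
  "dist_nearest_int x = infdist x \<int>"

definition alpha_separated :: "real \<Rightarrow> (nat \<Rightarrow> nat) \<Rightarrow> bool" where
  "alpha_separated \<alpha> q \<longleftrightarrow>
     (\<exists>m0\<ge>1. \<forall>m n. m0 \<le> m \<and> m < n \<longrightarrow>
        (\<forall>s t. 1 \<le> s \<and> 1 \<le> t
           \<and> 1 \<le> \<bar>int s * int (q m) - int t * int (q n)\<bar>
           \<and> real_of_int \<bar>int s * int (q m) - int t * int (q n)\<bar> < real (q m) powr \<alpha>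
         \<longrightarrow> s > m ^ 12))"

(* For psi (q n) \<ge> 1/2 the condition holds for every x, so n contributes
   min 1 (2 * psi (q n)), not 2 * psi (q n), to the expected count. *)
definition hit_count ::
  "(nat \<Rightarrow> nat) \<Rightarrow> real \<Rightarrow> (nat \<Rightarrow> real) \<Rightarrow> real \<Rightarrow> nat \<Rightarrow> nat" where
  "hit_count q \<gamma> \<psi> x N =
     card {n \<in> {1..N}. dist_nearest_int (real (q n) * x - \<gamma>) \<le> \<psi> (q n)}"

definition psi_sum :: "(nat \<Rightarrow> nat) \<Rightarrow> (nat \<Rightarrow> real) \<Rightarrow> nat \<Rightarrow> real" where
  "psi_sum q \<psi> N = (\<Sum>n=1..N. \<psi> (q n))"

definition gcd_sum :: "(nat \<Rightarrow> nat) \<Rightarrow> (nat \<Rightarrow> real) \<Rightarrow> nat \<Rightarrow> real" where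
  "gcd_sum q \<psi> N =
     (\<Sum>n=1..N. \<Sum>m=1..<n.
        real (gcd (q m) (q n)) * min (\<psi> (q m) / real (q m)) (\<psi> (q n) / real (q n)))"

end

theory Submission
  imports Defs
begin

text \<open>The indicator of \<open>dist_nearest_int y \<le> \<psi> (q n)\<close> is squeezed between two periodic trapezoids whose
  slopes have width \<open>\<psi> (q n) / sqrt (1 + psi_sum q \<psi> n)\<close>; replacing the one by the other changes the
  expected count only by \<open>O (sqrt (psi_sum q \<psi> N))\<close>. The trapezoid is a second difference of the
  Bernoulli parabola, whose absolutely convergent cosine series is known explicitly. Hence the
  \<open>\<mu>\<close>-covariance of the trapezoids of index \<open>m \<le> n\<close> differs from their Lebesgue covariance only by
  frequencies \<open>s q\<^sub>m \<plusminus> t q\<^sub>n \<noteq> 0\<close>, which are controlled by the Fourier decay and by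
  separation, while averaging over shifts by \<open>1 / q\<^sub>n\<close> bounds the Lebesgue covariance by the gcd term.
  A Gal--Koksma argument turns the resulting variance bound into an almost everywhere bound. Indices
  with \<open>\<psi> (q n) < 1 / n\<^sup>2\<close>, for which the slopes would be too steep, are removed by Borel--Cantelli.\<close>

section \<open>The cosine series of the Bernoulli parabola\<close>

text \<open>Three losses have to fit together. The relative slope width 1 / sqrt (1 +
  \<open>psi_sum q \<psi> n\<close>) is modelled on the integral of 1 / sqrt t
  (\<open>sum_psi_over_sqrt\<close>). Steep slopes make the absolute sums of the Fourier
  coefficients large, but interpolating between two coefficient bounds keeps each sum below a
  multiple of n powr (4 * \<eta>), with \<eta> small. The assumption A > 2 * B pays for this: the
  growth of \<open>q\<close> turns the decay into n powr (- \<tau>) with \<tau> > 2, and since n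
  meets fewer than n smaller indices, the total error at n is of order n powr (- \<tau> / 2), which
  is summable. The frequencies that decay cannot control have s > m ^ 12 by separation; there the
  coefficients, at most m ^ 4 / s^2, sum to at most m powr (-8). The trapezoids are centred at their
  Lebesgue mean a + b instead of the mean under the given measure, so the main term 2 *
  \<open>psi_sum\<close> needs no separate estimate of means.\<close>

lemma dirichlet_kernel:
  fixes x :: real
  shows "2 * sin (x/2) * ((\<Sum>k=1..K. cos (real k * x)) + 1/2) = sin ((real K + 1/2) * x)"
proof (induction K)
  case 0 then show ?case by simp
next
  case (Suc K)
  have "2 * sin (x/2) * cos (real (Suc K) * x) = sin ((real (Suc K) + 1/2) * x) - sin ((real K + 1/2) * x)"
  proof -
    have e: "(real (Suc K) + 1/2) * x = real (Suc K) * x + x/2" "(real K + 1/2) * x = real (Suc K) * x - x/2"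
      by (simp_all add: field_simps)
    show ?thesis unfolding e sin_add sin_diff by simp
  qed
  then show ?case using Suc by (simp add: algebra_simps)
qed

text \<open>Uniformity is possible because [\<eta>, pi] stays away from the jump of the sawtooth at
  0. By \<open>dirichlet_kernel\<close> the derivative of the error is an oscillating quotient; one
  integration by parts gains the factor 1 / (2 * K + 1).\<close>

lemma sine_partial_sum_bound:
  fixes x \<eta> :: real
  assumes "0 < \<eta>" "\<eta> \<le> x" "x \<le> pi"
  shows "\<bar>(\<Sum>k=1..K. sin (real k * x) / real k) + (x - pi) / 2\<bar> \<le> 5 / (real (2*K+1) * (sin (\<eta>/2))\<^sup>2)"
proof -
  define s where "s = sin (\<eta>/2)"
  have s: "0 < s" "s \<le> 1" unfolding s_def using assms by (auto intro!: sin_gt_zero)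
  have sm: "s \<le> sin (y/2)" if "\<eta> \<le> y" "y \<le> pi" for y
    unfolding s_def using that assms by (intro sin_monotone_2pi_le) auto
  define L where "L = real (2*K+1)"
  have L: "L \<ge> 1" "L > 0" by (auto simp: L_def)
  \<comment> \<open>The cosine term is the boundary term of the integration by parts: adding it
    leaves a derivative of size 1 / L, and it vanishes at pi together with the rest.\<close>
  define \<rho> where "\<rho> y = (\<Sum>k=1..K. sin (real k * y) / real k) + (y - pi) / 2 + cos ((real K + 1/2) * y) / (L * sin (y/2))" for y
  define \<rho>' where "\<rho>' y = - cos ((real K + 1/2) * y) * cos (y/2) / (2 * L * (sin (y/2))\<^sup>2)" for y
  have der: "(\<rho> has_real_derivative \<rho>' y) (at y)" if y: "\<eta> \<le> y" "y \<le> pi" for y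
  proof -
    have sp: "sin (y/2) > 0" using sm[OF y] s by linarith
    have 1: "((\<lambda>y. \<Sum>k=1..K. sin (real k * y) / real k) has_real_derivative (\<Sum>k=1..K. cos (real k * y))) (at y)"
    proof (rule DERIV_sum)
      fix k assume "k \<in> {1..K}"
      then show "((\<lambda>y. sin (real k * y) / real k) has_real_derivative cos (real k * y)) (at y)"
        by (auto intro!: derivative_eq_intros)
    qed
    have e: "(\<Sum>k=1..K. cos (real k * y)) = sin ((real K + 1/2) * y) / (2 * sin (y/2)) - 1/2"
      using dirichlet_kernel[of y K] sp by (simp add: field_simps)
    have h: "real K + 1/2 = L/2" by (simp add: L_def)
    have 2: "((\<lambda>y. cos ((real K + 1/2) * y) / (L * sin (y/2))) has_real_derivative
        ((- sin ((real K + 1/2) * y) * (real K + 1/2)) * (L * sin (y/2)) - cos ((real K + 1/2) * y) * (L * (cos (y/2) * (1/2)))) / (L * sin (y/2))\<^sup>2) (at y)"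
      using sp L by (auto intro!: derivative_eq_intros simp: power2_eq_square)
    have "(\<rho> has_real_derivative ((\<Sum>k=1..K. cos (real k * y)) + 1/2 + ((- sin ((real K + 1/2) * y) * (real K + 1/2)) * (L * sin (y/2)) - cos ((real K + 1/2) * y) * (L * (cos (y/2) * (1/2)))) / (L * sin (y/2))\<^sup>2)) (at y)"
      unfolding \<rho>_def by (intro derivative_intros 1 2) (auto intro!: derivative_eq_intros)
    moreover have "(\<Sum>k=1..K. cos (real k * y)) + 1/2 + ((- sin ((real K + 1/2) * y) * (real K + 1/2)) * (L * sin (y/2)) - cos ((real K + 1/2) * y) * (L * (cos (y/2) * (1/2)))) / (L * sin (y/2))\<^sup>2 = \<rho>' y"
      unfolding e \<rho>'_def h using sp L by (simp add: field_simps power2_eq_square)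
    ultimately show ?thesis by simp
  qed
  have rpi: "\<rho> pi = 0"
  proof -
    have "cos ((real K + 1/2) * pi) = 0"
      by (simp add: distrib_right cos_add)
    then show ?thesis by (simp add: \<rho>_def)
  qed
  have "norm (\<rho> pi - \<rho> x) \<le> (1 / (2 * L * s\<^sup>2)) * norm (pi - x)"
  proof (rule field_differentiable_bound[where S="{\<eta>..pi}" and f'=\<rho>'])
    fix y assume y: "y \<in> {\<eta>..pi}"
    show "(\<rho> has_field_derivative \<rho>' y) (at y within {\<eta>..pi})"
      using der y by (auto intro: DERIV_subset)
    have "norm (\<rho>' y) = \<bar>cos ((real K + 1/2) * y) * cos (y/2)\<bar> / (2 * L * (sin (y/2))\<^sup>2)"
      using L by (simp add: \<rho>'_def abs_mult)
    also have "\<dots> \<le> 1 / (2 * L * s\<^sup>2)"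
    proof (rule frac_le)
      show "\<bar>cos ((real K + 1/2) * y) * cos (y/2)\<bar> \<le> 1"
        unfolding abs_mult by (intro mult_le_one) auto
      show "2 * L * s\<^sup>2 \<le> 2 * L * (sin (y/2))\<^sup>2"
        using sm[of y] y s L by (intro mult_left_mono power_mono) auto
    qed (use s L in auto)
    finally show "norm (\<rho>' y) \<le> 1 / (2 * L * s\<^sup>2)" .
  qed (use assms in auto)
  then have 1: "\<bar>\<rho> x\<bar> \<le> 1 / (2 * L * s\<^sup>2) * (pi - x)" using rpi assms by simp
  also have "\<dots> \<le> 1 / (2 * L * s\<^sup>2) * 4"
    using s L assms pi_less_4 by (intro mult_left_mono) auto
  finally have 1: "\<bar>\<rho> x\<bar> \<le> 2 / (L * s\<^sup>2)" by simp
  have 2: "\<bar>cos ((real K + 1/2) * x) / (L * sin (x/2))\<bar> \<le> 1 / (L * s\<^sup>2)"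
  proof -
    have sx: "s \<le> sin (x/2)" using sm assms by simp
    have "s\<^sup>2 \<le> s" using s by (simp add: power2_eq_square mult_le_one)
    then have "L * s\<^sup>2 \<le> L * sin (x/2)" using sx L by (intro mult_left_mono) auto
    then show ?thesis unfolding abs_divide abs_mult using s L sx
      by (intro frac_le) auto
  qed
  have "\<bar>(\<Sum>k=1..K. sin (real k * x) / real k) + (x - pi) / 2\<bar> \<le> 2 / (L * s\<^sup>2) + 1 / (L * s\<^sup>2)"
    using 1 2 unfolding \<rho>_def by linarith
  also have "\<dots> \<le> 5 / (L * s\<^sup>2)" using s L by (simp add: field_simps)
  finally show ?thesis unfolding L_def s_def .
qed

text \<open>This integrates the sawtooth estimate from x to pi: partial sums minus parabola have a
  derivative tending to 0 uniformly on [x, pi], so their values at x and at pi agree in the limit.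
  The common constant is left open here.\<close>

lemma cosine_series_shift:
  fixes x :: real
  assumes x: "0 < x" "x \<le> pi"
    and X: "(\<lambda>k. cos (real (Suc k) * x) / (real (Suc k))\<^sup>2) sums X"
    and Y: "(\<lambda>k. cos (real (Suc k) * pi) / (real (Suc k))\<^sup>2) sums Y"
  shows "X - (x - pi)\<^sup>2 / 4 = Y"
proof -
  define D where "D K y = (\<Sum>k=1..K. cos (real k * y) / (real k)\<^sup>2) - (y - pi)\<^sup>2 / 4" for K y
  have lim: "(\<lambda>K. D K y) \<longlonglongrightarrow> Z - (y - pi)\<^sup>2 / 4"
    if "(\<lambda>k. cos (real (Suc k) * y) / (real (Suc k))\<^sup>2) sums Z" for y Z
  proof -
    have "(\<lambda>K. \<Sum>k<K. cos (real (Suc k) * y) / (real (Suc k))\<^sup>2) \<longlonglongrightarrow> Z"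
      using that by (simp add: sums_def)
    moreover have "(\<Sum>k<K. cos (real (Suc k) * y) / (real (Suc k))\<^sup>2) = (\<Sum>k=1..K. cos (real k * y) / (real k)\<^sup>2)" for K
      by (rule sum.reindex_bij_witness[where i="\<lambda>k. k-1" and j=Suc]) auto
    ultimately show ?thesis unfolding D_def by (intro tendsto_intros) simp
  qed
  define s where "s = sin (x/2)"
  have s: "0 < s" unfolding s_def using assms by (auto intro!: sin_gt_zero)
  have bd: "\<bar>D K pi - D K x\<bar> \<le> 5 / (real (2*K+1) * s\<^sup>2) * \<bar>pi - x\<bar>" for K
  proof -
    have "norm (D K pi - D K x) \<le> (5 / (real (2*K+1) * s\<^sup>2)) * norm (pi - x)"
    proof (rule field_differentiable_bound[where S="{x..pi}" and f'="\<lambda>y. - ((\<Sum>k=1..K. sin (real k * y) / real k) + (y - pi) / 2)"])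
      fix y assume y: "y \<in> {x..pi}"
      have 1: "((\<lambda>y. \<Sum>k=1..K. cos (real k * y) / (real k)\<^sup>2) has_real_derivative (\<Sum>k=1..K. - sin (real k * y) / real k)) (at y)"
      proof (rule DERIV_sum)
        fix k assume "k \<in> {1..K}"
        then show "((\<lambda>y. cos (real k * y) / (real k)\<^sup>2) has_real_derivative - sin (real k * y) / real k) (at y)"
          by (auto intro!: derivative_eq_intros simp: power2_eq_square)
      qed
      have "(D K has_real_derivative ((\<Sum>k=1..K. - sin (real k * y) / real k) - (y - pi) / 2)) (at y)"
        unfolding D_def by (intro derivative_intros 1) (auto intro!: derivative_eq_intros)
      moreover have "(\<Sum>k=1..K. - sin (real k * y) / real k) - (y - pi) / 2 = - ((\<Sum>k=1..K. sin (real k * y) / real k) + (y - pi) / 2)"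
        by (simp add: sum_negf)
      ultimately show "(D K has_field_derivative - ((\<Sum>k=1..K. sin (real k * y) / real k) + (y - pi) / 2)) (at y within {x..pi})"
        by (metis has_field_derivative_at_within)
      show "norm (- ((\<Sum>k=1..K. sin (real k * y) / real k) + (y - pi) / 2)) \<le> 5 / (real (2*K+1) * s\<^sup>2)"
        using sine_partial_sum_bound[of x y K] x y unfolding s_def by (simp del: of_nat_mult of_nat_add)
    qed (use x in auto)
    then show ?thesis by simp
  qed
  have "(\<lambda>K. 5 / (real (2*K+1) * s\<^sup>2) * \<bar>pi - x\<bar>) \<longlonglongrightarrow> 0"
  proof -
    have "(\<lambda>K. inverse (real (2*K+1))) \<longlonglongrightarrow> 0"
      using LIMSEQ_subseq_LIMSEQ[OF lim_inverse_n, of "\<lambda>K. 2*K+1"]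
      by (simp add: o_def strict_mono_def del: of_nat_mult of_nat_add)
    then have "(\<lambda>K. (5 / s\<^sup>2 * \<bar>pi - x\<bar>) * inverse (real (2*K+1))) \<longlonglongrightarrow> 0"
      by (rule tendsto_mult_right_zero)
    then show ?thesis by (simp add: field_simps del: of_nat_mult of_nat_add)
  qed
  then have "(\<lambda>K. D K pi - D K x) \<longlonglongrightarrow> 0"
    by (rule Lim_null_comparison[rotated]) (use bd in \<open>auto simp del: of_nat_mult of_nat_add\<close>)
  moreover have "(\<lambda>K. D K pi - D K x) \<longlonglongrightarrow> (Y - (pi - pi)\<^sup>2 / 4) - (X - (x - pi)\<^sup>2 / 4)"
    by (intro tendsto_diff lim X Y)
  ultimately show ?thesis using LIMSEQ_unique by fastforce
qed

lemma inverse_squares_summable: "summable (\<lambda>k. 1 / (real (Suc k))\<^sup>2)"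
  using inverse_squares_sums sums_summable by (fastforce simp: add.commute)

lemma cosine_series_summable: "summable (\<lambda>k. cos (real (Suc k) * x) / (real (Suc k))\<^sup>2)"
  by (rule summable_comparison_test'[OF inverse_squares_summable, of 0])
     (auto simp: abs_divide intro!: divide_right_mono)

text \<open>The constant missing in \<open>cosine_series_shift\<close> is read off at 0, where the
  series is that of the inverse squares. Uniform convergence gives the continuity needed to reach
  this point, which the shift lemma excludes.\<close>

lemma cosine_series:
  fixes x :: real
  assumes x: "0 \<le> x" "x \<le> pi"
  shows "(\<lambda>k. cos (real (Suc k) * x) / (real (Suc k))\<^sup>2) sums ((x - pi)\<^sup>2 / 4 - pi\<^sup>2 / 12)"
proof -
  define f where "f y = (\<Sum>k. cos (real (Suc k) * y) / (real (Suc k))\<^sup>2)" for y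
  have S: "(\<lambda>k. cos (real (Suc k) * y) / (real (Suc k))\<^sup>2) sums f y" for y
    unfolding f_def using cosine_series_summable by (rule summable_sums)
  have eq: "f y = f pi + (y - pi)\<^sup>2 / 4" if "0 < y" "y \<le> pi" for y
    using cosine_series_shift[OF that S S] by simp
  have "continuous_on UNIV f"
  proof (rule uniform_limit_theorem)
    show "uniform_limit UNIV (\<lambda>n y. \<Sum>k<n. cos (real (Suc k) * y) / (real (Suc k))\<^sup>2) f sequentially"
      unfolding f_def
      by (rule Weierstrass_m_test[OF _ inverse_squares_summable])
         (auto simp: abs_divide intro!: divide_right_mono)
    show "\<forall>\<^sub>F n in sequentially. continuous_on UNIV (\<lambda>y. \<Sum>k<n. cos (real (Suc k) * y) / (real (Suc k))\<^sup>2)"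
      by (intro always_eventually allI continuous_intros) auto
  qed auto
  then have "isCont f 0" by (simp add: continuous_on_eq_continuous_at)
  then have "(f \<longlongrightarrow> f 0) (at_right 0)"
    by (auto simp: isCont_def intro: tendsto_within_subset)
  moreover have "((\<lambda>y. f pi + (y - pi)\<^sup>2 / 4) \<longlongrightarrow> f pi + (0 - pi)\<^sup>2 / 4) (at_right 0)"
    by (auto intro!: tendsto_eq_intros)
  then have "(f \<longlongrightarrow> f pi + (0 - pi)\<^sup>2 / 4) (at_right 0)"
  proof (rule Lim_transform_eventually)
    show "\<forall>\<^sub>F y in at_right 0. f pi + (y - pi)\<^sup>2 / 4 = f y"
      using eventually_at_right_less[of 0] eventually_at_right_real[of 0 pi] pi_gt_zero
      by (auto elim!: eventually_mono simp del: eq intro!: eq[symmetric])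
  qed
  ultimately have f0: "f 0 = f pi + pi\<^sup>2 / 4"
    using tendsto_unique[of "at_right (0::real)"] by fastforce
  have "f 0 = pi\<^sup>2 / 6"
  proof -
    have "(\<lambda>k. 1 / (real (Suc k))\<^sup>2) sums (pi\<^sup>2 / 6)"
      using inverse_squares_sums by (simp add: add.commute)
    then show ?thesis using S[of 0] sums_unique2 by fastforce
  qed
  then have "f pi = - pi\<^sup>2 / 12" using f0 by simp
  then have "f x = (x - pi)\<^sup>2 / 4 - pi\<^sup>2 / 12"
    using eq[of x] f0 x by (cases "x = 0") auto
  then show ?thesis using S[of x] by simp
qed

section \<open>Periodic trapezoids\<close>

text \<open>The second Bernoulli polynomial of the fractional part, up to the constant 1 / 6; the
  distance may replace the fractional part because t^2 - t is symmetric about 1 / 2.\<close>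

definition parab :: "real \<Rightarrow> real" where
  "parab y = (dist_nearest_int y)\<^sup>2 - dist_nearest_int y"

section \<open>Distance to the nearest integer and shape of the parabola\<close>

lemma dist_nearest_int_le:
  "dist_nearest_int y \<le> \<bar>y - of_int i\<bar>"
  unfolding dist_nearest_int_def using infdist_le[of "of_int i" \<int> y] by (simp add: dist_real_def)

lemma dist_nearest_int_attained:
  obtains i where "dist_nearest_int y = \<bar>y - of_int i\<bar>"
proof -
  have "closed (\<int> :: real set)" by (rule closed_Ints)
  then obtain z where "z \<in> \<int>" "infdist y \<int> = dist y z"
    using infdist_attains_inf[of "\<int>::real set" y] by blast
  then show ?thesis using that unfolding dist_nearest_int_def by (auto simp: Ints_def dist_real_def)
qed

lemma dist_nearest_int_bounds: "0 \<le> dist_nearest_int y" "dist_nearest_int y \<le> 1/2"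
proof -
  show "0 \<le> dist_nearest_int y" by (simp add: dist_nearest_int_def infdist_nonneg)
  have "\<bar>y - of_int (round y)\<bar> \<le> 1/2" using of_int_round_abs_le[of y] by (simp add: abs_minus_commute)
  then show "dist_nearest_int y \<le> 1/2" using dist_nearest_int_le[of y "round y"] by linarith
qed

lemma dist_nearest_int_eq:
  assumes "\<bar>y - of_int i\<bar> \<le> 1/2"
  shows "dist_nearest_int y = \<bar>y - of_int i\<bar>"
proof -
  obtain j where j: "dist_nearest_int y = \<bar>y - of_int j\<bar>" by (rule dist_nearest_int_attained)
  show ?thesis
  proof (cases "j = i")
    case False
    then have "\<bar>real_of_int j - of_int i\<bar> \<ge> 1" by linarith
    then show ?thesis using dist_nearest_int_le[of y i] j assms by linarith
  qed (use j in simp)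
qed

lemma dist_nearest_int_add_int: "dist_nearest_int (y + of_int j) = dist_nearest_int y"
proof -
  obtain i where i: "dist_nearest_int y = \<bar>y - of_int i\<bar>" by (rule dist_nearest_int_attained)
  then have "\<bar>y - of_int i\<bar> \<le> 1/2" using dist_nearest_int_bounds(2)[of y] by linarith
  then have "\<bar>y + of_int j - of_int (i + j)\<bar> \<le> 1/2" by simp
  from dist_nearest_int_eq[OF this] i show ?thesis by simp
qed

lemma parab_add_int: "parab (y + of_int j) = parab y"
  by (simp add: parab_def dist_nearest_int_add_int)

lemma parab_unit:
  assumes "\<bar>y\<bar> \<le> 1" shows "parab y = y\<^sup>2 - \<bar>y\<bar>"
proof (cases "\<bar>y\<bar> \<le> 1/2")
  case True
  then show ?thesis using dist_nearest_int_eq[of y 0] by (simp add: parab_def)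
next
  case False
  show ?thesis
  proof (cases "y \<ge> 0")
    case True
    then have "parab y = (1 - y)\<^sup>2 - (1 - y)" unfolding parab_def using dist_nearest_int_eq[of y 1] False assms by simp
    then show ?thesis using True by (simp add: power2_eq_square algebra_simps)
  next
    case f: False
    then have "parab y = (1 + y)\<^sup>2 - (1 + y)" unfolding parab_def using dist_nearest_int_eq[of y "-1"] False assms by simp
    then show ?thesis using f by (simp add: power2_eq_square algebra_simps)
  qed
qed

text \<open>Arguments x + b with |x| <= 1 / 2 and b <= 1 leave [-1, 1], so one further kink at each
  of 1 and -1 must be recorded. There the slope drops by 2, as it does at 0.\<close>

lemma parab_two:
  assumes "\<bar>y\<bar> \<le> 2" shows "parab y = y\<^sup>2 - \<bar>y\<bar> - 2 * max 0 (\<bar>y\<bar> - 1)"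
proof (cases "\<bar>y\<bar> \<le> 1")
  case True
  then show ?thesis using parab_unit by simp
next
  case False
  show ?thesis
  proof (cases "y \<ge> 0")
    case True
    then show ?thesis using False assms parab_unit[of "y - 1"] parab_add_int[of y "-1"]
      by (simp add: power2_eq_square algebra_simps)
  next
    case f: False
    then show ?thesis using False assms parab_unit[of "y + 1"] parab_add_int[of y "1"]
      by (simp add: power2_eq_square algebra_simps)
  qed
qed

text \<open>The distance is 1-Lipschitz, and t^2 - t has slope at most 1 in absolute value on
  [0, 1 / 2].\<close>

lemma parab_lipschitz: "\<bar>parab y - parab z\<bar> \<le> \<bar>y - z\<bar>"
proof -
  define d e where "d = dist_nearest_int y" and "e = dist_nearest_int z"
  have b: "0 \<le> d" "d \<le> 1/2" "0 \<le> e" "e \<le> 1/2" unfolding d_def e_def by (rule dist_nearest_int_bounds)+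
  have "\<bar>d - e\<bar> \<le> \<bar>y - z\<bar>"
    unfolding d_def e_def dist_nearest_int_def using infdist_triangle_abs[of y \<int> z] by (simp add: dist_real_def)
  moreover have "parab y - parab z = (d - e) * (d + e - 1)"
    by (simp add: parab_def d_def e_def power2_eq_square algebra_simps)
  moreover have "\<bar>d - e\<bar> * \<bar>d + e - 1\<bar> \<le> \<bar>d - e\<bar> * 1"
    using b by (intro mult_left_mono) auto
  ultimately show ?thesis by (simp add: abs_mult)
qed

section \<open>Cosine series of the parabola and of the trapezoid\<close>

lemma cos_two_pi_add_int: "cos (2 * pi * real k * (y + of_int i)) = cos (2 * pi * real k * y)"
proof -
  have "2 * pi * real k * (y + of_int i) = 2 * pi * real k * y + 2 * pi * of_int (int k * i)"
    by (simp add: algebra_simps)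
  then show ?thesis by (simp only: cos_add cos_int_2pin sin_int_2pin mult_1_right mult_zero_right diff_zero)
qed

lemma parab_series:
  "(\<lambda>k. cos (2 * pi * real (Suc k) * y) / (real (Suc k))\<^sup>2) sums (pi\<^sup>2 * (parab y + 1/6))"
proof -
  obtain i where i: "dist_nearest_int y = \<bar>y - of_int i\<bar>" by (rule dist_nearest_int_attained)
  define d where "d = dist_nearest_int y"
  have b: "0 \<le> d" "d \<le> 1/2" unfolding d_def by (rule dist_nearest_int_bounds)+
  have c: "cos (2 * pi * real (Suc k) * y) = cos (real (Suc k) * (2 * pi * d))" for k
  proof -
    have "cos (2 * pi * real (Suc k) * y) = cos (2 * pi * real (Suc k) * (y - of_int i))"
      using cos_two_pi_add_int[of "Suc k" y "- i"] by simp
    also have "\<dots> = cos (2 * pi * real (Suc k) * d)"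
      unfolding d_def i abs_if by (simp only: cos_minus minus_mult_right[symmetric] split: if_split) simp
    finally show ?thesis by (simp only: mult_ac)
  qed
  have "(\<lambda>k. cos (2 * pi * real (Suc k) * y) / (real (Suc k))\<^sup>2) sums ((2 * pi * d - pi)\<^sup>2 / 4 - pi\<^sup>2 / 12)"
    unfolding c by (rule cosine_series) (use b in auto)
  moreover have "(2 * pi * d - pi)\<^sup>2 / 4 - pi\<^sup>2 / 12 = pi\<^sup>2 * (parab y + 1/6)"
    by (simp add: parab_def d_def[symmetric] power2_eq_square field_simps)
  ultimately show ?thesis by simp
qed

text \<open>A second difference that turns the kinks of the parabola into corners at distance a and
  b. For 0 <= a < b it is the periodic sum of the trapezoids that are 1 up to a, 0 from b on and
  linear between; a + b is its mean.\<close>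

definition trap :: "real \<Rightarrow> real \<Rightarrow> real \<Rightarrow> real" where
  "trap a b y = a + b + (parab (y + a) + parab (y - a) - parab (y + b) - parab (y - b)) / (2 * (b - a))"

definition trap_coeff :: "real \<Rightarrow> real \<Rightarrow> nat \<Rightarrow> real" where
  "trap_coeff a b k = (cos (2 * pi * real k * a) - cos (2 * pi * real k * b)) / (2 * pi\<^sup>2 * (real k)\<^sup>2 * (b - a))"

lemma trap_add_int: "trap a b (y + of_int j) = trap a b y"
proof -
  have "parab (y + of_int j + a) = parab (y + a)" "parab (y + of_int j - a) = parab (y - a)" for a
    using parab_add_int[of "y + a" j] parab_add_int[of "y - a" j] by (simp_all add: algebra_simps)
  then show ?thesis by (simp add: trap_def)
qed

lemma trap_series:
  assumes "a < b"
  shows "(\<lambda>k. 2 * trap_coeff a b (Suc k) * cos (2 * pi * real (Suc k) * y)) sums (trap a b y - (a + b))"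
proof -
  let ?c = "\<lambda>y k. cos (2 * pi * real (Suc k) * y) / (real (Suc k))\<^sup>2"
  have "(\<lambda>k. (?c (y + a) k + ?c (y - a) k - ?c (y + b) k - ?c (y - b) k) * (1 / (2 * pi\<^sup>2 * (b - a)))) sums
     ((pi\<^sup>2 * (parab (y + a) + 1/6) + pi\<^sup>2 * (parab (y - a) + 1/6) - pi\<^sup>2 * (parab (y + b) + 1/6) - pi\<^sup>2 * (parab (y - b) + 1/6)) * (1 / (2 * pi\<^sup>2 * (b - a))))"
    by (intro sums_mult2 sums_diff sums_add parab_series)
  moreover have "(pi\<^sup>2 * (parab (y + a) + 1/6) + pi\<^sup>2 * (parab (y - a) + 1/6) - pi\<^sup>2 * (parab (y + b) + 1/6) - pi\<^sup>2 * (parab (y - b) + 1/6)) * (1 / (2 * pi\<^sup>2 * (b - a))) = trap a b y - (a + b)"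
    using assms by (simp add: trap_def field_simps)
  moreover have "(?c (y + a) k + ?c (y - a) k - ?c (y + b) k - ?c (y - b) k) * (1 / (2 * pi\<^sup>2 * (b - a))) =
    2 * trap_coeff a b (Suc k) * cos (2 * pi * real (Suc k) * y)" for k
  proof -
    have s: "cos (w * (y + a)) + cos (w * (y - a)) = 2 * cos (w * y) * cos (w * a)" for w a
      by (simp add: distrib_left right_diff_distrib cos_add cos_diff)
    define n where "n = real (Suc k)"
    define w where "w = 2 * pi * n"
    have n: "n \<noteq> 0" by (simp add: n_def)
    have "(cos (w * (y + a)) / n\<^sup>2 + cos (w * (y - a)) / n\<^sup>2 - cos (w * (y + b)) / n\<^sup>2 - cos (w * (y - b)) / n\<^sup>2)
       = (2 * cos (w * y) * cos (w * a) - 2 * cos (w * y) * cos (w * b)) / n\<^sup>2"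
      unfolding s[symmetric] by (simp add: add_divide_distrib diff_divide_distrib)
    moreover have "((2 * p * u - 2 * p * v) / m) * (1 / (2 * e * d)) = 2 * ((u - v) / (2 * e * m * d)) * p" for p u v m e d :: real
      by (cases "e = 0 \<or> d = 0 \<or> m = 0") (auto simp: field_simps)
    ultimately show ?thesis unfolding trap_coeff_def n_def[symmetric] w_def[symmetric] by (simp only:)
  qed
  ultimately show ?thesis by simp
qed

section \<open>Pointwise comparison of trapezoids with the indicator\<close>

lemma trap_reduce:
  obtains x where "\<bar>x\<bar> = dist_nearest_int y" "\<bar>x\<bar> \<le> 1/2" "\<And>a b. trap a b y = trap a b x"
proof -
  obtain i where i: "dist_nearest_int y = \<bar>y - of_int i\<bar>" by (rule dist_nearest_int_attained)
  show ?thesis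
    by (rule that[of "y - of_int i"])
      (use i dist_nearest_int_bounds(2)[of y] trap_add_int[of _ _ y "- i"] in auto)
qed

text \<open>On a half period the quadratic parts of the four parabolas cancel.\<close>

lemma trap_formula:
  assumes "0 \<le> a" "a < b" "b \<le> 1" "\<bar>x\<bar> \<le> 1/2"
  shows "2 * (b - a) * trap a b x =
    (\<bar>x + b\<bar> + 2 * max 0 (\<bar>x + b\<bar> - 1)) + (\<bar>x - b\<bar> + 2 * max 0 (\<bar>x - b\<bar> - 1))
    - (\<bar>x + a\<bar> + 2 * max 0 (\<bar>x + a\<bar> - 1)) - (\<bar>x - a\<bar> + 2 * max 0 (\<bar>x - a\<bar> - 1))"
proof -
  have p: "parab y = y\<^sup>2 - (\<bar>y\<bar> + 2 * max 0 (\<bar>y\<bar> - 1))" if "\<bar>y\<bar> \<le> 2" for y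
    using parab_two[OF that] by simp
  have "2 * (b - a) * trap a b x = 2 * (b - a) * (a + b) + (parab (x + a) + parab (x - a) - parab (x + b) - parab (x - b))"
    using assms by (simp add: trap_def field_simps)
  also have "\<dots> = 2 * (b - a) * (a + b) + ((x + a)\<^sup>2 + (x - a)\<^sup>2 - (x + b)\<^sup>2 - (x - b)\<^sup>2)
      + (\<bar>x + b\<bar> + 2 * max 0 (\<bar>x + b\<bar> - 1)) + (\<bar>x - b\<bar> + 2 * max 0 (\<bar>x - b\<bar> - 1))
    - (\<bar>x + a\<bar> + 2 * max 0 (\<bar>x + a\<bar> - 1)) - (\<bar>x - a\<bar> + 2 * max 0 (\<bar>x - a\<bar> - 1))"
    using assms by (subst (1 2 3 4) p) (auto simp: abs_le_iff)
  also have "2 * (b - a) * (a + b) + ((x + a)\<^sup>2 + (x - a)\<^sup>2 - (x + b)\<^sup>2 - (x - b)\<^sup>2) = 0"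
    by (simp add: power2_eq_square algebra_simps)
  finally show ?thesis by simp
qed

lemma trap_nonneg:
  assumes "0 \<le> a" "a < b" "b \<le> 1"
  shows "0 \<le> trap a b y"
proof -
  obtain x where x: "\<bar>x\<bar> \<le> 1/2" "\<And>a b. trap a b y = trap a b x"
    using trap_reduce by metis
  have "\<bar>x + a\<bar> + \<bar>x - a\<bar> \<le> \<bar>x + b\<bar> + \<bar>x - b\<bar>" using assms by linarith
  moreover have "max 0 (\<bar>x + a\<bar> - 1) + max 0 (\<bar>x - a\<bar> - 1) \<le> max 0 (\<bar>x + b\<bar> - 1) + max 0 (\<bar>x - b\<bar> - 1)"
  proof (cases "x \<ge> 0")
    case True
    then have "max 0 (\<bar>x - a\<bar> - 1) = 0" "max 0 (\<bar>x + a\<bar> - 1) \<le> max 0 (\<bar>x + b\<bar> - 1)"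
      using assms x(1) by auto
    then show ?thesis by linarith
  next
    case False
    then have "max 0 (\<bar>x + a\<bar> - 1) = 0" "max 0 (\<bar>x - a\<bar> - 1) \<le> max 0 (\<bar>x - b\<bar> - 1)"
      using assms x(1) by auto
    then show ?thesis by linarith
  qed
  ultimately have "0 \<le> 2 * (b - a) * trap a b x"
    unfolding trap_formula[OF assms x(1)] by linarith
  then show ?thesis using assms x(2) by (simp add: zero_le_mult_iff)
qed

text \<open>The majorant half of the sandwich. Only a lower bound is stated because b may exceed 1 /
  2; then the slopes of neighbouring periods overlap and the value can pass 1.\<close>

lemma trap_ge_1:
  assumes "0 \<le> a" "a < b" "b \<le> 1" "a \<le> 1/2" "dist_nearest_int y \<le> a"
  shows "1 \<le> trap a b y"
proof -
  obtain x where x: "\<bar>x\<bar> = dist_nearest_int y" "\<bar>x\<bar> \<le> 1/2" "\<And>a b. trap a b y = trap a b x"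
    using trap_reduce by metis
  have "\<bar>x\<bar> \<le> a" using assms x by simp
  then have "max 0 (\<bar>x - a\<bar> - 1) = 0" "max 0 (\<bar>x + a\<bar> - 1) = 0" "\<bar>x + a\<bar> + \<bar>x - a\<bar> = 2 * a"
    using assms x(2) by auto
  moreover have "\<bar>x + b\<bar> + \<bar>x - b\<bar> \<ge> 2 * b" by linarith
  moreover have "max 0 (\<bar>x - b\<bar> - 1) \<ge> 0" "max 0 (\<bar>x + b\<bar> - 1) \<ge> 0" by auto
  moreover have "2 * (b - a) * 1 = 2 * b - 2 * a" by simp
  ultimately have "2 * (b - a) * 1 \<le> 2 * (b - a) * trap a b x"
    unfolding trap_formula[OF assms(1-3) x(2)] by linarith
  then have "1 \<le> trap a b x" using assms(2) by (subst (asm) mult_le_cancel_left_pos) auto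
  then show ?thesis using x(3) by simp
qed

text \<open>The minorant half. Here b <= 1 / 2 keeps neighbouring periods apart, so all correction
  terms of \<open>trap_formula\<close> vanish.\<close>

lemma trap_le_indicator:
  assumes "0 \<le> a" "a < b" "b \<le> 1/2"
  shows "trap a b y \<le> (if dist_nearest_int y \<le> b then 1 else 0)"
proof -
  obtain x where x: "\<bar>x\<bar> = dist_nearest_int y" "\<bar>x\<bar> \<le> 1/2" "\<And>a b. trap a b y = trap a b x"
    using trap_reduce by metis
  have b: "b \<le> 1" using assms by simp
  have "max 0 (\<bar>x - a\<bar> - 1) = 0" "max 0 (\<bar>x + a\<bar> - 1) = 0" "max 0 (\<bar>x - b\<bar> - 1) = 0" "max 0 (\<bar>x + b\<bar> - 1) = 0"
    using assms x(2) by auto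
  then have f: "2 * (b - a) * trap a b x = \<bar>x + b\<bar> + \<bar>x - b\<bar> - (\<bar>x + a\<bar> + \<bar>x - a\<bar>)"
    unfolding trap_formula[OF assms(1-2) b x(2)] by linarith
  have "2 * (b - a) * trap a b x \<le> 2 * (b - a) * (if dist_nearest_int y \<le> b then 1 else 0)"
  proof (cases "\<bar>x\<bar> \<le> b")
    case True
    then have "\<bar>x + b\<bar> + \<bar>x - b\<bar> = 2 * b" by linarith
    moreover have "\<bar>x + a\<bar> + \<bar>x - a\<bar> \<ge> 2 * a" by linarith
    ultimately show ?thesis unfolding f using True x(1) by simp
  next
    case False
    then have "\<bar>x + b\<bar> + \<bar>x - b\<bar> = \<bar>x + a\<bar> + \<bar>x - a\<bar>" using assms by linarith
    then show ?thesis unfolding f using False x(1) by simp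
  qed
  then have "trap a b x \<le> (if dist_nearest_int y \<le> b then 1 else 0)"
    using assms(2) by (subst (asm) mult_le_cancel_left_pos) auto
  then show ?thesis using x(3) by simp
qed

section \<open>Averages over rational shifts\<close>

lemma sum_cos_arith_progression:
  assumes "Q \<ge> 1"
  shows "(\<Sum>i<Q. cos (2 * pi * real k * (z + real i * real r / real Q))) =
         (if Q dvd k * r then real Q * cos (2 * pi * real k * z) else 0)"
proof -
  define \<theta> where "\<theta> = 2 * pi * real (k * r) / real Q"
  have Q: "real Q > 0" using assms by simp
  have e: "2 * pi * real k * (z + real i * real r / real Q) = 2 * pi * real k * z + real i * \<theta>" for i
    using Q by (simp add: \<theta>_def field_simps)
  have c: "cos (2 * pi * real k * (z + real i * real r / real Q)) = Re (cis (2 * pi * real k * z) * cis \<theta> ^ i)" for i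
    unfolding e by (simp add: Complex.DeMoivre cis_mult)
  have s: "(\<Sum>i<Q. cos (2 * pi * real k * (z + real i * real r / real Q))) = Re (cis (2 * pi * real k * z) * (\<Sum>i<Q. cis \<theta> ^ i))"
    unfolding c Re_sum[symmetric] sum_distrib_left[symmetric] ..
  show ?thesis
  proof (cases "Q dvd k * r")
    case True
    then obtain j where j: "k * r = Q * j" by blast
    have "\<theta> = 2 * pi * real j" unfolding \<theta>_def j using Q by simp
    then have "cis \<theta> = 1" by (simp add: cis_multiple_2pi)
    then show ?thesis unfolding s using True by simp
  next
    case False
    have ne: "cis \<theta> \<noteq> 1"
    proof
      assume "cis \<theta> = 1"
      then have "cos \<theta> = 1" by (metis cis.sel(1) one_complex.sel(1))
      then obtain j :: int where "\<theta> = of_int j * 2 * pi" using cos_one_2pi_int by blast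
      then have "real (k * r) = of_int j * real Q" using Q by (simp add: \<theta>_def field_simps)
      then have "of_int (int (k * r)) = (of_int (j * int Q) :: real)" by simp
      then have "int (k * r) = j * int Q" by (simp only: of_int_eq_iff)
      then have "int Q dvd int (k * r)" by simp
      then show False using False by (simp only: of_nat_dvd_iff)
    qed
    have "cis \<theta> ^ Q = cis (real Q * \<theta>)" by (simp add: Complex.DeMoivre)
    also have "real Q * \<theta> = 2 * pi * real (k * r)" using Q by (simp add: \<theta>_def)
    also have "cis \<dots> = 1" by (rule cis_multiple_2pi) (simp only: Ints_of_nat)
    finally have "(\<Sum>i<Q. cis \<theta> ^ i) = 0" using geometric_sum[OF ne, of Q] by simp
    then show ?thesis unfolding s using False by simp
  qed
qed

text \<open>The distribution relation of the Bernoulli polynomial: among the frequencies k only the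
  multiples of v survive the sum over the shifts, and k = v * j turns 1 / k^2 into 1 / (v^2 *
  j^2).\<close>

lemma parab_average:
  fixes r Q :: nat
  assumes Q: "Q \<ge> 1"
  defines "v \<equiv> Q div gcd r Q"
  shows "(\<Sum>i<Q. parab (z + real i * real r / real Q) + 1/6) =
         real Q / (real v)\<^sup>2 * (parab (real v * z) + 1/6)"
proof -
  have Qv: "Q = v * gcd r Q" by (simp add: v_def)
  have v: "v \<ge> 1" using Q Qv by (cases v) auto
  have dv: "Q dvd k * r \<longleftrightarrow> v dvd k" for k
  proof -
    define g where "g = gcd r Q"
    have g: "g > 0" using Q by (simp add: g_def)
    define u where "u = r div g"
    have ru: "k * u * g = k * r" by (simp add: u_def g_def)
    have Qg: "v * g = Q" by (simp add: v_def g_def)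
    have cop: "coprime v u" unfolding u_def v_def g_def using Q
      by (metis coprime_commute div_gcd_coprime not_one_le_zero)
    have "Q dvd k * r \<longleftrightarrow> v * g dvd (k * u) * g" unfolding Qg ru ..
    also have "\<dots> \<longleftrightarrow> v dvd k * u" using g by simp
    also have "\<dots> \<longleftrightarrow> v dvd k" using cop by (simp add: coprime_dvd_mult_left_iff)
    finally show ?thesis .
  qed
  define f where "f k = (\<Sum>i<Q. cos (2 * pi * real (Suc k) * (z + real i * real r / real Q)) / (real (Suc k))\<^sup>2)" for k
  have 1: "f sums (\<Sum>i<Q. pi\<^sup>2 * (parab (z + real i * real r / real Q) + 1/6))"
    unfolding f_def by (intro sums_sum parab_series)
  have f: "f k = (if v dvd Suc k then real Q * cos (2 * pi * real (Suc k) * z) / (real (Suc k))\<^sup>2 else 0)" for k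
    unfolding f_def sum_divide_distrib[symmetric] sum_cos_arith_progression[OF Q] dv by simp
  \<comment> \<open>Index k of the series stands for the frequency Suc k, so the multiple v * Suc j
    has index one less.\<close>
  define g where "g j = v * Suc j - 1" for j
  have sg: "Suc (g j) = v * Suc j" for j using v by (simp add: g_def)
  have sm: "strict_mono g"
  proof (rule strict_monoI)
    fix i j :: nat assume "i < j"
    then have "v * Suc i < v * Suc j" using v by simp
    then show "g i < g j" using sg[of i] sg[of j] by linarith
  qed
  have nr: "f k = 0" if "k \<notin> range g" for k
  proof -
    have "\<not> v dvd Suc k"
    proof
      assume "v dvd Suc k"
      then obtain j where j: "Suc k = v * j" by blast
      then obtain j' where "j = Suc j'" by (cases j) auto
      then have "k = g j'" using j sg[of j'] by simp
      then show False using that by simp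
    qed
    then show ?thesis by (simp add: f)
  qed
  have fg: "f (g j) = real Q / (real v)\<^sup>2 * (cos (2 * pi * real (Suc j) * (real v * z)) / (real (Suc j))\<^sup>2)" for j
    unfolding f sg of_nat_mult power_mult_distrib by (simp add: mult_ac del: of_nat_Suc)
  have "(\<lambda>j. f (g j)) sums (real Q / (real v)\<^sup>2 * (pi\<^sup>2 * (parab (real v * z) + 1/6)))"
    unfolding fg by (intro sums_mult parab_series)
  then have "f sums (real Q / (real v)\<^sup>2 * (pi\<^sup>2 * (parab (real v * z) + 1/6)))"
    using sums_mono_reindex[of g f, OF sm nr] by blast
  from sums_unique2[OF this 1] have "pi\<^sup>2 * (\<Sum>i<Q. parab (z + real i * real r / real Q) + 1/6) =
      pi\<^sup>2 * (real Q / (real v)\<^sup>2 * (parab (real v * z) + 1/6))"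
    unfolding sum_distrib_left[symmetric] by (simp add: mult_ac)
  then show ?thesis by (subst (asm) mult_left_cancel) auto
qed

text \<open>The decay of the discrepancy comes from the Lipschitz bound for the parabola: averaging
  over the \<open>v\<close> shifts rescales its argument by \<open>v\<close> and its size by \<open>1 / v\<^sup>2\<close>.\<close>

lemma trap_average:
  assumes Q: "Q \<ge> 1" and ab: "a < b"
  shows "\<bar>\<Sum>i<Q. trap a b (z + real i * real r / real Q) - (a + b)\<bar> \<le> real (gcd r Q)"
proof -
  define v where "v = Q div gcd r Q"
  have Qv: "Q = v * gcd r Q" by (simp add: v_def)
  have v: "v \<ge> 1" using Q Qv by (cases v) auto
  define S where "S c = (\<Sum>i<Q. parab (z + real i * real r / real Q + c) + 1/6)" for c
  have S: "S c = real Q / (real v)\<^sup>2 * (parab (real v * (z + c)) + 1/6)" for c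
    unfolding S_def v_def using parab_average[OF Q, of "z + c" r] by (simp add: add_ac)
  have "(\<Sum>i<Q. trap a b (z + real i * real r / real Q) - (a + b)) = (S a + S (- a) - S b - S (- b)) / (2 * (b - a))"
    unfolding S_def sum.distrib[symmetric] sum_subtractf[symmetric] sum_divide_distrib trap_def
    by (intro sum.cong refl) simp
  also have "\<dots> = real Q / (real v)\<^sup>2 * ((parab (real v * (z + a)) - parab (real v * (z + b))) + (parab (real v * (z - a)) - parab (real v * (z - b)))) / (2 * (b - a))"
    unfolding S by (simp add: algebra_simps)
  finally have e: "\<bar>\<Sum>i<Q. trap a b (z + real i * real r / real Q) - (a + b)\<bar> = real Q / (real v)\<^sup>2 * \<bar>(parab (real v * (z + a)) - parab (real v * (z + b))) + (parab (real v * (z - a)) - parab (real v * (z - b)))\<bar> / (2 * (b - a))"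
    using ab by (simp add: abs_mult)
  have "\<bar>parab (real v * (z + a)) - parab (real v * (z + b))\<bar> \<le> real v * (b - a)"
    using parab_lipschitz[of "real v * (z + a)" "real v * (z + b)"] ab
    by (simp add: right_diff_distrib[symmetric] abs_mult)
  moreover have "\<bar>parab (real v * (z - a)) - parab (real v * (z - b))\<bar> \<le> real v * (b - a)"
    using parab_lipschitz[of "real v * (z - a)" "real v * (z - b)"] ab
    by (simp add: right_diff_distrib[symmetric] abs_mult)
  ultimately have "\<bar>(parab (real v * (z + a)) - parab (real v * (z + b))) + (parab (real v * (z - a)) - parab (real v * (z - b)))\<bar> \<le> 2 * real v * (b - a)"
    by linarith
  then have "\<bar>\<Sum>i<Q. trap a b (z + real i * real r / real Q) - (a + b)\<bar> \<le> real Q / (real v)\<^sup>2 * (2 * real v * (b - a)) / (2 * (b - a))"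
    unfolding e using ab by (intro divide_right_mono mult_left_mono) auto
  also have "\<dots> = real Q / real v" using ab v by (simp add: field_simps power2_eq_square)
  also have "\<dots> = real (gcd r Q)" using v by (subst Qv) (simp add: field_simps)
  finally show ?thesis .
qed

lemma trap_deviation: "a < b \<Longrightarrow> \<bar>trap a b y - (a + b)\<bar> \<le> 1"
  using trap_average[of 1 a b y 0] by simp

section \<open>Mean and covariance of trapezoids under Lebesgue measure\<close>

lemma continuous_on_parab: "continuous_on A parab"
proof -
  have "1-lipschitz_on A parab"
    by (rule lipschitz_onI) (auto simp: dist_real_def parab_lipschitz)
  then show ?thesis by (rule lipschitz_on_continuous_on)
qed

lemma continuous_on_trap [continuous_intros]:
  "continuous_on A f \<Longrightarrow> continuous_on A (\<lambda>x. trap a b (f x))"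
  unfolding trap_def divide_inverse by (intro continuous_intros continuous_on_compose2[OF continuous_on_parab]) auto

lemma integral_periodic_shift:
  fixes g :: "real \<Rightarrow> real"
  assumes cont: "continuous_on UNIV g" and per: "\<And>x. g (x + 1) = g x" and h: "0 \<le> h" "h \<le> 1"
  shows "integral {0..1} (\<lambda>x. g (x + h)) = integral {0..1} g"
proof -
  have c: "continuous_on A g" for A using cont by (rule continuous_on_subset) simp
  have i: "g integrable_on {x..y}" for x y by (intro integrable_continuous_real c)
  have s: "integral {x..y} (\<lambda>x. g (x + d)) = integral {x + d..y + d} g" for x y d
    using integral_shift[of x d y g] c by (simp add: o_def)
  have "integral {0..1} (\<lambda>x. g (x + h)) = integral {h..1 + h} g" using s[of 0 1 h] by simp
  also have "\<dots> = integral {h..1} g + integral {1..1 + h} g"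
    using Henstock_Kurzweil_Integration.integral_combine[where a=h and c=1 and b="1 + h" and f=g] h i by simp
  also have "integral {1..1 + h} g = integral {0..h} g" using s[of 0 h 1] per by (simp add: add.commute)
  also have "integral {h..1} g + integral {0..h} g = integral {0..1} g"
    using Henstock_Kurzweil_Integration.integral_combine[where a=0 and c=h and b=1 and f=g] h i by simp
  finally show ?thesis .
qed

lemma integral_shift_average:
  fixes g :: "real \<Rightarrow> real"
  assumes cont: "continuous_on UNIV g" and per: "\<And>x. g (x + 1) = g x" and Q: "Q \<ge> 1"
  shows "real Q * integral {0..1} g = integral {0..1} (\<lambda>x. \<Sum>i<Q. g (x + real i / real Q))"
proof -
  have c: "continuous_on A (\<lambda>x. g (x + c))" for A c
    by (rule continuous_on_compose2[OF cont]) (auto intro!: continuous_intros)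
  have "integral {0..1} (\<lambda>x. \<Sum>i<Q. g (x + real i / real Q)) = (\<Sum>i<Q. integral {0..1} (\<lambda>x. g (x + real i / real Q)))"
    by (rule integral_sum) (auto intro!: integrable_continuous_real c)
  also have "\<dots> = (\<Sum>i<Q. integral {0..1} g)"
    by (intro sum.cong refl integral_periodic_shift assms) auto
  finally show ?thesis by simp
qed

text \<open>The series is not integrated. For Q coprime to q the sum over the Q shifts is bounded by
  the gcd, which is 1, so Q * |I| <= 1; as Q = q * N + 1 can be arbitrarily large, I = 0.\<close>

lemma integral_trap:
  assumes ab: "a < b" and q: "q \<ge> 1"
  shows "integral {0..1} (\<lambda>x. trap a b (real q * x - \<gamma>)) = a + b"
proof -
  define I where "I = integral {0..1} (\<lambda>x. trap a b (real q * x - \<gamma>) - (a + b))"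
  have bd: "real Q * \<bar>I\<bar> \<le> 1" if Q: "Q \<ge> 1" "coprime q Q" for Q
  proof -
    define g where "g x = trap a b (real q * x - \<gamma>) - (a + b)" for x
    have c: "continuous_on A g" for A unfolding g_def by (intro continuous_intros)
    have per: "g (x + 1) = g x" for x
      unfolding g_def using trap_add_int[of a b "real q * x - \<gamma>" "int q"] by (simp add: algebra_simps)
    have "real Q * I = integral {0..1} (\<lambda>x. \<Sum>i<Q. g (x + real i / real Q))"
      unfolding I_def using integral_shift_average[OF c per Q(1)] by (simp add: g_def)
    also have "norm \<dots> \<le> integral {0..1} (\<lambda>x::real. 1 :: real)"
    proof (rule integral_norm_bound_integral)
      show "(\<lambda>x. \<Sum>i<Q. g (x + real i / real Q)) integrable_on {0..1}"
        by (intro integrable_continuous_real continuous_intros continuous_on_compose2[OF c[of UNIV]]) auto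
      fix x :: real assume "x \<in> {0..1}"
      have "g (x + real i / real Q) = trap a b (real q * x - \<gamma> + real i * real q / real Q) - (a + b)" for i
        by (simp add: g_def algebra_simps)
      then show "norm (\<Sum>i<Q. g (x + real i / real Q)) \<le> 1"
        using trap_average[OF Q(1) ab, of "real q * x - \<gamma>" q] Q(2) by simp
    qed auto
    finally show ?thesis using Q by (simp add: abs_mult)
  qed
  have "I = 0"
  proof (rule ccontr)
    assume "I \<noteq> 0"
    obtain N where N: "1 < real N * \<bar>I\<bar>" using \<open>I \<noteq> 0\<close> reals_Archimedean3[of "\<bar>I\<bar>"] by auto
    have "real N \<le> real (q * N + 1)" using q by (cases q) auto
    then have "real N * \<bar>I\<bar> \<le> real (q * N + 1) * \<bar>I\<bar>" by (intro mult_right_mono) auto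
    also have "\<dots> \<le> 1" by (rule bd) (simp, rule coprimeI, metis dvd_add_right_iff dvd_mult2)
    finally show False using N by simp
  qed
  moreover have "I = integral {0..1} (\<lambda>x. trap a b (real q * x - \<gamma>)) - (a + b)"
    unfolding I_def
    by (subst integral_diff) (auto intro!: integrable_continuous_real continuous_intros)
  ultimately show ?thesis by simp
qed

text \<open>Shifting x by i / q changes q * x by an integer, so the second factor stays fixed while
  the shifts of the first sum to at most the gcd. What remains is the mean a' + b' of the
  nonnegative second trapezoid, whose centring costs nothing because the first factor has mean
  0.\<close>

lemma lebesgue_covariance_trap:
  assumes ab: "a < b" and ab': "0 \<le> a'" "a' < b'" "b' \<le> 1" and p: "p \<ge> 1" and q: "q \<ge> 1"
  shows "\<bar>integral {0..1} (\<lambda>x. (trap a b (real p * x - \<gamma>) - (a + b)) * (trap a' b' (real q * x - \<gamma>) - (a' + b')))\<bar>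
          \<le> real (gcd p q) * ((a' + b') / real q)"
proof -
  define f g where "f x = trap a b (real p * x - \<gamma>) - (a + b)" and "g x = trap a' b' (real q * x - \<gamma>)" for x
  have c: "continuous_on A f" "continuous_on A g" for A unfolding f_def g_def by (intro continuous_intros)+
  have per: "f (x + 1) * g (x + 1) = f x * g x" for x
    unfolding f_def g_def using trap_add_int[of a b "real p * x - \<gamma>" "int p"] trap_add_int[of a' b' "real q * x - \<gamma>" "int q"]
    by (simp add: algebra_simps)
  have f0: "integral {0..1} f = 0"
    unfolding f_def by (subst integral_diff) (auto intro!: integrable_continuous_real continuous_intros simp: integral_trap[OF ab p])
  have "real q * integral {0..1} (\<lambda>x. f x * g x) = integral {0..1} (\<lambda>x. \<Sum>i<q. f (x + real i / real q) * g (x + real i / real q))"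
    by (rule integral_shift_average) (use q per in \<open>auto intro!: continuous_intros c\<close>)
  also have "norm \<dots> \<le> integral {0..1} (\<lambda>x. real (gcd p q) * g x)"
  proof (rule integral_norm_bound_integral)
    show "(\<lambda>x. \<Sum>i<q. f (x + real i / real q) * g (x + real i / real q)) integrable_on {0..1}"
      by (intro integrable_continuous_real continuous_intros continuous_on_compose2[OF c(1)[of UNIV]] continuous_on_compose2[OF c(2)[of UNIV]]) auto
    show "(\<lambda>x. real (gcd p q) * g x) integrable_on {0..1}"
      by (intro integrable_continuous_real continuous_intros c)
    fix x :: real assume "x \<in> {0..1}"
    have gp: "g (x + real i / real q) = g x" for i
      unfolding g_def using trap_add_int[of a' b' "real q * x - \<gamma>" "int i"] q by (simp add: algebra_simps)
    have fi: "f (x + real i / real q) = trap a b (real p * x - \<gamma> + real i * real p / real q) - (a + b)" for i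
      by (simp add: f_def algebra_simps)
    have g0: "g x \<ge> 0" unfolding g_def using ab' by (intro trap_nonneg)
    have "norm (\<Sum>i<q. f (x + real i / real q) * g (x + real i / real q)) = \<bar>\<Sum>i<q. f (x + real i / real q)\<bar> * g x"
      unfolding gp sum_distrib_right[symmetric] using g0 by (simp add: abs_mult)
    also have "\<dots> \<le> real (gcd p q) * g x"
      unfolding fi by (intro mult_right_mono trap_average q ab g0)
    finally show "norm (\<Sum>i<q. f (x + real i / real q) * g (x + real i / real q)) \<le> real (gcd p q) * g x" .
  qed
  also have "\<dots> = real (gcd p q) * (a' + b')"
    unfolding g_def using integral_trap[OF ab'(2) q] by simp
  finally have 1: "real q * \<bar>integral {0..1} (\<lambda>x. f x * g x)\<bar> \<le> real (gcd p q) * (a' + b')"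
    by (simp add: abs_mult)
  have "integral {0..1} (\<lambda>x. f x * (g x - (a' + b'))) = integral {0..1} (\<lambda>x. f x * g x - (a' + b') * f x)"
    by (simp add: algebra_simps)
  also have "\<dots> = integral {0..1} (\<lambda>x. f x * g x)"
    by (subst integral_diff) (auto intro!: integrable_continuous_real continuous_intros c simp: f0)
  finally show ?thesis using 1 q unfolding f_def g_def by (simp add: field_simps)
qed

text \<open>The difference of cosines is 2 * sin u * sin w. Estimating |sin| by its argument for
  both factors, only for w, or for neither (then by 1) gives the three bounds.\<close>

lemma trap_coeff_bounds:
  assumes "0 \<le> a" "a < b" "k \<ge> 1"
  shows "\<bar>trap_coeff a b k\<bar> \<le> a + b" "\<bar>trap_coeff a b k\<bar> \<le> 1 / real k"
    "\<bar>trap_coeff a b k\<bar> \<le> 1 / ((real k)\<^sup>2 * (b - a))"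
proof -
  define u w where "u = pi * real k * (a + b)" and "w = pi * real k * (b - a)"
  have k: "real k \<ge> 1" using assms by simp
  have w: "w > 0" using assms k by (auto simp: w_def)
  have u: "u \<ge> 0" using assms k by (auto simp: u_def)
  have "cos (2 * pi * real k * a) - cos (2 * pi * real k * b) = 2 * (sin u * sin w)"
  proof -
    have "(2 * pi * real k * a + 2 * pi * real k * b) / 2 = u" "(2 * pi * real k * b - 2 * pi * real k * a) / 2 = w"
      by (simp_all add: u_def w_def field_simps)
    then show ?thesis unfolding cos_diff_cos by (simp only: mult.assoc)
  qed
  then have "trap_coeff a b k = sin u * sin w / (pi\<^sup>2 * (real k)\<^sup>2 * (b - a))"
    by (simp add: trap_coeff_def)
  also have "pi\<^sup>2 * (real k)\<^sup>2 * (b - a) = pi * real k * w" by (simp add: w_def power2_eq_square)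
  finally have c: "\<bar>trap_coeff a b k\<bar> = \<bar>sin u\<bar> * \<bar>sin w\<bar> / (pi * real k * w)"
    using w k by (simp add: abs_mult)
  have "\<bar>sin u\<bar> * \<bar>sin w\<bar> \<le> u * w"
    using abs_sin_x_le_abs_x[of u] abs_sin_x_le_abs_x[of w] u w by (intro mult_mono) auto
  then have "\<bar>trap_coeff a b k\<bar> \<le> u * w / (pi * real k * w)"
    unfolding c using w k by (intro divide_right_mono) auto
  also have "\<dots> = a + b" using w k by (simp add: u_def)
  finally show "\<bar>trap_coeff a b k\<bar> \<le> a + b" .
  have "\<bar>sin u\<bar> * \<bar>sin w\<bar> \<le> 1 * w"
    using abs_sin_x_le_abs_x[of w] w by (intro mult_mono) auto
  then have "\<bar>trap_coeff a b k\<bar> \<le> 1 * w / (pi * real k * w)"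
    unfolding c using w k by (intro divide_right_mono) auto
  also have "\<dots> = 1 / (pi * real k)" using w by simp
  also have "\<dots> \<le> 1 / real k" using k pi_gt3 by (intro divide_left_mono) auto
  finally show "\<bar>trap_coeff a b k\<bar> \<le> 1 / real k" .
  have "\<bar>sin u\<bar> * \<bar>sin w\<bar> \<le> 1 * 1" by (intro mult_mono) auto
  then have "\<bar>trap_coeff a b k\<bar> \<le> 1 * 1 / (pi * real k * w)"
    unfolding c using w k by (intro divide_right_mono) auto
  also have "\<dots> \<le> 1 / ((real k)\<^sup>2 * (b - a))"
  proof -
    have "1 * ((real k)\<^sup>2 * (b - a)) \<le> pi\<^sup>2 * ((real k)\<^sup>2 * (b - a))"
      using assms pi_gt3 by (intro mult_right_mono) (auto simp: one_le_power)
    then have "(real k)\<^sup>2 * (b - a) \<le> pi * real k * w" by (simp add: w_def power2_eq_square mult_ac)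
    then show ?thesis using assms k w by (simp add: frac_le)
  qed
  finally show "\<bar>trap_coeff a b k\<bar> \<le> 1 / ((real k)\<^sup>2 * (b - a))" .
qed

text \<open>The bound 1 / k alone diverges logarithmically, and 1 / (k^2 * (b - a)) alone is poor
  for small k. Their geometric mean with weights 1 - \<eta> and \<eta> is summable and costs only (b
  - a) powr (- \<eta>).\<close>

lemma trap_coeff_sum:
  assumes "0 \<le> a" "a < b" "0 < \<eta>" "\<eta> < 1"
  shows "(\<Sum>k=1..K. \<bar>trap_coeff a b k\<bar>) \<le> (\<Sum>k. real k powr (- 1 - \<eta>)) * (b - a) powr (- \<eta>)"
proof -
  have 1: "\<bar>trap_coeff a b k\<bar> \<le> real k powr (- 1 - \<eta>) * (b - a) powr (- \<eta>)" if k: "k \<ge> 1" for k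
  proof -
    define c where "c = \<bar>trap_coeff a b k\<bar>"
    have kp: "real k > 0" using k by simp
    have "c = c powr (1 - \<eta>) * c powr \<eta>" by (cases "c = 0") (auto simp: powr_add[symmetric] c_def)
    also have "\<dots> \<le> (1 / real k) powr (1 - \<eta>) * (1 / ((real k)\<^sup>2 * (b - a))) powr \<eta>"
      using trap_coeff_bounds(2,3)[OF assms(1,2) k] assms
      by (intro mult_mono powr_mono2) (auto simp: c_def)
    also have "(1 / ((real k)\<^sup>2 * (b - a))) powr \<eta> = real k powr (- 2 * \<eta>) * (b - a) powr (- \<eta>)"
    proof -
      have "(1 / ((real k)\<^sup>2 * (b - a))) = (real k powr (-2)) * (b - a) powr (-1)"
        using assms kp by (simp add: powr_minus powr_realpow divide_inverse)
      then show ?thesis using assms kp by (simp only: powr_mult powr_powr) simp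
    qed
    also have "(1 / real k) powr (1 - \<eta>) = real k powr (\<eta> - 1)"
      using kp by (simp add: powr_divide powr_minus_divide[symmetric])
    also have "real k powr (\<eta> - 1) * (real k powr (- 2 * \<eta>) * (b - a) powr (- \<eta>)) = real k powr (- 1 - \<eta>) * (b - a) powr (- \<eta>)"
      by (simp add: powr_add[symmetric] mult.assoc[symmetric] algebra_simps)
    finally show ?thesis unfolding c_def .
  qed
  have "(\<Sum>k=1..K. \<bar>trap_coeff a b k\<bar>) \<le> (\<Sum>k=1..K. real k powr (- 1 - \<eta>)) * (b - a) powr (- \<eta>)"
    unfolding sum_distrib_right by (intro sum_mono 1) auto
  also have "\<dots> \<le> (\<Sum>k. real k powr (- 1 - \<eta>)) * (b - a) powr (- \<eta>)"
    using assms by (intro mult_right_mono sum_le_suminf) (auto simp: summable_real_powr_iff)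
  finally show ?thesis .
qed

section \<open>Covariances under measures with small Fourier transform\<close>

lemma abs_integral_cos_le_fourier:
  assumes M: "prob_space M" "sets M = sets borel"
  shows "\<bar>\<integral>x. cos (2 * pi * (r * x - \<theta>)) \<partial>M\<bar> \<le> norm (fourier M r)"
proof -
  interpret prob_space M by fact
  define e where "e x = exp (- 2 * of_real pi * \<i> * of_real r * of_real x :: complex)" for x :: real
  have meas: "e \<in> borel_measurable M"
    unfolding e_def measurable_cong_sets[OF M(2) refl] by (intro borel_measurable_continuous_onI continuous_intros)
  have ne: "norm (e x) = 1" for x by (simp add: e_def norm_exp_eq_Re)
  have int: "integrable M e"
    by (rule integrable_const_bound[where B=1]) (auto simp: ne meas)
  have c: "cos (2 * pi * (r * x - \<theta>)) = Re (cis (2 * pi * \<theta>) * e x)" for x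
  proof -
    have "e x = cis (- (2 * pi * r * x))" by (simp add: e_def cis_conv_exp mult_ac)
    then have "cis (2 * pi * \<theta>) * e x = cis (- (2 * pi * (r * x - \<theta>)))"
      by (simp add: cis_mult algebra_simps)
    then show ?thesis by simp
  qed
  have "(\<integral>x. cos (2 * pi * (r * x - \<theta>)) \<partial>M) = Re (\<integral>x. cis (2 * pi * \<theta>) * e x \<partial>M)"
    unfolding c using int by (subst integral_Re) auto
  also have "(\<integral>x. cis (2 * pi * \<theta>) * e x \<partial>M) = cis (2 * pi * \<theta>) * fourier M r"
    using int by (simp add: fourier_def e_def)
  finally show ?thesis
    using abs_Re_le_cmod[of "cis (2 * pi * \<theta>) * fourier M r"] by (simp add: norm_mult)
qed

lemma integral_cos_unit_interval:
  fixes r :: int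
  assumes "r \<noteq> 0"
  shows "integral {0..1} (\<lambda>x. cos (2 * pi * (of_int r * x - \<theta>))) = 0"
proof -
  define F where "F x = sin (2 * pi * (of_int r * x - \<theta>)) / (2 * pi * of_int r)" for x :: real
  have "((\<lambda>x. cos (2 * pi * (of_int r * x - \<theta>))) has_integral (F 1 - F 0)) {0..1}"
  proof (rule fundamental_theorem_of_calculus)
    fix x :: real
    have "(F has_real_derivative cos (2 * pi * (of_int r * x - \<theta>))) (at x within {0..1})"
      unfolding F_def using assms by (auto intro!: derivative_eq_intros)
    then show "(F has_vector_derivative cos (2 * pi * (of_int r * x - \<theta>))) (at x within {0..1})"
      by (rule has_real_derivative_iff_has_vector_derivative[THEN iffD1])
  qed simp
  moreover have "F 1 = F 0"
  proof -
    have "sin (2 * pi * (of_int r * 1 - \<theta>)) = sin (2 * pi * of_int r - 2 * pi * \<theta>)" by (simp add: algebra_simps)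
    also have "\<dots> = sin (- (2 * pi * \<theta>))" by (simp add: sin_diff)
    finally show ?thesis by (simp add: F_def)
  qed
  ultimately show ?thesis by (simp add: integral_unique)
qed

definition trap_poly :: "nat \<Rightarrow> real \<Rightarrow> real \<Rightarrow> real \<Rightarrow> real" where
  "trap_poly K a b y = (\<Sum>k=1..K. 2 * trap_coeff a b k * cos (2 * pi * real k * y))"

lemma trap_poly_tendsto:
  assumes "a < b"
  shows "(\<lambda>K. trap_poly K a b y) \<longlonglongrightarrow> trap a b y - (a + b)"
proof -
  have "trap_poly K a b y = (\<Sum>k<K. 2 * trap_coeff a b (Suc k) * cos (2 * pi * real (Suc k) * y))" for K
    unfolding trap_poly_def by (rule sum.reindex_bij_witness[where i=Suc and j="\<lambda>k. k-1"]) auto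
  then show ?thesis using trap_series[OF assms, of y] by (simp add: sums_def)
qed

text \<open>Supplies the constant dominating function for the limit in K; 1 / 2 is one admissible
  \<eta> in \<open>trap_coeff_sum\<close>.\<close>

lemma trap_poly_bounded:
  assumes "0 \<le> a" "a < b"
  obtains C where "0 \<le> C" "\<And>K y. \<bar>trap_poly K a b y\<bar> \<le> C"
proof -
  define Z where "Z = 2 * ((\<Sum>k. real k powr (- 1 - 1/2)) * (b - a) powr (- (1/2)))"
  have "\<bar>trap_poly K a b y\<bar> \<le> Z" for K y
  proof -
    have "\<bar>trap_poly K a b y\<bar> \<le> (\<Sum>k=1..K. \<bar>2 * trap_coeff a b k * cos (2 * pi * real k * y)\<bar>)"
      unfolding trap_poly_def by (rule sum_abs)
    also have "\<dots> \<le> (\<Sum>k=1..K. 2 * \<bar>trap_coeff a b k\<bar>)"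
      by (intro sum_mono) (auto simp: abs_mult mult_left_le)
    also have "\<dots> \<le> Z" unfolding Z_def sum_distrib_left[symmetric]
      using trap_coeff_sum[OF assms, of "1/2" K] by simp
    finally show ?thesis .
  qed
  moreover from this[of 0 0] have "0 \<le> Z" by (simp add: trap_poly_def)
  ultimately show ?thesis using that by blast
qed

lemma continuous_on_trap_poly [continuous_intros]:
  fixes f :: "real \<Rightarrow> real"
  shows "continuous_on A f \<Longrightarrow> continuous_on A (\<lambda>x. trap_poly K a b (f x))"
  unfolding trap_poly_def by (intro continuous_intros)

lemma trap_poly_product:
  "trap_poly K a b (real p * x - \<gamma>) * trap_poly K a' b' (real q * x - \<gamma>) =
    (\<Sum>s=1..K. \<Sum>t=1..K. 2 * trap_coeff a b s * trap_coeff a' b' t *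
      (cos (2 * pi * (of_int (int (s * p) + int (t * q)) * x - real (s + t) * \<gamma>))
     + cos (2 * pi * (of_int (int (s * p) - int (t * q)) * x - (real s - real t) * \<gamma>))))"
proof -
  have pr: "2 * (cos u * cos v) = cos (u + v) + cos (u - v)" for u v :: real
    by (simp add: cos_add cos_diff)
  have "2 * trap_coeff a b s * cos (2 * pi * real s * (real p * x - \<gamma>)) * (2 * trap_coeff a' b' t * cos (2 * pi * real t * (real q * x - \<gamma>)))
    = 2 * trap_coeff a b s * trap_coeff a' b' t *
      (cos (2 * pi * (of_int (int (s * p) + int (t * q)) * x - real (s + t) * \<gamma>))
     + cos (2 * pi * (of_int (int (s * p) - int (t * q)) * x - (real s - real t) * \<gamma>)))" (is "?l = ?r") for s t
  proof -
    define u v where "u = 2 * pi * real s * (real p * x - \<gamma>)" and "v = 2 * pi * real t * (real q * x - \<gamma>)"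
    have "?l = 2 * trap_coeff a b s * trap_coeff a' b' t * (2 * (cos u * cos v))"
      by (simp add: u_def v_def)
    also have "\<dots> = 2 * trap_coeff a b s * trap_coeff a' b' t * (cos (u + v) + cos (u - v))" unfolding pr ..
    also have "u + v = 2 * pi * (of_int (int (s * p) + int (t * q)) * x - real (s + t) * \<gamma>)"
      by (simp add: u_def v_def algebra_simps)
    also have "u - v = 2 * pi * (of_int (int (s * p) - int (t * q)) * x - (real s - real t) * \<gamma>)"
      by (simp add: u_def v_def algebra_simps)
    finally show ?thesis .
  qed
  then show ?thesis unfolding trap_poly_def sum_product by (intro sum.cong refl)
qed

text \<open>The covariance under an arbitrary measure is compared with the one under Lebesgue measure,
  so that only the off-diagonal frequencies have to be estimated by Fourier decay.\<close>

lemma covariance_trap: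
  assumes M: "prob_space M" "sets M = sets borel"
    and ab: "0 \<le> a" "a < b" "b \<le> 1" and ab': "0 \<le> a'" "a' < b'" "b' \<le> 1"
    and p: "p \<ge> 1" and q: "q \<ge> 1"
    and B: "\<And>K. (\<Sum>s=1..K. \<Sum>t=1..K. 2 * \<bar>trap_coeff a b s\<bar> * \<bar>trap_coeff a' b' t\<bar> *
       (norm (fourier M (of_int (int (s * p) + int (t * q)))) +
        (if s * p = t * q then 0 else norm (fourier M (of_int (int (s * p) - int (t * q))))))) \<le> B"
  shows "\<bar>\<integral>x. (trap a b (real p * x - \<gamma>) - (a + b)) * (trap a' b' (real q * x - \<gamma>) - (a' + b')) \<partial>M\<bar>
     \<le> real (gcd p q) * min ((a + b) / real p) ((a' + b') / real q) + B"
proof -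
  interpret prob_space M by fact
  define F where "F K x = trap_poly K a b (real p * x - \<gamma>) * trap_poly K a' b' (real q * x - \<gamma>)" for K x
  define G where "G x = (trap a b (real p * x - \<gamma>) - (a + b)) * (trap a' b' (real q * x - \<gamma>) - (a' + b'))" for x
  obtain C where C: "0 \<le> C" "\<And>K y. \<bar>trap_poly K a b y\<bar> \<le> C" using trap_poly_bounded[OF ab(1,2)] by blast
  obtain C' where C': "0 \<le> C'" "\<And>K y. \<bar>trap_poly K a' b' y\<bar> \<le> C'" using trap_poly_bounded[OF ab'(1,2)] by blast
  have FG: "(\<lambda>K. F K x) \<longlonglongrightarrow> G x" for x
    unfolding F_def G_def by (intro tendsto_mult trap_poly_tendsto ab ab')
  have bd: "\<bar>F K x\<bar> \<le> C * C'" for K x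
    unfolding F_def abs_mult using C C' by (intro mult_mono) auto
  have contF: "continuous_on A (F K)" and contG: "continuous_on A G" for A K
    unfolding F_def G_def by (intro continuous_intros)+
  have meas: "f \<in> borel_measurable M" if "continuous_on UNIV f" for f :: "real \<Rightarrow> real"
    unfolding measurable_cong_sets[OF M(2) refl] by (intro borel_measurable_continuous_onI that)
  have limM: "(\<lambda>K. integral\<^sup>L M (F K)) \<longlonglongrightarrow> integral\<^sup>L M G"
    by (rule integral_dominated_convergence[where w="\<lambda>_. C * C'"])
      (use meas contF contG FG bd in auto)
  have limL: "(\<lambda>K. integral {0..1} (F K)) \<longlonglongrightarrow> integral {0..1} G"
    by (rule dominated_convergence(2)[where h="\<lambda>_. C * C'"])
      (use contF FG bd in \<open>auto intro!: integrable_continuous_real\<close>)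
  have diff: "\<bar>integral\<^sup>L M (F K) - integral {0..1} (F K)\<bar> \<le> B" for K
  proof -
    define e1 e2 where "e1 s t x = cos (2 * pi * (of_int (int (s * p) + int (t * q)) * x - real (s + t) * \<gamma>))"
      and "e2 s t x = cos (2 * pi * (of_int (int (s * p) - int (t * q)) * x - (real s - real t) * \<gamma>))" for s t x
    define w where "w s t = 2 * trap_coeff a b s * trap_coeff a' b' t" for s t
    have Fe: "F K x = (\<Sum>s=1..K. \<Sum>t=1..K. w s t * (e1 s t x + e2 s t x))" for x
      unfolding F_def trap_poly_product w_def e1_def e2_def ..
    have ce: "continuous_on A (e1 s t)" "continuous_on A (e2 s t)" for A s t
      unfolding e1_def e2_def by (intro continuous_intros)+
    have ie: "integrable M (e1 s t)" "integrable M (e2 s t)" for s t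
      by (rule integrable_const_bound[where B=1]; use meas ce in \<open>auto simp: e1_def e2_def\<close>)+
    have he: "e1 s t integrable_on {0..1}" "e2 s t integrable_on {0..1}" for s t
      by (intro integrable_continuous_real ce)+
    have "integral\<^sup>L M (F K) = (\<Sum>s=1..K. \<Sum>t=1..K. w s t * (integral\<^sup>L M (e1 s t) + integral\<^sup>L M (e2 s t)))"
      unfolding Fe using ie by simp
    moreover have "integral {0..1} (F K) = (\<Sum>s=1..K. \<Sum>t=1..K. w s t * (integral {0..1} (e1 s t) + integral {0..1} (e2 s t)))"
    proof -
      have "integral {0..1} (\<lambda>x. w s t * (e1 s t x + e2 s t x)) = w s t * (integral {0..1} (e1 s t) + integral {0..1} (e2 s t))" for s t
        using he by (simp add: integral_add)
      moreover have "integral {0..1} (F K) = (\<Sum>s=1..K. integral {0..1} (\<lambda>x. \<Sum>t=1..K. w s t * (e1 s t x + e2 s t x)))"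
        unfolding Fe by (rule integral_sum) (auto intro!: integrable_continuous_real continuous_intros ce)
      moreover have "integral {0..1} (\<lambda>x. \<Sum>t=1..K. w s t * (e1 s t x + e2 s t x)) = (\<Sum>t=1..K. integral {0..1} (\<lambda>x. w s t * (e1 s t x + e2 s t x)))" for s
        by (rule integral_sum) (auto intro!: integrable_continuous_real continuous_intros ce)
      ultimately show ?thesis by (simp only:)
    qed
    ultimately have eq: "integral\<^sup>L M (F K) - integral {0..1} (F K) = (\<Sum>s=1..K. \<Sum>t=1..K. w s t *
        ((integral\<^sup>L M (e1 s t) - integral {0..1} (e1 s t)) + (integral\<^sup>L M (e2 s t) - integral {0..1} (e2 s t))))"
      by (simp add: sum_subtractf[symmetric] algebra_simps)
    have "\<bar>integral\<^sup>L M (F K) - integral {0..1} (F K)\<bar> \<le> (\<Sum>s=1..K. \<Sum>t=1..K. \<bar>w s t *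
        ((integral\<^sup>L M (e1 s t) - integral {0..1} (e1 s t)) + (integral\<^sup>L M (e2 s t) - integral {0..1} (e2 s t)))\<bar>)"
      unfolding eq by (intro order_trans[OF sum_abs] sum_mono sum_abs)
    also have "\<dots> \<le> (\<Sum>s=1..K. \<Sum>t=1..K. 2 * \<bar>trap_coeff a b s\<bar> * \<bar>trap_coeff a' b' t\<bar> *
       (norm (fourier M (of_int (int (s * p) + int (t * q)))) +
        (if s * p = t * q then 0 else norm (fourier M (of_int (int (s * p) - int (t * q)))))))"
    proof (intro sum_mono)
      fix s t assume st: "s \<in> {1..K}" "t \<in> {1..K}"
      have "s * p > 0" using st p by simp
      then have nz: "int (s * p) + int (t * q) \<noteq> 0" by linarith
      have 1: "\<bar>integral\<^sup>L M (e1 s t) - integral {0..1} (e1 s t)\<bar> \<le> norm (fourier M (of_int (int (s * p) + int (t * q))))"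
        unfolding e1_def integral_cos_unit_interval[OF nz] using abs_integral_cos_le_fourier[OF M] by simp
      have 2: "\<bar>integral\<^sup>L M (e2 s t) - integral {0..1} (e2 s t)\<bar> \<le> (if s * p = t * q then 0 else norm (fourier M (of_int (int (s * p) - int (t * q)))))"
      proof (cases "s * p = t * q")
        case True
        \<comment> \<open>On the diagonal s * p = t * q the frequency is 0 and the cosine is
          constant, so both probability measures give it the same integral. These terms stay inside
          the Lebesgue covariance.\<close>
        then have "e2 s t = (\<lambda>x. cos (2 * pi * (0 - (real s - real t) * \<gamma>)))"
          unfolding e2_def True by (simp del: of_nat_mult)
        then show ?thesis using True by (simp add: prob_space)
      next
        case False
        then have nz: "int (s * p) - int (t * q) \<noteq> 0" by linarith
        show ?thesis unfolding e2_def integral_cos_unit_interval[OF nz] using False abs_integral_cos_le_fourier[OF M] by simp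
      qed
      have "\<bar>(integral\<^sup>L M (e1 s t) - integral {0..1} (e1 s t)) + (integral\<^sup>L M (e2 s t) - integral {0..1} (e2 s t))\<bar> \<le>
         norm (fourier M (of_int (int (s * p) + int (t * q)))) +
        (if s * p = t * q then 0 else norm (fourier M (of_int (int (s * p) - int (t * q)))))"
        using 1 2 by linarith
      then have "\<bar>w s t\<bar> * \<bar>(integral\<^sup>L M (e1 s t) - integral {0..1} (e1 s t)) + (integral\<^sup>L M (e2 s t) - integral {0..1} (e2 s t))\<bar> \<le>
         \<bar>w s t\<bar> * (norm (fourier M (of_int (int (s * p) + int (t * q)))) +
        (if s * p = t * q then 0 else norm (fourier M (of_int (int (s * p) - int (t * q))))))"
        by (rule mult_left_mono) simp
      then show "\<bar>w s t * ((integral\<^sup>L M (e1 s t) - integral {0..1} (e1 s t)) + (integral\<^sup>L M (e2 s t) - integral {0..1} (e2 s t)))\<bar>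
         \<le> 2 * \<bar>trap_coeff a b s\<bar> * \<bar>trap_coeff a' b' t\<bar> * (norm (fourier M (of_int (int (s * p) + int (t * q)))) +
        (if s * p = t * q then 0 else norm (fourier M (of_int (int (s * p) - int (t * q))))))"
        unfolding abs_mult by (simp add: w_def abs_mult)
    qed
    also have "\<dots> \<le> B" by (rule B)
    finally show ?thesis .
  qed
  have "\<bar>integral\<^sup>L M G - integral {0..1} G\<bar> \<le> B"
    by (rule LIMSEQ_le_const2[OF tendsto_rabs[OF tendsto_diff[OF limM limL]]]) (use diff in auto)
  moreover have "\<bar>integral {0..1} G\<bar> \<le> real (gcd p q) * ((a' + b') / real q)"
    unfolding G_def by (rule lebesgue_covariance_trap) (use assms in auto)
  \<comment> \<open>The same estimate with the two factors exchanged; having both gives the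
    minimum.\<close>
  moreover have "\<bar>integral {0..1} G\<bar> \<le> real (gcd p q) * ((a + b) / real p)"
    using lebesgue_covariance_trap[OF ab'(2) ab q p, of \<gamma>] unfolding G_def by (simp add: mult.commute gcd.commute)
  ultimately show ?thesis unfolding G_def min_def by auto
qed

lemma mean_trap:
  assumes M: "prob_space M" "sets M = sets borel" and ab: "0 \<le> a" "a < b" and q: "q \<ge> 1"
    and B: "\<And>K. (\<Sum>k=1..K. 2 * \<bar>trap_coeff a b k\<bar> * norm (fourier M (real (k * q)))) \<le> B"
  shows "\<bar>\<integral>x. trap a b (real q * x - \<gamma>) - (a + b) \<partial>M\<bar> \<le> B"
proof -
  interpret prob_space M by fact
  define F where "F K x = trap_poly K a b (real q * x - \<gamma>)" for K x
  define G where "G x = trap a b (real q * x - \<gamma>) - (a + b)" for x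
  obtain C where C: "0 \<le> C" "\<And>K y. \<bar>trap_poly K a b y\<bar> \<le> C" using trap_poly_bounded[OF ab] by blast
  have FG: "(\<lambda>K. F K x) \<longlonglongrightarrow> G x" for x
    unfolding F_def G_def by (intro tendsto_mult trap_poly_tendsto ab)
  have contF: "continuous_on A (F K)" and contG: "continuous_on A G" for A K
    unfolding F_def G_def by (intro continuous_intros)+
  have meas: "f \<in> borel_measurable M" if "continuous_on UNIV f" for f :: "real \<Rightarrow> real"
    unfolding measurable_cong_sets[OF M(2) refl] by (intro borel_measurable_continuous_onI that)
  have limM: "(\<lambda>K. integral\<^sup>L M (F K)) \<longlonglongrightarrow> integral\<^sup>L M G"
    by (rule integral_dominated_convergence[where w="\<lambda>_. C"])
      (use meas contF contG FG C in \<open>auto simp: F_def\<close>)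
  have bd: "\<bar>integral\<^sup>L M (F K)\<bar> \<le> B" for K
  proof -
    define e where "e k x = cos (2 * pi * (real (k * q) * x - real k * \<gamma>))" for k x
    have ce: "continuous_on A (e k)" for A k unfolding e_def by (intro continuous_intros)
    have ie: "integrable M (e k)" for k
      by (rule integrable_const_bound[where B=1]) (use meas ce in \<open>auto simp: e_def\<close>)
    have Fe: "F K x = (\<Sum>k=1..K. 2 * trap_coeff a b k * e k x)" for x
      unfolding F_def trap_poly_def e_def by (simp add: algebra_simps)
    have "integral\<^sup>L M (F K) = (\<Sum>k=1..K. 2 * trap_coeff a b k * integral\<^sup>L M (e k))"
      unfolding Fe using ie by simp
    also have "\<bar>\<dots>\<bar> \<le> (\<Sum>k=1..K. \<bar>2 * trap_coeff a b k * integral\<^sup>L M (e k)\<bar>)" by (rule sum_abs)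
    also have "\<dots> \<le> (\<Sum>k=1..K. 2 * \<bar>trap_coeff a b k\<bar> * norm (fourier M (real (k * q))))"
      unfolding abs_mult e_def by (intro sum_mono mult_mono abs_integral_cos_le_fourier M) auto
    also have "\<dots> \<le> B" by (rule B)
    finally show ?thesis .
  qed
  show ?thesis unfolding G_def[symmetric]
    by (rule LIMSEQ_le_const2[OF tendsto_rabs[OF limM]]) (use bd in auto)
qed

section \<open>Sums over pairs of frequencies\<close>

lemma sum_inverse_squares_tail:
  assumes "J \<ge> 1"
  shows "(\<Sum>s\<in>{J<..K}. 1 / (real s)\<^sup>2) \<le> 1 / real J"
proof (cases "J \<le> K")
  case True
  have "(\<Sum>s\<in>{J<..K}. 1 / (real s)\<^sup>2) \<le> 1 / real J - 1 / real K" using True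
  proof (induction K rule: dec_induct)
    case (step n)
    have "{J<..Suc n} = insert (Suc n) {J<..n}" using step by auto
    then have "(\<Sum>s\<in>{J<..Suc n}. 1 / (real s)\<^sup>2) \<le> 1 / real J - 1 / real n + 1 / (real (Suc n))\<^sup>2"
      using step by simp
    also have "1 / (real (Suc n))\<^sup>2 \<le> 1 / real n - 1 / real (Suc n)"
    proof -
      have n: "real n > 0" using step assms by simp
      then have "1 / real n - 1 / real (Suc n) = 1 / (real n * real (Suc n))" by (simp add: field_simps)
      moreover have "1 / (real (Suc n))\<^sup>2 \<le> 1 / (real n * real (Suc n))"
        unfolding power2_eq_square using n by (intro divide_left_mono mult_right_mono mult_pos_pos) auto
      ultimately show ?thesis by simp
    qed
    finally show ?case by simp
  qed simp
  moreover have "1 / real K \<ge> 0" by simp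
  ultimately show ?thesis by linarith
qed simp

text \<open>For each \<open>s\<close> at most one frequency \<open>s p - t q\<close> is shorter than \<open>q / 2\<close>; it is either of size
  at least \<open>X\<close> or, by separation, forces \<open>s > J\<close>.\<close>

lemma frequency_sum_bound:
  fixes F :: "int \<Rightarrow> real" and X :: real and c c' :: "nat \<Rightarrow> real"
  assumes p: "p \<ge> 1" and q: "q \<ge> 1" and F: "\<And>r. 0 \<le> F r" "\<And>r. F r \<le> 1"
    and c: "\<And>s. 0 \<le> c s" "\<And>s. s \<ge> 1 \<Longrightarrow> c s \<le> W / (real s)\<^sup>2" "(\<Sum>s=1..K. c s) \<le> L"
    and c': "\<And>t. 0 \<le> c' t" "\<And>t. t \<ge> 1 \<Longrightarrow> c' t \<le> l" "(\<Sum>t=1..K. c' t) \<le> L'"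
    and W: "0 \<le> W" and l: "0 \<le> l" and uv: "0 \<le> u" "0 \<le> v" and J: "J \<ge> 1"
    and far: "\<And>r. real q / 2 \<le> \<bar>of_int r\<bar> \<Longrightarrow> F r \<le> u"
    and mid: "\<And>r. X \<le> \<bar>of_int r\<bar> \<Longrightarrow> F r \<le> v"
    and sep: "\<And>s t. 1 \<le> s \<Longrightarrow> 1 \<le> t \<Longrightarrow> s * p \<noteq> t * q \<Longrightarrow> of_int \<bar>int (s * p) - int (t * q)\<bar> < X \<Longrightarrow> s > J"
  shows "(\<Sum>s=1..K. \<Sum>t=1..K. 2 * c s * c' t * (F (int (s * p) + int (t * q)) +
        (if s * p = t * q then 0 else F (int (s * p) - int (t * q))))) \<le> 4 * u * L * L' + 2 * l * (v * L + W / real J)"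
proof -
  define near where "near s t \<longleftrightarrow> of_int \<bar>int (s * p) - int (t * q)\<bar> < real q / 2" for s t
  have "0 \<le> (\<Sum>s=1..K. c s)" "0 \<le> (\<Sum>t=1..K. c' t)" by (auto intro!: sum_nonneg c c')
  then have L0: "0 \<le> L" "0 \<le> L'" using c(3) c'(3) by linarith+
  have bound: "2 * c s * c' t * (F (int (s * p) + int (t * q)) + (if s * p = t * q then 0 else F (int (s * p) - int (t * q))))
     \<le> 4 * u * (c s * c' t) + (if near s t then 2 * l * (c s * (v + (if s > J then 1 else 0))) else 0)"
    if st: "s \<in> {1..K}" "t \<in> {1..K}" for s t
  proof -
    define f1 f2 where "f1 = F (int (s * p) + int (t * q))" and "f2 = (if s * p = t * q then 0 else F (int (s * p) - int (t * q)))"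
    have cc: "0 \<le> c s * c' t" using c c' by simp
    have f1: "f1 \<le> u" unfolding f1_def
    proof (rule far)
      have "q \<le> t * q" using st by simp
      then show "real q / 2 \<le> \<bar>of_int (int (s * p) + int (t * q))\<bar>" by linarith
    qed
    show ?thesis
    proof (cases "near s t")
      case False
      then have "f2 \<le> u" unfolding f2_def near_def using uv far by auto
      then have "c s * c' t * (f1 + f2) \<le> c s * c' t * (2 * u)" using f1 cc by (intro mult_left_mono) auto
      moreover have "2 * c s * c' t * (f1 + f2) = 2 * (c s * c' t * (f1 + f2))" by simp
      moreover have "c s * c' t * (2 * u) = 2 * (u * (c s * c' t))" "4 * u * (c s * c' t) = 4 * (u * (c s * c' t))" by simp_all
      ultimately have "2 * c s * c' t * (f1 + f2) \<le> 4 * u * (c s * c' t)" by linarith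
      then show ?thesis using False unfolding f1_def[symmetric] f2_def[symmetric] by simp
    next
      case True
      have f2: "f2 \<le> v + (if s > J then 1 else 0)"
      proof (cases "s * p = t * q \<or> X \<le> of_int \<bar>int (s * p) - int (t * q)\<bar>")
        case True
        then have "f2 \<le> v" unfolding f2_def using uv mid[of "int (s * p) - int (t * q)"] by auto
        then show ?thesis by simp
      next
        case False
        then have "s > J" using sep[of s t] st by auto
        moreover have "f2 \<le> 1" using F by (simp add: f2_def)
        ultimately show ?thesis using uv by simp
      qed
      have "c s * c' t * f1 \<le> c s * c' t * u" using f1 cc by (intro mult_left_mono)
      moreover have "c s * c' t * f2 \<le> c s * l * (v + (if s > J then 1 else 0))"
        using c(1)[of s] c'(1,2)[of t] st f2 uv F by (intro mult_mono) (auto simp: f2_def)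
      moreover have "0 \<le> c s * c' t * u" using cc uv by simp
      moreover have "2 * (x + y) \<le> 4 * z + 2 * w" if "x \<le> z" "y \<le> w" "0 \<le> z" for x y z w :: real
        using that by argo
      ultimately have "2 * (c s * c' t * f1 + c s * c' t * f2) \<le> 4 * (c s * c' t * u) + 2 * (c s * l * (v + (if s > J then 1 else 0)))"
        by blast
      then show ?thesis using True unfolding f1_def[symmetric] f2_def[symmetric] by (simp add: algebra_simps)
    qed
  qed
  have one: "card {t \<in> {1..K}. near s t} \<le> 1" for s
  proof -
    have "t = t'" if "near s t" "near s t'" for t t'
    proof (rule ccontr)
      assume "t \<noteq> t'"
      then have "1 \<le> \<bar>int t - int t'\<bar>" by linarith
      then have "1 * int q \<le> \<bar>int t - int t'\<bar> * int q" by (intro mult_right_mono) auto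
      also have "\<dots> = \<bar>int (t * q) - int (t' * q)\<bar>" by (simp add: left_diff_distrib[symmetric] abs_mult)
      finally have "real q \<le> of_int \<bar>int (t * q) - int (t' * q)\<bar>" by linarith
      then show False using that unfolding near_def by linarith
    qed
    then show ?thesis by (auto simp: card_le_Suc0_iff_eq)
  qed
  have nearsum: "(\<Sum>s=1..K. \<Sum>t=1..K. if near s t then 2 * l * (c s * (v + (if s > J then 1 else 0))) else 0)
     \<le> (\<Sum>s=1..K. 2 * l * (c s * (v + (if s > J then 1 else 0))))"
  proof (rule sum_mono)
    fix s
    have "(\<Sum>t=1..K. if near s t then 2 * l * (c s * (v + (if s > J then 1 else 0))) else 0)
      = real (card {t \<in> {1..K}. near s t}) * (2 * l * (c s * (v + (if s > J then 1 else 0))))"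
      by (subst sum.inter_filter[symmetric]) auto
    also have "\<dots> \<le> 1 * (2 * l * (c s * (v + (if s > J then 1 else 0))))"
      using one[of s] l uv c(1)[of s] by (intro mult_right_mono) auto
    finally show "(\<Sum>t=1..K. if near s t then 2 * l * (c s * (v + (if s > J then 1 else 0))) else 0) \<le> 2 * l * (c s * (v + (if s > J then 1 else 0)))" by simp
  qed
  have "(\<Sum>s=1..K. if s > J then c s else 0) = (\<Sum>s\<in>{J<..K}. c s)"
    using J by (subst sum.inter_filter[symmetric]) (auto intro!: sum.cong)
  also have "\<dots> \<le> (\<Sum>s\<in>{J<..K}. W * (1 / (real s)\<^sup>2))"
    using J by (intro sum_mono) (auto simp: c(2))
  also have "\<dots> \<le> W * (1 / real J)"
    unfolding sum_distrib_left[symmetric] using W sum_inverse_squares_tail[OF J] by (intro mult_left_mono)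
  finally have tail: "(\<Sum>s=1..K. if s > J then c s else 0) \<le> W * (1 / real J)" .
  have "(\<Sum>s=1..K. 2 * l * (c s * (v + (if s > J then 1 else 0)))) = 2 * l * (v * (\<Sum>s=1..K. c s) + (\<Sum>s=1..K. if s > J then c s else 0))"
    unfolding sum_distrib_left sum.distrib[symmetric] by (intro sum.cong refl) (simp add: algebra_simps)
  also have "\<dots> \<le> 2 * l * (v * L + W * (1 / real J))"
    using uv l c(3) tail by (intro mult_left_mono add_mono) auto
  finally have nearsum': "(\<Sum>s=1..K. 2 * l * (c s * (v + (if s > J then 1 else 0)))) \<le> 2 * l * (v * L + W * (1 / real J))" .
  have "(\<Sum>s=1..K. \<Sum>t=1..K. 2 * c s * c' t * (F (int (s * p) + int (t * q)) +
        (if s * p = t * q then 0 else F (int (s * p) - int (t * q)))))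
      \<le> (\<Sum>s=1..K. \<Sum>t=1..K. 4 * u * (c s * c' t) + (if near s t then 2 * l * (c s * (v + (if s > J then 1 else 0))) else 0))"
    by (intro sum_mono bound)
  also have "\<dots> = 4 * u * ((\<Sum>s=1..K. c s) * (\<Sum>t=1..K. c' t)) + (\<Sum>s=1..K. \<Sum>t=1..K. if near s t then 2 * l * (c s * (v + (if s > J then 1 else 0))) else 0)"
    unfolding sum.distrib sum_product by (simp only: sum_distrib_left)
  also have "\<dots> \<le> 4 * u * (L * L') + 2 * l * (v * L + W * (1 / real J))"
    using uv c c' L0 by (intro add_mono mult_left_mono mult_mono sum_nonneg order_trans[OF nearsum nearsum']) auto
  finally show ?thesis by (simp add: mult.assoc)
qed

section \<open>The method of Gal and Koksma\<close>

text \<open>Besides single terms only left halves enter: an initial segment of a dyadic block splits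
  into left halves and at most one single term.\<close>

fun dyadic_squares :: "nat \<Rightarrow> nat \<Rightarrow> (nat \<Rightarrow> real) \<Rightarrow> real" where
  "dyadic_squares a 0 y = (y a)\<^sup>2"
| "dyadic_squares a (Suc r) y =
     dyadic_squares a r y + dyadic_squares (a + 2 ^ r) r y + (\<Sum>i=a..<a + 2 ^ r. y i)\<^sup>2"

lemma dyadic_squares_nonneg: "0 \<le> dyadic_squares a r y"
  by (induction r arbitrary: a) auto

text \<open>Rademacher--Menshov chaining, done pathwise.\<close>

lemma partial_sum_le_dyadic_squares:
  "k \<le> 2 ^ r \<Longrightarrow> (\<Sum>i=a..<a + k. y i)\<^sup>2 \<le> real (r + 1) * dyadic_squares a r y"
proof (induction r arbitrary: a k)
  case 0
  then have "k = 0 \<or> k = 1" by auto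
  then show ?case by auto
next
  case (Suc r)
  let ?A = "\<Sum>i=a..<a + 2 ^ r. y i"
  note nn = dyadic_squares_nonneg[of a r y] dyadic_squares_nonneg[of "a + 2 ^ r" r y]
  show ?case
  proof (cases "k \<le> 2 ^ r")
    case True
    have "(\<Sum>i=a..<a + k. y i)\<^sup>2 \<le> real (r + 1) * dyadic_squares a r y" by (rule Suc.IH[OF True])
    also have "\<dots> \<le> real (Suc r + 1) * dyadic_squares a (Suc r) y"
      using nn by (intro mult_mono) auto
    finally show ?thesis .
  next
    case False
    define l where "l = k - 2 ^ r"
    have l: "k = 2 ^ r + l" "l \<le> 2 ^ r" using False Suc.prems by (auto simp: l_def)
    define B where "B = (\<Sum>i=a + 2 ^ r..<a + 2 ^ r + l. y i)"
    define n where "n = real (r + 1)"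
    have n: "n > 0" by (simp add: n_def)
    have "(\<Sum>i=a..<a + k. y i) = ?A + B"
      unfolding B_def l(1) by (subst sum.atLeastLessThan_concat) (auto simp: add.assoc)
    \<comment> \<open>Cauchy-Schwarz with weights 1 and n, chosen so that the constant grows only
      from n to n + 1 per level.\<close>
    moreover have "(?A + B)\<^sup>2 \<le> (n + 1) * (?A\<^sup>2 + B\<^sup>2 / n)"
    proof -
      have "(n + 1) * (?A\<^sup>2 + B\<^sup>2 / n) - (?A + B)\<^sup>2 = (n * ?A - B)\<^sup>2 / n"
        using n by (simp add: field_simps power2_eq_square)
      moreover have "(n * ?A - B)\<^sup>2 / n \<ge> 0" using n by simp
      ultimately show ?thesis by linarith
    qed
    moreover have "B\<^sup>2 / n \<le> dyadic_squares (a + 2 ^ r) r y"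
      using Suc.IH[OF l(2), of "a + 2 ^ r"] n by (simp add: B_def n_def field_simps)
    then have "(n + 1) * (?A\<^sup>2 + B\<^sup>2 / n) \<le> (n + 1) * dyadic_squares a (Suc r) y"
      using n nn by (intro mult_left_mono) auto
    moreover have "real (Suc r + 1) = n + 1" by (simp add: n_def)
    ultimately show ?thesis by (metis order_trans)
  qed
qed

text \<open>Bounding by increments of U makes each level telescope: disjoint blocks of one level
  contribute at most U (a + 2 ^ r) - U a, and there are r + 1 levels, counting the single
  terms.\<close>

lemma integral_dyadic_squares:
  assumes int: "\<And>a b. integrable M (\<lambda>x. (\<Sum>i=a..<b. Y i x)\<^sup>2)"
    and bd: "\<And>a b. a \<le> b \<Longrightarrow> (\<integral>x. (\<Sum>i=a..<b. Y i x)\<^sup>2 \<partial>M) \<le> U b - U a"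
  shows "integrable M (\<lambda>x. dyadic_squares a r (\<lambda>i. Y i x)) \<and>
    (\<integral>x. dyadic_squares a r (\<lambda>i. Y i x) \<partial>M) \<le> real (r + 1) * (U (a + 2 ^ r) - U a)"
proof (induction r arbitrary: a)
  case 0
  show ?case using int[of a "Suc a"] bd[of a "Suc a"] by simp
next
  case (Suc r)
  let ?b = "a + 2 ^ r" and ?c = "a + 2 ^ Suc r"
  have c: "?b + 2 ^ r = ?c" by simp
  have i: "integrable M (\<lambda>x. dyadic_squares a r (\<lambda>i. Y i x))" "integrable M (\<lambda>x. dyadic_squares ?b r (\<lambda>i. Y i x))"
    using Suc by blast+
  have "0 \<le> (\<integral>x. (\<Sum>i=?b..<?c. Y i x)\<^sup>2 \<partial>M)" by simp
  also have "\<dots> \<le> U ?c - U ?b" by (rule bd) simp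
  finally have mono: "U ?b \<le> U ?c" by simp
  have "(\<integral>x. dyadic_squares a (Suc r) (\<lambda>i. Y i x) \<partial>M) =
     (\<integral>x. dyadic_squares a r (\<lambda>i. Y i x) \<partial>M) + (\<integral>x. dyadic_squares ?b r (\<lambda>i. Y i x) \<partial>M)
     + (\<integral>x. (\<Sum>i=a..<?b. Y i x)\<^sup>2 \<partial>M)"
    using i int by simp
  also have "\<dots> \<le> real (r + 1) * (U ?b - U a) + real (r + 1) * (U ?c - U ?b) + (U ?b - U a)"
    using Suc.IH[of a] Suc.IH[of ?b] bd[of a ?b] unfolding c by (intro add_mono) auto
  also have "\<dots> \<le> real (Suc r + 1) * (U ?c - U a)"
    using mono by (simp add: algebra_simps)
  finally show ?case using i int by simp
qed

text \<open>The sum of all g r has finite integral, hence is finite almost everywhere, and it bounds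
  every term.\<close>

lemma AE_bounded_of_summable_integrals:
  fixes g :: "nat \<Rightarrow> 'a \<Rightarrow> real"
  assumes int: "\<And>r. integrable M (g r)" and nn: "\<And>r x. 0 \<le> g r x"
    and le: "\<And>r. integral\<^sup>L M (g r) \<le> c r" and c: "summable c"
  shows "AE x in M. \<exists>K. \<forall>r. g r x \<le> K"
proof -
  have c0: "0 \<le> c r" for r using le[of r] Bochner_Integration.integral_nonneg[of M "g r"] nn by fastforce
  have "(\<integral>\<^sup>+x. (\<Sum>r. ennreal (g r x)) \<partial>M) = (\<Sum>r. \<integral>\<^sup>+x. ennreal (g r x) \<partial>M)"
    using int by (intro nn_integral_suminf) auto
  also have "\<dots> \<le> (\<Sum>r. ennreal (c r))"
    using nn_integral_eq_integral[OF int] nn le by (intro suminf_le) (auto simp: ennreal_leI)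
  also have "\<dots> < top" using c c0 by (simp add: suminf_ennreal_eq less_top[symmetric] suminf_ennreal_eq[OF c0 summable_sums[OF c]])
  finally have "AE x in M. (\<Sum>r. ennreal (g r x)) \<noteq> \<infinity>"
    using int by (intro nn_integral_PInf_AE) (auto simp: top.not_eq_extremum)
  then show ?thesis
  proof eventually_elim
    case (elim x)
    then have s: "(\<Sum>r. ennreal (g r x)) < top" by (simp add: top.not_eq_extremum)
    have "g r x \<le> enn2real (\<Sum>r. ennreal (g r x))" for r
    proof -
      have "ennreal (g r x) \<le> (\<Sum>r. ennreal (g r x))"
        using sum_le_suminf[of "\<lambda>r. ennreal (g r x)" "{r}"] by simp
      then have "enn2real (ennreal (g r x)) \<le> enn2real (\<Sum>r. ennreal (g r x))"
        using s by (intro enn2real_mono) auto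
      then show ?thesis using nn by simp
    qed
    then show ?case by blast
  qed
qed

text \<open>Variances are known only through the weights \<phi>, so time is measured by their sum.
  The deviation is first bounded at the indices T j with j <= 2 ^ r, where its square is at most a
  multiple of (r + 1) ^ 4 * 2 ^ r: one factor r + 1 comes from the pathwise chaining, one from the
  expectation, two from summability over r. In between, the sums of f and of lam are monotone and
  the latter grows by a bounded amount.\<close>

lemma gal_koksma:
  fixes f :: "nat \<Rightarrow> 'a \<Rightarrow> real" and lam \<phi> :: "nat \<Rightarrow> real"
  assumes "prob_space M"
    and meas: "\<And>n. f n \<in> borel_measurable M"
    and f: "\<And>n x. 0 \<le> f n x" "\<And>n x. f n x \<le> H"
    and lam: "\<And>n. 0 \<le> lam n" "\<And>n. lam n \<le> L" "\<And>n. lam n \<le> \<phi> n"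
    and var: "\<And>a b. a \<le> b \<Longrightarrow> (\<integral>x. (\<Sum>n\<in>{a<..b}. f n x - lam n)\<^sup>2 \<partial>M) \<le> (\<Sum>n\<in>{a<..b}. \<phi> n)"
    and unbounded: "\<And>B. \<exists>N. B < (\<Sum>n=1..N. \<phi> n)"
  shows "AE x in M. \<exists>K. \<forall>N. \<bar>\<Sum>n=1..N. f n x - lam n\<bar> \<le>
     K * (sqrt ((\<Sum>n=1..N. \<phi> n) + 1) * (ln ((\<Sum>n=1..N. \<phi> n) + 2))\<^sup>2)"
proof -
  interpret prob_space M by fact
  have phi: "0 \<le> \<phi> n" for n using lam(1,3) order_trans by blast
  have H: "0 \<le> H" using f[of 0] order_trans by blast
  have L: "0 \<le> L" using lam(1,2) order_trans by blast
  define \<Phi> where "\<Phi> N = (\<Sum>n=1..N. \<phi> n)" for N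
  have split: "(\<Sum>n=1..b. g n) = (\<Sum>n=1..a. g n) + (\<Sum>n\<in>{a<..b}. g n)" if "a \<le> b" for a b and g :: "nat \<Rightarrow> real"
  proof -
    have "{1..b} = {1..a} \<union> {a<..b}" using that by auto
    then show ?thesis by (simp only:) (rule sum.union_disjoint, auto)
  qed
  have Pmono: "\<Phi> a \<le> \<Phi> b" if "a \<le> b" for a b
    using split[OF that, of \<phi>] phi by (simp add: \<Phi>_def sum_nonneg)
  have P0: "0 \<le> \<Phi> N" for N using phi by (simp add: \<Phi>_def sum_nonneg)
  have fin: "finite {n. \<Phi> n \<le> real j}" for j
  proof -
    obtain N where N: "real j < \<Phi> N" using unbounded \<Phi>_def by auto
    have "{n. \<Phi> n \<le> real j} \<subseteq> {..<N}"
      using N Pmono by (auto simp: not_less[symmetric]) (meson leI order_trans not_less)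
    then show ?thesis using finite_subset by blast
  qed
  have ne: "0 \<in> {n. \<Phi> n \<le> real j}" for j by (simp add: \<Phi>_def)
  \<comment> \<open>The last index at which the sum of the weights is at most j. The set is finite
    because these sums are unbounded, and it contains 0, where the sum is empty.\<close>
  define T where "T j = Max {n. \<Phi> n \<le> real j}" for j
  have T1: "\<Phi> (T j) \<le> real j" for j
    using Max_in[OF fin[of j]] ne[of j] unfolding T_def by blast
  have T2: "n \<le> T j" if "\<Phi> n \<le> real j" for n j
    unfolding T_def using fin that by (intro Max_ge) auto
  have Tmono: "T i \<le> T j" if "i \<le> j" for i j
    using T1[of i] that by (intro T2) linarith
  define S where "S N x = (\<Sum>n=1..N. f n x - lam n)" for N x
  define Y where "Y j x = S (T (Suc j)) x - S (T j) x" for j x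
  have Ysum: "(\<Sum>j=a..<b. Y j x) = S (T b) x - S (T a) x" if "a \<le> b" for a b x
    unfolding Y_def by (rule sum_Suc_diff'[OF that])
  have Ssub: "S (T b) x - S (T a) x = (\<Sum>n\<in>{T a<..T b}. f n x - lam n)" if "a \<le> b" for a b x
    unfolding S_def using split[OF Tmono[OF that]] by simp
  have bnd: "\<bar>f n x - lam n\<bar> \<le> H + L" for n x
    using f[of n x] f(1)[of n x] lam(1,2)[of n] by linarith
  have int: "integrable M (\<lambda>x. (\<Sum>n\<in>A. f n x - lam n)\<^sup>2)" if "finite A" for A
  proof (rule integrable_const_bound[where B="(real (card A) * (H + L))\<^sup>2"])
    have "\<bar>\<Sum>n\<in>A. f n x - lam n\<bar> \<le> real (card A) * (H + L)" for x
      using sum_bounded_above[of A "\<lambda>n. \<bar>f n x - lam n\<bar>" "H + L"] bnd sum_abs[of "\<lambda>n. f n x - lam n" A]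
      by (auto intro: order_trans)
    then have "norm ((\<Sum>n\<in>A. f n x - lam n)\<^sup>2) \<le> (real (card A) * (H + L))\<^sup>2" for x
      using power_mono[of "\<bar>\<Sum>n\<in>A. f n x - lam n\<bar>" _ 2] by simp
    then show "AE x in M. norm ((\<Sum>n\<in>A. f n x - lam n)\<^sup>2) \<le> (real (card A) * (H + L))\<^sup>2" by simp
  qed (use meas in measurable)
  have int_Y: "integrable M (\<lambda>x. (\<Sum>i=a..<b. Y i x)\<^sup>2)" for a b
  proof (cases "a \<le> b")
    case True then show ?thesis unfolding Ysum[OF True] Ssub[OF True] by (intro int) simp
  qed simp
  have bd_Y: "(\<integral>x. (\<Sum>i=a..<b. Y i x)\<^sup>2 \<partial>M) \<le> \<Phi> (T b) - \<Phi> (T a)" if "a \<le> b" for a b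
    unfolding Ysum[OF that] Ssub[OF that] using var[OF Tmono[OF that]] split[OF Tmono[OF that], of \<phi>] by (simp add: \<Phi>_def)
  define Q where "Q r x = dyadic_squares 0 r (\<lambda>i. Y i x)" for r x
  have Q: "integrable M (Q r)" "integral\<^sup>L M (Q r) \<le> real (r + 1) * 2 ^ r" for r
  proof -
    note d = integral_dyadic_squares[of M Y "\<lambda>j. \<Phi> (T j)" 0 r, OF int_Y bd_Y]
    show "integrable M (Q r)" using d unfolding Q_def by blast
    have "integral\<^sup>L M (Q r) \<le> real (r + 1) * (\<Phi> (T (0 + 2 ^ r)) - \<Phi> (T 0))" using d unfolding Q_def by blast
    also have "\<dots> \<le> real (r + 1) * 2 ^ r"
      using T1[of "2 ^ r"] P0[of "T 0"] by (intro mult_left_mono) auto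
    finally show "integral\<^sup>L M (Q r) \<le> real (r + 1) * 2 ^ r" .
  qed
  \<comment> \<open>One factor r + 1 cancels the one in the bound for the expectation of Q r; the
    other two leave the summable 1 / (r + 1)^2.\<close>
  define d where "d r = real (r + 1) ^ 3 * 2 ^ r" for r
  have d: "d r > 0" for r by (simp add: d_def)
  have "AE x in M. \<exists>K. \<forall>r. Q r x / d r \<le> K"
  proof (rule AE_bounded_of_summable_integrals)
    show "summable (\<lambda>r. 1 / (real (r + 1))\<^sup>2)"
      using sums_summable[OF inverse_squares_sums] by (simp add: add.commute)
    show "(\<integral>x. Q r x / d r \<partial>M) \<le> 1 / (real (r + 1))\<^sup>2" for r
    proof -
      have "(\<integral>x. Q r x / d r \<partial>M) = integral\<^sup>L M (Q r) / d r" by simp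
      also have "\<dots> \<le> real (r + 1) * 2 ^ r / d r" using Q(2) d[of r] by (intro divide_right_mono) auto
      also have "\<dots> = 1 / (real (r + 1))\<^sup>2" by (simp add: d_def power2_eq_square power3_eq_cube)
      finally show ?thesis .
    qed
    show "0 \<le> Q r x / d r" for r x using d[of r] dyadic_squares_nonneg unfolding Q_def by simp
  qed (use Q in auto)
  then show ?thesis
  proof eventually_elim
    case (elim x)
    then obtain K where K: "\<And>r. Q r x / d r \<le> K" by blast
    have K0: "0 \<le> K" using K[of 0] d[of 0] dyadic_squares_nonneg[of 0 0 "\<lambda>i. Y i x"]
      by (simp add: Q_def) (metis divide_nonneg_pos order_trans zero_le_power2)
    \<comment> \<open>36 = 6^2, from r + 1 <= 6 * ln (j + 2): this holds because 2 ^ (r + 1) <= 4 *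
      (j + 1) <= (j + 2) ^ 3 and ln 2 >= 1 / 2.\<close>
    have ST: "\<bar>S (T j) x - S (T 0) x\<bar> \<le> sqrt K * 36 * (ln (real j + 2))\<^sup>2 * sqrt (2 * (real j + 1))" for j
    proof -
      define r where "r = (LEAST r. j \<le> 2 ^ r)"
      have ex: "j \<le> 2 ^ j" by (simp add: less_imp_le)
      have r1: "j \<le> 2 ^ r" unfolding r_def using ex by (rule LeastI)
      have r2: "(2::nat) ^ r \<le> 2 * (j + 1)"
      proof (cases r)
        case (Suc s)
        then have "\<not> j \<le> 2 ^ s" unfolding r_def using not_less_Least by (metis lessI)
        then show ?thesis using Suc by simp
      qed simp
      have r2': "(2::real) ^ r \<le> 2 * (real j + 1)"
      proof -
        have "real (2 ^ r) \<le> real (2 * (j + 1))" using r2 by (simp only: of_nat_le_iff)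
        then show ?thesis by simp
      qed
      have l2: "ln (2::real) \<ge> 1/2" using ln2_ge_two_thirds by simp
      have "real (r + 1) * ln 2 = ln (2 ^ (r + 1))" by (simp only: ln_realpow[of 2] zero_less_numeral)
      also have "\<dots> \<le> ln ((real j + 2) ^ 3)"
      proof (subst ln_le_cancel_iff)
        have "(2::real) ^ (r + 1) \<le> 4 * (real j + 1)" using r2' by simp
        also have "\<dots> \<le> (real j + 2) ^ 3" by (simp add: power3_eq_cube algebra_simps)
        finally show "(2::real) ^ (r + 1) \<le> (real j + 2) ^ 3" .
      qed auto
      also have "\<dots> = 3 * ln (real j + 2)" by (subst ln_realpow) auto
      finally have "real (r + 1) * (1/2) \<le> 3 * ln (real j + 2)"
        using l2 mult_left_mono[of "1/2" "ln 2" "real (r + 1)"] by linarith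
      then have r3: "real (r + 1) \<le> 6 * ln (real j + 2)" by simp
      have "(S (T j) x - S (T 0) x)\<^sup>2 \<le> real (r + 1) * Q r x"
        using partial_sum_le_dyadic_squares[OF r1, of "\<lambda>i. Y i x" 0] Ysum[of 0 j x] by (simp add: Q_def)
      also have "\<dots> \<le> real (r + 1) * (K * d r)"
        using K[of r] d[of r] by (intro mult_left_mono) (auto simp: divide_le_eq)
      also have "\<dots> = K * real (r + 1) ^ 4 * 2 ^ r" by (simp add: d_def power3_eq_cube power4_eq_xxxx)
      also have "\<dots> \<le> K * (6 * ln (real j + 2)) ^ 4 * (2 * (real j + 1))"
        using K0 r3 r2' by (intro mult_mono power_mono) auto
      finally have "sqrt ((S (T j) x - S (T 0) x)\<^sup>2) \<le> sqrt (K * (6 * ln (real j + 2)) ^ 4 * (2 * (real j + 1)))"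
        by (rule real_sqrt_le_mono)
      also have "\<dots> = sqrt K * sqrt ((36 * (ln (real j + 2))\<^sup>2)\<^sup>2) * sqrt (2 * (real j + 1))"
        by (simp add: real_sqrt_mult power2_eq_square power4_eq_xxxx)
      also have "sqrt ((36 * (ln (real j + 2))\<^sup>2)\<^sup>2) = 36 * (ln (real j + 2))\<^sup>2"
        by (rule real_sqrt_unique) auto
      finally show ?thesis by (simp add: mult.assoc)
    qed
    define c where "c = (\<Sum>n=1..T 0. \<bar>f n x - lam n\<bar>)"
    define R where "R N = sqrt (\<Phi> N + 1) * (ln (\<Phi> N + 2))\<^sup>2" for N
    have R: "1/4 \<le> R N" for N
    proof -
      have "1/2 \<le> ln (2::real)" using ln2_ge_two_thirds by simp
      also have "\<dots> \<le> ln (\<Phi> N + 2)" using P0[of N] by (subst ln_le_cancel_iff) auto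
      finally have "(1/2)\<^sup>2 \<le> (ln (\<Phi> N + 2))\<^sup>2" by (intro power_mono) auto
      moreover have "1 \<le> sqrt (\<Phi> N + 1)" using P0[of N] by simp
      ultimately have "1 * (1/2)\<^sup>2 \<le> R N" unfolding R_def by (intro mult_mono) auto
      then show ?thesis by (simp add: power2_eq_square)
    qed
    have c0: "c \<ge> 0" by (simp add: c_def sum_nonneg)
    have Sc: "\<bar>S N x\<bar> \<le> c" if "N \<le> T 0" for N
    proof -
      have "\<bar>S N x\<bar> \<le> (\<Sum>n=1..N. \<bar>f n x - lam n\<bar>)" unfolding S_def by (rule sum_abs)
      also have "\<dots> \<le> c" unfolding c_def using that by (intro sum_mono2) auto
      finally show ?thesis .
    qed
    \<comment> \<open>Since R N >= 1 / 4, constants are absorbed at the price of a factor 4. The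
      number 288 = 36 * 2^2 * 2 arises when j + 2 is replaced by (\<Phi> N + 2)^2 in the logarithm
      and 2 * (j + 1) by 4 * (\<Phi> N + 1) under the root.\<close>
    have "\<bar>S N x\<bar> \<le> (4 * (c + L + 1) + 288 * sqrt K) * R N" for N
    proof (cases "N \<le> T 0")
      case True
      have "\<bar>S N x\<bar> \<le> 4 * c * (1/4)" using Sc[OF True] by simp
      also have "\<dots> \<le> 4 * c * R N" using R c0 by (intro mult_left_mono) auto
      also have "\<dots> \<le> (4 * (c + L + 1) + 288 * sqrt K) * R N"
        using L K0 R[of N] by (intro mult_right_mono) auto
      finally show ?thesis .
    next
      case False
      then have pos: "\<Phi> N > 0" using T2[of N 0] by force
      \<comment> \<open>Ceiling minus one makes the inequality i < \<Phi> N strict while \<Phi> N <=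
        i + 1; this places N between T i and T (Suc i).\<close>
      define i where "i = nat (\<lceil>\<Phi> N\<rceil> - 1)"
      have i: "real i < \<Phi> N" "\<Phi> N \<le> real i + 1"
        using pos unfolding i_def by (auto simp: of_nat_nat) linarith+
      have NT: "N \<le> T (Suc i)" using i by (intro T2) simp
      have TN: "T i \<le> N"
      proof (rule ccontr)
        assume "\<not> T i \<le> N"
        then have "\<Phi> N \<le> \<Phi> (T i)" by (intro Pmono) simp
        then show False using T1[of i] i by linarith
      qed
      \<comment> \<open>The term right after T i crosses level i and its weight may be large, so
        there lam is bounded by L. The weights that follow, up to level i + 1, add up to at most
        1.\<close>
      have lsum: "(\<Sum>n\<in>{T i<..T (Suc i)}. lam n) \<le> L + 1"
      proof (cases "T i = T (Suc i)")
        case False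
        then have lt: "T i < T (Suc i)" using Tmono[of i "Suc i"] by simp
        have "{T i<..T (Suc i)} = insert (T i + 1) {T i + 1<..T (Suc i)}" using lt by auto
        then have "(\<Sum>n\<in>{T i<..T (Suc i)}. lam n) = lam (T i + 1) + (\<Sum>n\<in>{T i + 1<..T (Suc i)}. lam n)" by simp
        also have "\<dots> \<le> L + (\<Sum>n\<in>{T i + 1<..T (Suc i)}. \<phi> n)"
          using lam by (intro add_mono sum_mono) auto
        also have "(\<Sum>n\<in>{T i + 1<..T (Suc i)}. \<phi> n) = \<Phi> (T (Suc i)) - \<Phi> (T i + 1)"
          using split[of "T i + 1" "T (Suc i)" \<phi>] lt by (simp add: \<Phi>_def)
        also have "\<dots> \<le> 1" using T1[of "Suc i"] T2[of "T i + 1" i] by force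
        finally show ?thesis by simp
      qed (use L in simp)
      have fnn: "0 \<le> (\<Sum>n\<in>A. f n x)" "0 \<le> (\<Sum>n\<in>A. lam n)" for A by (auto intro!: sum_nonneg f lam)
      have part: "{T i<..T (Suc i)} = {T i<..N} \<union> {N<..T (Suc i)}" "{T i<..N} \<inter> {N<..T (Suc i)} = {}"
        using NT TN by auto
      have lp: "(\<Sum>n\<in>{T i<..N}. lam n) \<le> L + 1" "(\<Sum>n\<in>{N<..T (Suc i)}. lam n) \<le> L + 1"
        using lsum fnn(2)[of "{T i<..N}"] fnn(2)[of "{N<..T (Suc i)}"] unfolding part(1) by (simp_all add: sum.union_disjoint part(2))
      have up: "S N x \<le> S (T (Suc i)) x + (L + 1)"
        using split[OF NT, of "\<lambda>n. f n x - lam n"] fnn(1)[of "{N<..T (Suc i)}"] lp(2) by (simp add: S_def sum_subtractf)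
      have lo: "S (T i) x - (L + 1) \<le> S N x"
        using split[OF TN, of "\<lambda>n. f n x - lam n"] fnn(1)[of "{T i<..N}"] lp(1) by (simp add: S_def sum_subtractf)
      have ST': "\<bar>S (T j) x\<bar> \<le> c + 288 * sqrt K * R N" if j: "j \<le> Suc i" for j
      proof -
        have jr: "real j \<le> \<Phi> N + 1" using j i by linarith
        have "ln (real j + 2) \<le> ln ((\<Phi> N + 2)\<^sup>2)"
        proof (subst ln_le_cancel_iff)
          have "(\<Phi> N + 2)\<^sup>2 = \<Phi> N * \<Phi> N + 4 * \<Phi> N + 4" by (simp add: power2_eq_square algebra_simps)
          then show "real j + 2 \<le> (\<Phi> N + 2)\<^sup>2" using jr pos zero_le_square[of "\<Phi> N"] by linarith
        qed (use pos in auto)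
        also have "\<dots> = 2 * ln (\<Phi> N + 2)" using pos by (subst ln_realpow) auto
        finally have "(ln (real j + 2))\<^sup>2 \<le> (2 * ln (\<Phi> N + 2))\<^sup>2" by (intro power_mono) auto
        moreover have "sqrt (2 * (real j + 1)) \<le> sqrt (4 * (\<Phi> N + 1))" using jr pos by simp
        then have "sqrt (2 * (real j + 1)) \<le> 2 * sqrt (\<Phi> N + 1)"
          by (simp only: real_sqrt_mult[of 4 "\<Phi> N + 1"] real_sqrt_four)
        ultimately have "sqrt K * 36 * (ln (real j + 2))\<^sup>2 * sqrt (2 * (real j + 1)) \<le> sqrt K * 36 * (2 * ln (\<Phi> N + 2))\<^sup>2 * (2 * sqrt (\<Phi> N + 1))"
          using K0 by (intro mult_mono) auto
        also have "\<dots> = 288 * sqrt K * R N" by (simp add: R_def power2_eq_square)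
        finally show ?thesis using ST[of j] Sc[of "T 0"] by linarith
      qed
      have "\<bar>S N x\<bar> \<le> c + 288 * sqrt K * R N + (L + 1)"
        using up lo ST'[of i] ST'[of "Suc i"] by linarith
      also have "\<dots> = 4 * (c + L + 1) * (1/4) + 288 * sqrt K * R N" by simp
      also have "\<dots> \<le> 4 * (c + L + 1) * R N + 288 * sqrt K * R N"
        using R c0 L by (intro add_right_mono mult_left_mono) auto
      finally show ?thesis by (simp add: algebra_simps)
    qed
    then show ?case unfolding S_def R_def \<Phi>_def by blast
  qed
qed

section \<open>Variance estimates for separated sequences\<close>

lemma norm_fourier_le_1:
  assumes "prob_space M"
  shows "norm (fourier M r) \<le> 1"
proof -
  interpret prob_space M by fact
  have "norm (fourier M r) \<le> (\<integral>x. norm (exp (- 2 * of_real pi * \<i> * of_real r * of_real x :: complex)) \<partial>M)"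
    unfolding fourier_def by (rule integral_norm_bound)
  also have "\<dots> = 1" by (simp add: norm_exp_eq_Re prob_space)
  finally show ?thesis .
qed

text \<open>The hypotheses of the theorem in quantitative form: \<open>\<tau>\<close> is \<open>A / B\<close>, lowered to at most 3, and
  the decay is expressed through the index \<open>n\<close> instead of the frequency.\<close>

locale separated_decay =
  fixes M :: "real measure" and q :: "nat \<Rightarrow> nat" and \<psi> :: "nat \<Rightarrow> real" and \<gamma> \<alpha> \<tau> \<kappa> :: real and n0 :: nat
  assumes prob: "prob_space M" and sets_M: "sets M = sets borel"
    and q_pos: "\<And>n. 1 \<le> n \<Longrightarrow> 1 \<le> q n"
    and psi_pos: "\<And>n. 1 \<le> n \<Longrightarrow> 0 < \<psi> (q n)" and psi_le: "\<And>n. 1 \<le> n \<Longrightarrow> \<psi> (q n) \<le> 1 / 2"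
    and tau: "2 < \<tau>" "\<tau> \<le> 3" and kappa: "0 \<le> \<kappa>" and n0: "2 \<le> n0"
    and decay: "\<And>n r. n0 \<le> n \<Longrightarrow> real (q n) powr \<alpha> \<le> \<bar>r\<bar> \<Longrightarrow> norm (fourier M r) \<le> \<kappa> * real n powr (- \<tau>)"
    and half: "\<And>n. n0 \<le> n \<Longrightarrow> real (q n) powr \<alpha> \<le> real (q n) / 2"
    and separated: "\<And>m n s t. n0 \<le> m \<Longrightarrow> m < n \<Longrightarrow> 1 \<le> s \<Longrightarrow> 1 \<le> t \<Longrightarrow> s * q m \<noteq> t * q n \<Longrightarrow>
      of_int \<bar>int (s * q m) - int (t * q n)\<bar> < real (q m) powr \<alpha> \<Longrightarrow> m ^ 12 < s"
begin

interpretation prob_space M by (rule prob)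

text \<open>Two coefficient sums cost n powr (8 * \<eta>), half of the excess \<tau> - 2: the
  exponent that is left, - \<tau> + 8 * \<eta> = - 1 - \<tau> / 2, is still below - 2.\<close>

definition \<eta> where "\<eta> = (\<tau> - 2) / 16"

definition Z where "Z = (\<Sum>k. real k powr (- 1 - \<eta>))"

lemma eta: "0 < \<eta>" "\<eta> < 1" using tau by (auto simp: \<eta>_def)

lemma Z_nonneg: "0 \<le> Z"
  unfolding Z_def using eta by (intro suminf_nonneg) (auto simp: summable_real_powr_iff)

text \<open>The floor n powr (-4) for the slope width is the product of two floors n powr (-2), one
  for \<psi> (q n) and one for the relative width.\<close>

lemma coeff_sum:
  assumes "n0 \<le> n" "0 \<le> a" "a < b" "real n powr (- 4) \<le> b - a"
  shows "(\<Sum>k=1..K. \<bar>trap_coeff a b k\<bar>) \<le> Z * real n powr (4 * \<eta>)"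
proof -
  have n: "real n > 0" using assms n0 by simp
  have "(\<Sum>k=1..K. \<bar>trap_coeff a b k\<bar>) \<le> Z * (b - a) powr (- \<eta>)"
    unfolding Z_def using assms eta by (intro trap_coeff_sum) auto
  also have "\<dots> \<le> Z * (real n powr (- 4)) powr (- \<eta>)"
    using assms n eta Z_nonneg by (intro mult_left_mono powr_mono2') auto
  also have "(real n powr (- 4)) powr (- \<eta>) = real n powr (4 * \<eta>)" by (simp add: powr_powr)
  finally show ?thesis .
qed

text \<open>The error has two shapes on purpose. The first part is uniform in m and, summed over m <
  n, is of order n powr (- \<tau> / 2). The second is summable over m and carries the mean a' + b',
  so it adds up to a multiple of \<psi> (q n).\<close>

lemma covariance_bound:
  assumes m: "n0 \<le> m" "m \<le> n" and ab: "0 \<le> a" "a < b" "b \<le> 1" "real m powr (- 4) \<le> b - a"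
    and ab': "0 \<le> a'" "a' < b'" "b' \<le> 1" "real n powr (- 4) \<le> b' - a'"
  shows "\<bar>\<integral>x. (trap a b (real (q m) * x - \<gamma>) - (a + b)) * (trap a' b' (real (q n) * x - \<gamma>) - (a' + b')) \<partial>M\<bar>
    \<le> real (gcd (q m) (q n)) * min ((a + b) / real (q m)) ((a' + b') / real (q n)) +
      (4 * \<kappa> * Z\<^sup>2 * real n powr (- 1 - \<tau> / 2) + 2 * (a' + b') * ((\<kappa> * Z + 1) * real m powr (- 2)))"
proof (rule covariance_trap[OF prob sets_M ab(1,2,3) ab'(1,2,3)])
  have pos: "real m \<ge> 1" "real n \<ge> 1" "real m \<le> real n" using m n0 by auto
  show qq: "1 \<le> q m" "1 \<le> q n" using m n0 q_pos by auto
  fix K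
  have "(\<Sum>s=1..K. \<Sum>t=1..K. 2 * \<bar>trap_coeff a b s\<bar> * \<bar>trap_coeff a' b' t\<bar> *
       (norm (fourier M (of_int (int (s * q m) + int (t * q n)))) +
        (if s * q m = t * q n then 0 else norm (fourier M (of_int (int (s * q m) - int (t * q n)))))))
     \<le> 4 * (\<kappa> * real n powr (- \<tau>)) * (Z * real m powr (4 * \<eta>)) * (Z * real n powr (4 * \<eta>))
       + 2 * (a' + b') * (\<kappa> * real m powr (- \<tau>) * (Z * real m powr (4 * \<eta>)) + real m ^ 4 / real (m ^ 12))"
  \<comment> \<open>J is m ^ 12 and W is m ^ 4, the bound for the inverse slope width: beyond J the
    coefficients contribute at most m ^ 4 / m ^ 12.\<close>
  proof (rule frequency_sum_bound[where X="real (q m) powr \<alpha>" and F="\<lambda>r. norm (fourier M (of_int r))"])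
    show "\<bar>trap_coeff a b s\<bar> \<le> real m ^ 4 / (real s)\<^sup>2" if "1 \<le> s" for s
    proof -
      have "\<bar>trap_coeff a b s\<bar> \<le> 1 / ((real s)\<^sup>2 * (b - a))" by (rule trap_coeff_bounds(3)[OF ab(1,2) that])
      also have "\<dots> \<le> 1 / ((real s)\<^sup>2 * real m powr (- 4))"
        using ab that pos by (intro divide_left_mono mult_left_mono mult_pos_pos) auto
      also have "\<dots> = real m ^ 4 / (real s)\<^sup>2" using pos by (simp add: powr_minus powr_realpow divide_inverse)
      finally show ?thesis .
    qed
    show "\<bar>trap_coeff a' b' t\<bar> \<le> a' + b'" if "1 \<le> t" for t
      by (rule trap_coeff_bounds(1)[OF ab'(1,2) that])
    show "norm (fourier M (of_int r)) \<le> \<kappa> * real n powr (- \<tau>)" if "real (q n) / 2 \<le> \<bar>of_int r\<bar>" for r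
      using half[of n] that m by (intro decay) auto
    show "norm (fourier M (of_int r)) \<le> \<kappa> * real m powr (- \<tau>)" if "real (q m) powr \<alpha> \<le> \<bar>of_int r\<bar>" for r
      using that m by (intro decay) auto
    show "m ^ 12 < s" if st: "1 \<le> s" "1 \<le> t" "s * q m \<noteq> t * q n" "of_int \<bar>int (s * q m) - int (t * q n)\<bar> < real (q m) powr \<alpha>" for s t
    proof (cases "m = n")
      case True
      \<comment> \<open>For m = n separation says nothing, but distinct multiples of q m differ by
        at least q m, which exceeds its \<alpha>-th power.\<close>
      then have "1 \<le> \<bar>int s - int t\<bar>" using st(3) by auto
      then have "1 * int (q m) \<le> \<bar>int s - int t\<bar> * int (q m)" by (intro mult_right_mono) auto
      also have "\<dots> = \<bar>int (s * q m) - int (t * q n)\<bar>" unfolding True by (simp add: left_diff_distrib[symmetric] abs_mult)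
      finally have "real (q m) \<le> of_int \<bar>int (s * q m) - int (t * q n)\<bar>" by linarith
      then show ?thesis using st(4) half[OF m(1)] qq by linarith
    next
      case False
      then show ?thesis using separated[of m n s t] st m by simp
    qed
    show "(\<Sum>s=1..K. \<bar>trap_coeff a b s\<bar>) \<le> Z * real m powr (4 * \<eta>)" using coeff_sum[OF m(1) ab(1,2,4)] .
    show "(\<Sum>s=1..K. \<bar>trap_coeff a' b' s\<bar>) \<le> Z * real n powr (4 * \<eta>)" using coeff_sum[OF _ ab'(1,2,4)] m by simp
  qed (use qq kappa ab ab' pos norm_fourier_le_1[OF prob] m n0 in \<open>auto intro!: one_le_power\<close>)
  also have "\<dots> \<le> 4 * \<kappa> * Z\<^sup>2 * real n powr (- 1 - \<tau> / 2) + 2 * (a' + b') * ((\<kappa> * Z + 1) * real m powr (- 2))"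
  proof (intro add_mono mult_left_mono)
    have "4 * (\<kappa> * real n powr (- \<tau>)) * (Z * real m powr (4 * \<eta>)) * (Z * real n powr (4 * \<eta>))
       \<le> 4 * (\<kappa> * real n powr (- \<tau>)) * (Z * real n powr (4 * \<eta>)) * (Z * real n powr (4 * \<eta>))"
      using kappa Z_nonneg pos eta by (intro mult_right_mono mult_left_mono powr_mono2) auto
    also have "\<dots> = 4 * \<kappa> * Z\<^sup>2 * (real n powr (- \<tau>) * real n powr (4 * \<eta>) * real n powr (4 * \<eta>))"
      by (simp add: power2_eq_square)
    also have "real n powr (- \<tau>) * real n powr (4 * \<eta>) * real n powr (4 * \<eta>) = real n powr (- 1 - \<tau> / 2)"
    proof -
      have "- \<tau> + 4 * \<eta> + 4 * \<eta> = - 1 - \<tau> / 2" by (simp add: \<eta>_def field_simps)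
      then show ?thesis unfolding powr_add[symmetric] by (simp only:)
    qed
    finally show "4 * (\<kappa> * real n powr (- \<tau>)) * (Z * real m powr (4 * \<eta>)) * (Z * real n powr (4 * \<eta>)) \<le> 4 * \<kappa> * Z\<^sup>2 * real n powr (- 1 - \<tau> / 2)" .
    have "\<kappa> * real m powr (- \<tau>) * (Z * real m powr (4 * \<eta>)) = \<kappa> * Z * real m powr (- \<tau> + 4 * \<eta>)"
      by (simp only: powr_add) simp
    also have "\<dots> \<le> \<kappa> * Z * real m powr (- 2)"
      using kappa Z_nonneg pos tau by (intro mult_left_mono powr_mono) (auto simp: \<eta>_def field_simps)
    finally have 1: "\<kappa> * real m powr (- \<tau>) * (Z * real m powr (4 * \<eta>)) \<le> \<kappa> * Z * real m powr (- 2)" .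
    have "real m ^ 4 / real (m ^ 12) = real m powr 4 / real m powr 12"
      using pos powr_realpow[of "real m" 4] powr_realpow[of "real m" 12] by simp
    also have "\<dots> = real m powr (- 8)" using powr_diff[of "real m" 4 12] by simp
    also have "\<dots> \<le> real m powr (- 2)" using pos by (intro powr_mono) auto
    finally show "\<kappa> * real m powr (- \<tau>) * (Z * real m powr (4 * \<eta>)) + real m ^ 4 / real (m ^ 12) \<le> (\<kappa> * Z + 1) * real m powr (- 2)"
      using 1 by (simp add: distrib_right)
  qed (use ab' in auto)
  finally show "(\<Sum>s=1..K. \<Sum>t=1..K. 2 * \<bar>trap_coeff a b s\<bar> * \<bar>trap_coeff a' b' t\<bar> *
       (norm (fourier M (of_int (int (s * q m) + int (t * q n)))) +
        (if s * q m = t * q n then 0 else norm (fourier M (of_int (int (s * q m) - int (t * q n)))))))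
     \<le> 4 * \<kappa> * Z\<^sup>2 * real n powr (- 1 - \<tau> / 2) + 2 * (a' + b') * ((\<kappa> * Z + 1) * real m powr (- 2))" .
qed

lemma mean_bound:
  assumes n: "n0 \<le> n" and ab: "0 \<le> a" "a < b" "real n powr (- 4) \<le> b - a"
  shows "\<bar>\<integral>x. trap a b (real (q n) * x - \<gamma>) - (a + b) \<partial>M\<bar> \<le> 2 * \<kappa> * Z * real n powr (- 2)"
proof (rule mean_trap[OF prob sets_M ab(1,2)])
  have pos: "real n \<ge> 1" using n n0 by auto
  show qq: "1 \<le> q n" using n n0 q_pos by auto
  fix K
  have "(\<Sum>k=1..K. 2 * \<bar>trap_coeff a b k\<bar> * norm (fourier M (real (k * q n)))) \<le> (\<Sum>k=1..K. 2 * \<bar>trap_coeff a b k\<bar> * (\<kappa> * real n powr (- \<tau>)))"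
  proof (intro sum_mono mult_left_mono decay n)
    fix k assume "k \<in> {1..K}"
    then have "q n \<le> k * q n" by simp
    then have "real (q n) \<le> real (k * q n)" by (simp only: of_nat_le_iff)
    then show "real (q n) powr \<alpha> \<le> \<bar>real (k * q n)\<bar>" using half[OF n] qq by linarith
  qed auto
  also have "\<dots> = 2 * (\<kappa> * real n powr (- \<tau>)) * (\<Sum>k=1..K. \<bar>trap_coeff a b k\<bar>)"
    unfolding sum_distrib_left by (intro sum.cong refl) simp
  also have "\<dots> \<le> 2 * (\<kappa> * real n powr (- \<tau>)) * (Z * real n powr (4 * \<eta>))"
    using kappa by (intro mult_left_mono coeff_sum n ab) auto
  also have "\<dots> = 2 * \<kappa> * Z * real n powr (- \<tau> + 4 * \<eta>)" by (simp only: powr_add) simp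
  also have "\<dots> \<le> 2 * \<kappa> * Z * real n powr (- 2)"
    using kappa Z_nonneg pos tau by (intro mult_left_mono powr_mono) (auto simp: \<eta>_def field_simps)
  finally show "(\<Sum>k=1..K. 2 * \<bar>trap_coeff a b k\<bar> * norm (fourier M (real (k * q n)))) \<le> 2 * \<kappa> * Z * real n powr (- 2)" .
qed

section \<open>Probability of a single hit\<close>

lemma measurable_trap: "(\<lambda>x. trap a b (real k * x - \<gamma>)) \<in> borel_measurable M"
  unfolding measurable_cong_sets[OF sets_M refl] by (intro borel_measurable_continuous_onI continuous_intros)

lemma integrable_trap: "a < b \<Longrightarrow> integrable M (\<lambda>x. trap a b (real k * x - \<gamma>))"
proof (rule integrable_const_bound[where B="1 + \<bar>a + b\<bar>"])
  assume "a < b"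
  then have "\<bar>trap a b y\<bar> \<le> 1 + \<bar>a + b\<bar>" for y using trap_deviation[of a b y] by linarith
  then show "AE x in M. norm (trap a b (real k * x - \<gamma>)) \<le> 1 + \<bar>a + b\<bar>" by simp
qed (rule measurable_trap)

lemma measurable_dist: "(\<lambda>x. dist_nearest_int (real k * x - \<gamma>)) \<in> borel_measurable M"
  unfolding measurable_cong_sets[OF sets_M refl] dist_nearest_int_def
  by (intro borel_measurable_continuous_onI continuous_intros)

lemma hit_probability:
  assumes n: "n0 \<le> n"
  shows "prob {x \<in> space M. dist_nearest_int (real (q n) * x - \<gamma>) \<le> \<psi> (q n)}
     \<le> 3 * \<psi> (q n) + (3 + 2 * \<kappa> * Z) * real n powr (- 2)"
proof -
  define E where "E = {x \<in> space M. dist_nearest_int (real (q n) * x - \<gamma>) \<le> \<psi> (q n)}"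
  have n1: "1 \<le> n" "2 \<le> real n" using n n0 by auto
  \<comment> \<open>Raising the radius to at least n powr (-2) keeps the slope width 2 * a - a
    admissible however small \<psi> (q n) is, at a summable cost.\<close>
  define a where "a = max (\<psi> (q n)) (real n powr (- 2))"
  have n2: "real n powr (- 2) \<le> 1/4"
  proof -
    have "real n powr (- 2) \<le> 2 powr (- 2)" using n1 by (intro powr_mono2') auto
    then show ?thesis by (simp add: powr_minus)
  qed
  have a: "0 \<le> a" "a < 2 * a" "2 * a \<le> 1" "a \<le> 1/2" "\<psi> (q n) \<le> a"
    using psi_pos[OF n1(1)] psi_le[OF n1(1)] n2 by (auto simp: a_def)
  have "real n powr (- 4) \<le> real n powr (- 2)" using n1 by (intro powr_mono) auto
  then have a4: "real n powr (- 4) \<le> 2 * a - a" by (simp add: a_def)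
  have E: "E \<in> events" unfolding E_def using measurable_dist[of "q n"] by measurable
  have "prob E = (\<integral>x. indicator E x \<partial>M)" using E by simp
  also have "\<dots> \<le> (\<integral>x. trap a (2 * a) (real (q n) * x - \<gamma>) \<partial>M)"
  proof (intro integral_mono integrable_trap a)
    show "integrable M (indicator E :: real \<Rightarrow> real)" using E by (simp add: less_top[symmetric])
    fix x
    show "indicator E x \<le> trap a (2 * a) (real (q n) * x - \<gamma>)"
      using trap_nonneg[OF a(1-3)] trap_ge_1[OF a(1-4)] a(5) by (auto simp: E_def indicator_def)
  qed
  also have "\<dots> \<le> (a + 2 * a) + 2 * \<kappa> * Z * real n powr (- 2)"
    using mean_bound[OF n a(1,2) a4] integrable_trap[OF a(2), of "q n"] by (simp add: prob_space)
  also have "\<dots> \<le> 3 * \<psi> (q n) + (3 + 2 * \<kappa> * Z) * real n powr (- 2)"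
    using psi_pos[OF n1(1)] by (simp add: a_def max_def distrib_right)
  finally show ?thesis unfolding E_def .
qed

lemma psi_sum_nonneg: "0 \<le> psi_sum q \<psi> N"
  unfolding psi_sum_def by (intro sum_nonneg) (use psi_pos in \<open>auto intro: less_imp_le\<close>)

lemma gcd_sum_nonneg: "0 \<le> gcd_sum q \<psi> N"
  unfolding gcd_sum_def
proof (intro sum_nonneg mult_nonneg_nonneg)
  fix m n assume "n \<in> {1..N}" "m \<in> {1..<n}"
  then show "0 \<le> min (\<psi> (q m) / real (q m)) (\<psi> (q n) / real (q n))"
    using psi_pos[of m] psi_pos[of n] by simp
qed simp

text \<open>Each pair is charged to its larger index, so that the square becomes a sum of one term
  per n, to be compared with the weight of n in \<open>gal_koksma\<close>.\<close>

lemma integral_square_sum: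
  fixes F :: "nat \<Rightarrow> real \<Rightarrow> real"
  assumes int: "\<And>m n. integrable M (\<lambda>x. F m x * F n x)" and ab: "a \<le> b"
  shows "(\<integral>x. (\<Sum>n\<in>{a<..b}. F n x)\<^sup>2 \<partial>M) =
    (\<Sum>n\<in>{a<..b}. (\<integral>x. F n x * F n x \<partial>M) + 2 * (\<Sum>m\<in>{a<..<n}. \<integral>x. F m x * F n x \<partial>M))"
  using ab
proof (induction b rule: dec_induct)
  case (step b)
  have s: "{a<..Suc b} = insert (Suc b) {a<..b}" "{a<..<Suc b} = {a<..b}" using step by auto
  have sq: "(\<Sum>n\<in>{a<..b}. F n x)\<^sup>2 = (\<Sum>m\<in>{a<..b}. \<Sum>n\<in>{a<..b}. F m x * F n x)" for x
    by (simp add: power2_eq_square sum_product)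
  have i: "integrable M (\<lambda>x. (\<Sum>n\<in>{a<..b}. F n x)\<^sup>2)"
    unfolding sq by (intro Bochner_Integration.integrable_sum int)
  have "(\<Sum>n\<in>{a<..Suc b}. F n x)\<^sup>2 = (\<Sum>n\<in>{a<..b}. F n x)\<^sup>2 + (F (Suc b) x * F (Suc b) x + 2 * (\<Sum>m\<in>{a<..b}. F m x * F (Suc b) x))" for x
    unfolding s(1) sum_distrib_right[symmetric] by (simp add: power2_eq_square algebra_simps)
  then have "(\<integral>x. (\<Sum>n\<in>{a<..Suc b}. F n x)\<^sup>2 \<partial>M) = (\<integral>x. (\<Sum>n\<in>{a<..b}. F n x)\<^sup>2 \<partial>M) +
      ((\<integral>x. F (Suc b) x * F (Suc b) x \<partial>M) + 2 * (\<Sum>m\<in>{a<..b}. \<integral>x. F m x * F (Suc b) x \<partial>M))"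
    using i int by simp
  then show ?case unfolding s(1) using step s(2) by simp
qed simp

text \<open>The weights for \<open>gal_koksma\<close> are read off from the covariances: the
  diagonal gives g n n = \<psi> (q n), the pairs m < n give the gcd terms e n, and the rest is a
  multiple of \<psi> (q n) plus the summable n powr (- \<tau> / 2). So the sum of the weights is a
  multiple of \<open>psi_sum\<close> + \<open>gcd_sum\<close> up to a bounded term.\<close>

lemma almost_everywhere_deviation:
  fixes a b :: "nat \<Rightarrow> real" and G :: "nat set"
  assumes G: "\<And>n. n \<in> G \<Longrightarrow> n0 \<le> n"
    and ab: "\<And>n. n \<in> G \<Longrightarrow> 0 \<le> a n" "\<And>n. n \<in> G \<Longrightarrow> a n < b n" "\<And>n. n \<in> G \<Longrightarrow> b n \<le> 1"
      "\<And>n. n \<in> G \<Longrightarrow> real n powr (- 4) \<le> b n - a n" "\<And>n. n \<in> G \<Longrightarrow> a n + b n \<le> 3 * \<psi> (q n)"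
    and unbounded: "\<And>B. \<exists>N. B < psi_sum q \<psi> N"
  shows "AE x in M. \<exists>K. \<forall>N. \<bar>\<Sum>n\<in>{1..N} \<inter> G. trap (a n) (b n) (real (q n) * x - \<gamma>) - (a n + b n)\<bar>
     \<le> K * (sqrt (psi_sum q \<psi> N + gcd_sum q \<psi> N + 2) * (ln (psi_sum q \<psi> N + gcd_sum q \<psi> N + 2))\<^sup>2)"
proof -
  define f where "f n x = (if n \<in> G then trap (a n) (b n) (real (q n) * x - \<gamma>) else 0)" for n x
  define lam where "lam n = (if n \<in> G then a n + b n else 0)" for n
  define g where "g m n = real (gcd (q m) (q n)) * min (\<psi> (q m) / real (q m)) (\<psi> (q n) / real (q n))" for m n
  define e where "e n = (\<Sum>m=1..<n. g m n)" for n
  define \<zeta> where "\<zeta> = (\<Sum>k. real k powr (- 2))"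
  define \<zeta>' where "\<zeta>' = (\<Sum>k. real k powr (- \<tau> / 2))"
  \<comment> \<open>The diagonal counts once and the pairs m < n twice: hence 12 = 4 * (1 + 2), the
    factor 1 + 2 * \<zeta>, and 6 = 2 * 3 for the gcd terms.\<close>
  define C where "C = 6 + 12 * \<kappa> * Z\<^sup>2 + 6 * (\<kappa> * Z + 1) * (1 + 2 * \<zeta>)"
  define h where "h n = \<psi> (q n) + e n + real n powr (- \<tau> / 2)" for n
  \<comment> \<open>\<open>gal_koksma\<close> quantifies over all n, while \<psi> (q 0) is
    unconstrained, so the weight at 0 is set to 0.\<close>
  define \<phi> where "\<phi> n = (if n \<ge> 1 then C * h n else 0)" for n
  have G1: "1 \<le> n" if "n \<in> G" for n using G[OF that] n0 by simp
  have g: "0 \<le> g m n" if "1 \<le> m" "1 \<le> n" for m n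
    unfolding g_def using psi_pos[OF that(1)] psi_pos[OF that(2)] by (intro mult_nonneg_nonneg) auto
  have e: "0 \<le> e n" if "1 \<le> n" for n unfolding e_def using that by (intro sum_nonneg g) auto
  have zeta: "0 \<le> \<zeta>" "(\<Sum>m\<in>A. real m powr (- 2)) \<le> \<zeta>" if "finite A" for A
    using that unfolding \<zeta>_def by (auto intro!: suminf_nonneg sum_le_suminf simp: summable_real_powr_iff)
  have zeta0: "0 \<le> \<zeta>" using zeta(1)[of "{}"] by simp
  have zeta': "0 \<le> \<zeta>'" "(\<Sum>m=1..N. real m powr (- \<tau> / 2)) \<le> \<zeta>'" for N
    using tau unfolding \<zeta>'_def by (auto intro!: suminf_nonneg sum_le_suminf simp: summable_real_powr_iff)
  have kz: "0 \<le> \<kappa> * Z\<^sup>2" "0 \<le> \<kappa> * Z" "0 \<le> \<kappa>" "0 \<le> Z" using kappa Z_nonneg by auto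
  have C: "6 \<le> C" unfolding C_def using kz zeta0 by simp
  have h: "0 \<le> h n" "\<psi> (q n) \<le> h n" if "1 \<le> n" for n
    using psi_pos[OF that] e[OF that] by (auto simp: h_def)
  define F where "F n x = f n x - lam n" for n x
  have F: "F n x = (if n \<in> G then trap (a n) (b n) (real (q n) * x - \<gamma>) - (a n + b n) else 0)" for n x
    by (simp add: F_def f_def lam_def)
  have Fbd: "\<bar>F n x\<bar> \<le> 1" for n x using trap_deviation[OF ab(2)] by (simp add: F)
  have fmeas: "f n \<in> borel_measurable M" for n
    unfolding f_def using measurable_trap[of "a n" "b n" "q n"] by (cases "n \<in> G") auto
  have Fmeas: "F n \<in> borel_measurable M" for n unfolding F_def using fmeas by measurable
  have int: "integrable M (\<lambda>x. F m x * F n x)" for m n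
  proof (rule integrable_const_bound[where B=1])
    show "AE x in M. norm (F m x * F n x) \<le> 1"
      using Fbd by (simp add: abs_mult mult_le_one)
  qed (use Fmeas in measurable)
  have cov: "(\<integral>x. F m x * F n x \<partial>M) \<le> 3 * g m n + (4 * \<kappa> * Z\<^sup>2 * real n powr (- 1 - \<tau> / 2) + 6 * \<psi> (q n) * ((\<kappa> * Z + 1) * real m powr (- 2)))"
    if mn: "1 \<le> m" "m \<le> n" for m n
  proof (cases "m \<in> G \<and> n \<in> G")
    case True
    have qq: "1 \<le> q m" "1 \<le> q n" using q_pos mn by auto
    have "\<bar>\<integral>x. F m x * F n x \<partial>M\<bar> \<le> real (gcd (q m) (q n)) * min ((a m + b m) / real (q m)) ((a n + b n) / real (q n)) +
      (4 * \<kappa> * Z\<^sup>2 * real n powr (- 1 - \<tau> / 2) + 2 * (a n + b n) * ((\<kappa> * Z + 1) * real m powr (- 2)))"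
      using covariance_bound[of m n "a m" "b m" "a n" "b n"] True mn G ab by (simp add: F)
    also have "\<dots> \<le> 3 * g m n + (4 * \<kappa> * Z\<^sup>2 * real n powr (- 1 - \<tau> / 2) + 6 * \<psi> (q n) * ((\<kappa> * Z + 1) * real m powr (- 2)))"
    proof (intro add_mono order_refl mult_right_mono)
      have "min ((a m + b m) / real (q m)) ((a n + b n) / real (q n)) \<le> min (3 * \<psi> (q m) / real (q m)) (3 * \<psi> (q n) / real (q n))"
        using True ab(5) by (intro min.mono divide_right_mono) auto
      also have "\<dots> = 3 * min (\<psi> (q m) / real (q m)) (\<psi> (q n) / real (q n))"
        by (simp add: min_def)
      finally have "real (gcd (q m) (q n)) * min ((a m + b m) / real (q m)) ((a n + b n) / real (q n)) \<le> real (gcd (q m) (q n)) * (3 * min (\<psi> (q m) / real (q m)) (\<psi> (q n) / real (q n)))"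
        by (rule mult_left_mono) simp
      then show "real (gcd (q m) (q n)) * min ((a m + b m) / real (q m)) ((a n + b n) / real (q n)) \<le> 3 * g m n"
        by (simp add: g_def)
      show "2 * (a n + b n) \<le> 6 * \<psi> (q n)" using True ab(5)[of n] by simp
      show "0 \<le> (\<kappa> * Z + 1) * real m powr (- 2)" using kz by simp
    qed
    finally show ?thesis by simp
  next
    case False
    then have "(\<integral>x. F m x * F n x \<partial>M) = 0" by (auto simp: F)
    also have "0 \<le> 3 * g m n + (4 * \<kappa> * Z\<^sup>2 * real n powr (- 1 - \<tau> / 2) + 6 * \<psi> (q n) * ((\<kappa> * Z + 1) * real m powr (- 2)))"
      using g[of m n] mn kappa Z_nonneg psi_pos[of n] by (intro add_nonneg_nonneg mult_nonneg_nonneg) auto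
    finally show ?thesis .
  qed
  have var: "(\<integral>x. (\<Sum>n\<in>{c<..d}. f n x - lam n)\<^sup>2 \<partial>M) \<le> (\<Sum>n\<in>{c<..d}. \<phi> n)" if cd: "c \<le> d" for c d
  proof -
    have "(\<integral>x. F n x * F n x \<partial>M) + 2 * (\<Sum>m\<in>{c<..<n}. \<integral>x. F m x * F n x \<partial>M) \<le> \<phi> n" if n: "n \<in> {c<..d}" for n
    proof -
      have n1: "1 \<le> n" "real n \<ge> 1" using n by auto
      define P where "P = real n powr (- 1 - \<tau> / 2)"
      define Q where "Q = \<kappa> * Z + 1"
      have nP: "real n * P = real n powr (- \<tau> / 2)" "P \<le> real n powr (- \<tau> / 2)" "0 \<le> P"
      proof -
        have "real n powr 1 * real n powr (- 1 - \<tau> / 2) = real n powr (- \<tau> / 2)"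
          unfolding powr_add[symmetric] by simp
        then show "real n * P = real n powr (- \<tau> / 2)" using n1 by (simp add: P_def)
        show "P \<le> real n powr (- \<tau> / 2)" unfolding P_def using n1 by (intro powr_mono) auto
      qed (simp add: P_def)
      have Q: "0 \<le> Q" using kz by (simp add: Q_def)
      have psi: "0 \<le> \<psi> (q n)" using psi_pos[OF n1(1)] by simp
      have gnn: "g n n = \<psi> (q n)" using q_pos[OF n1(1)] by (simp add: g_def)
      have m1: "real n powr (- 2) \<le> 1" using n1 by (simp add: powr_minus powr_realpow inverse_le_1_iff one_le_power)
      have d1: "(\<integral>x. F n x * F n x \<partial>M) \<le> 3 * \<psi> (q n) + (4 * \<kappa> * Z\<^sup>2 * P + 6 * \<psi> (q n) * (Q * real n powr (- 2)))"
        using cov[OF n1(1) order_refl] unfolding gnn P_def Q_def .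
      also have "\<dots> \<le> 3 * \<psi> (q n) + (4 * (\<kappa> * Z\<^sup>2) * real n powr (- \<tau> / 2) + 6 * \<psi> (q n) * (Q * 1))"
        using nP kz Q psi m1 by (intro add_mono order_refl mult_left_mono) (auto simp: mult.assoc intro!: mult_left_mono)
      finally have d1: "(\<integral>x. F n x * F n x \<partial>M) \<le> 3 * \<psi> (q n) + (4 * (\<kappa> * Z\<^sup>2) * real n powr (- \<tau> / 2) + 6 * \<psi> (q n) * (Q * 1))" .
      have "(\<Sum>m\<in>{c<..<n}. \<integral>x. F m x * F n x \<partial>M) \<le> (\<Sum>m\<in>{c<..<n}. 3 * g m n + (4 * \<kappa> * Z\<^sup>2 * P + 6 * \<psi> (q n) * (Q * real m powr (- 2))))"
        unfolding P_def Q_def by (intro sum_mono cov) auto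
      also have "\<dots> \<le> (\<Sum>m\<in>{1..<n}. 3 * g m n + (4 * \<kappa> * Z\<^sup>2 * P + 6 * \<psi> (q n) * (Q * real m powr (- 2))))"
        using g n1 nP kz Q psi by (intro sum_mono2 add_nonneg_nonneg mult_nonneg_nonneg) auto
      also have "\<dots> = 3 * e n + (real (n - 1) * (4 * (\<kappa> * Z\<^sup>2) * P) + 6 * \<psi> (q n) * (Q * (\<Sum>m\<in>{1..<n}. real m powr (- 2))))"
        by (simp add: sum.distrib e_def sum_distrib_left mult.assoc)
      also have "\<dots> \<le> 3 * e n + (4 * (\<kappa> * Z\<^sup>2) * real n powr (- \<tau> / 2) + 6 * \<psi> (q n) * (Q * \<zeta>))"
      proof (intro add_mono order_refl mult_left_mono)
        have "real (n - 1) * (4 * (\<kappa> * Z\<^sup>2) * P) \<le> real n * (4 * (\<kappa> * Z\<^sup>2) * P)"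
          using kz nP by (intro mult_right_mono) auto
        also have "\<dots> = 4 * (\<kappa> * Z\<^sup>2) * (real n * P)" by simp
        finally show "real (n - 1) * (4 * (\<kappa> * Z\<^sup>2) * P) \<le> 4 * (\<kappa> * Z\<^sup>2) * real n powr (- \<tau> / 2)"
          unfolding nP(1) .
      qed (use zeta Q psi in auto)
      finally have d2: "(\<Sum>m\<in>{c<..<n}. \<integral>x. F m x * F n x \<partial>M) \<le> 3 * e n + (4 * (\<kappa> * Z\<^sup>2) * real n powr (- \<tau> / 2) + 6 * \<psi> (q n) * (Q * \<zeta>))" .
      define T where "T = real n powr (- \<tau> / 2)"
      have T: "0 \<le> T" by (simp add: T_def)
      have "(\<integral>x. F n x * F n x \<partial>M) + 2 * (\<Sum>m\<in>{c<..<n}. \<integral>x. F m x * F n x \<partial>M) \<le>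
         (3 * \<psi> (q n) + (4 * (\<kappa> * Z\<^sup>2) * T + 6 * \<psi> (q n) * (Q * 1))) + 2 * (3 * e n + (4 * (\<kappa> * Z\<^sup>2) * T + 6 * \<psi> (q n) * (Q * \<zeta>)))"
        unfolding T_def using d1 d2 by (intro add_mono mult_left_mono) auto
      also have "\<dots> = (3 + 6 * Q * (1 + 2 * \<zeta>)) * \<psi> (q n) + 6 * e n + 12 * (\<kappa> * Z\<^sup>2) * T"
        by (simp add: algebra_simps)
      also have "\<dots> \<le> C * \<psi> (q n) + C * e n + C * T"
        using kz Q zeta0 psi e[OF n1(1)] T by (intro add_mono mult_right_mono) (auto simp: C_def Q_def)
      also have "\<dots> = \<phi> n" using n1 by (simp add: \<phi>_def h_def T_def algebra_simps)
      finally show ?thesis .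
    qed
    then show ?thesis
      unfolding F_def[symmetric] integral_square_sum[OF int cd] by (intro sum_mono)
  qed
  define X where "X N = psi_sum q \<psi> N + gcd_sum q \<psi> N" for N
  define \<Phi> where "\<Phi> N = (\<Sum>n=1..N. \<phi> n)" for N
  have Phi: "\<Phi> N = C * (X N + (\<Sum>n=1..N. real n powr (- \<tau> / 2)))" for N
  proof -
    have "\<Phi> N = (\<Sum>n=1..N. C * h n)" unfolding \<Phi>_def by (intro sum.cong) (auto simp: \<phi>_def)
    then show ?thesis
      by (simp add: h_def X_def psi_sum_def gcd_sum_def e_def g_def sum.distrib sum_distrib_left distrib_left)
  qed
  have X0: "0 \<le> X N" for N using psi_sum_nonneg gcd_sum_nonneg by (simp add: X_def)
  have "AE x in M. \<exists>K. \<forall>N. \<bar>\<Sum>n=1..N. f n x - lam n\<bar> \<le> K * (sqrt (\<Phi> N + 1) * (ln (\<Phi> N + 2))\<^sup>2)"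
    unfolding \<Phi>_def
  \<comment> \<open>On G, lam n = a n + b n <= 2 since b n <= 1, and f n deviates from lam n by at
    most 1.\<close>
  proof (rule gal_koksma[where H=3 and L=2, OF prob fmeas])
    have lam2: "lam n \<le> 2" for n using ab(2,3)[of n] by (auto simp: lam_def)
    show "0 \<le> lam n" "lam n \<le> 2" "lam n \<le> \<phi> n" for n
    proof -
      show "0 \<le> lam n" using ab(1,2)[of n] by (auto simp: lam_def)
      show "lam n \<le> 2" by (rule lam2)
      show "lam n \<le> \<phi> n"
      proof (cases "n \<in> G")
        case True
        have "lam n \<le> 3 * \<psi> (q n)" using True ab(5) by (simp add: lam_def)
        also have "\<dots> \<le> C * h n" using C h[OF G1[OF True]] psi_pos[OF G1[OF True]] by (intro mult_mono) auto
        finally show ?thesis using G1[OF True] by (simp add: \<phi>_def)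
      qed (use C h in \<open>auto simp: lam_def \<phi>_def\<close>)
    qed
    show "0 \<le> f n x" for n x using trap_nonneg ab by (simp add: f_def)
    show "f n x \<le> 3" for n x using Fbd[of n x] lam2[of n] by (simp add: F_def abs_le_iff)
    show "\<exists>N. B < (\<Sum>n=1..N. \<phi> n)" for B
    proof -
      obtain N where N: "B < psi_sum q \<psi> N" using unbounded by blast
      also have "\<dots> \<le> 1 * (X N + (\<Sum>n=1..N. real n powr (- \<tau> / 2)))" using gcd_sum_nonneg by (simp add: X_def sum_nonneg)
      also have "\<dots> \<le> \<Phi> N" unfolding Phi using C X0 by (intro mult_right_mono add_nonneg_nonneg sum_nonneg) auto
      finally show ?thesis unfolding \<Phi>_def by blast
    qed
  qed (rule var)
  then show ?thesis
  proof eventually_elim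
    case (elim x)
    then obtain K where K: "\<And>N. \<bar>\<Sum>n=1..N. f n x - lam n\<bar> \<le> K * (sqrt (\<Phi> N + 1) * (ln (\<Phi> N + 2))\<^sup>2)" by blast
    \<comment> \<open>D compares \<Phi> N + 2 with X N + 2, and W turns the resulting summand ln D
      into a factor, using ln (X N + 2) >= ln 2.\<close>
    define D where "D = C * (\<zeta>' + 1) + 2"
    have D: "1 \<le> D" using C zeta'(1) by (simp add: D_def)
    define W where "W = 1 + ln D / ln 2"
    have W: "1 \<le> W" using D by (simp add: W_def)
    have PD: "\<Phi> N + 2 \<le> D * (X N + 2)" "0 \<le> \<Phi> N" for N
    proof -
      have "\<Phi> N \<le> C * (X N + \<zeta>')" unfolding Phi using C zeta' by (intro mult_left_mono add_mono) auto
      moreover have "D * (X N + 2) - (C * (X N + \<zeta>') + 2) = C * \<zeta>' * (X N + 1) + 2 * C + 2 * X N + 2"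
        by (simp add: D_def algebra_simps)
      moreover have "0 \<le> C * \<zeta>' * (X N + 1)" using C zeta' X0 by simp
      ultimately show "\<Phi> N + 2 \<le> D * (X N + 2)" using C X0[of N] by linarith
      show "0 \<le> \<Phi> N" unfolding Phi using C X0 by (intro mult_nonneg_nonneg add_nonneg_nonneg sum_nonneg) auto
    qed
    have "\<bar>\<Sum>n\<in>{1..N} \<inter> G. trap (a n) (b n) (real (q n) * x - \<gamma>) - (a n + b n)\<bar> \<le> (\<bar>K\<bar> * (sqrt D * W\<^sup>2)) * (sqrt (X N + 2) * (ln (X N + 2))\<^sup>2)" for N
    proof -
      have "(\<Sum>n\<in>{1..N} \<inter> G. trap (a n) (b n) (real (q n) * x - \<gamma>) - (a n + b n)) = (\<Sum>n=1..N. F n x)"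
        unfolding F by (simp add: sum.inter_restrict)
      then have "\<bar>\<Sum>n\<in>{1..N} \<inter> G. trap (a n) (b n) (real (q n) * x - \<gamma>) - (a n + b n)\<bar> \<le> K * (sqrt (\<Phi> N + 1) * (ln (\<Phi> N + 2))\<^sup>2)"
        using K unfolding F_def by simp
      also have "\<dots> \<le> \<bar>K\<bar> * (sqrt (D * (X N + 2)) * (W * ln (X N + 2))\<^sup>2)"
      proof (intro mult_mono power_mono real_sqrt_le_mono)
        show "\<Phi> N + 1 \<le> D * (X N + 2)" using PD[of N] by simp
        have "ln (\<Phi> N + 2) \<le> ln (D * (X N + 2))" using PD[of N] by (subst ln_le_cancel_iff) auto
        also have "\<dots> = ln D + ln (X N + 2)" using D X0[of N] by (subst ln_mult) auto
        also have "ln D = (ln D / ln 2) * ln 2" by simp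
        also have "(ln D / ln 2) * ln 2 \<le> (ln D / ln 2) * ln (X N + 2)" using D X0[of N] by (intro mult_left_mono) auto
        finally show "ln (\<Phi> N + 2) \<le> W * ln (X N + 2)" by (simp add: W_def distrib_right)
      qed (use PD X0 D in auto)
      also have "\<dots> = (\<bar>K\<bar> * (sqrt D * W\<^sup>2)) * (sqrt (X N + 2) * (ln (X N + 2))\<^sup>2)"
        by (simp add: real_sqrt_mult power_mult_distrib)
      finally show ?thesis .
    qed
    then show ?case unfolding X_def by blast
  qed
qed

end

section \<open>Counting hits\<close>

context separated_decay
begin

interpretation prob_space M by (rule prob)

lemma finite_hits:
  assumes B: "\<And>n. n \<in> B \<Longrightarrow> n0 \<le> n" and sm: "summable (\<lambda>n. if n \<in> B then \<psi> (q n) else 0)"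
  shows "AE x in M. finite {n \<in> B. dist_nearest_int (real (q n) * x - \<gamma>) \<le> \<psi> (q n)}"
proof -
  define E where "E n = (if n \<in> B then {x \<in> space M. dist_nearest_int (real (q n) * x - \<gamma>) \<le> \<psi> (q n)} else {})" for n
  have E: "E n \<in> events" for n unfolding E_def using measurable_dist[of "q n"] by (cases "n \<in> B") auto
  have "summable (\<lambda>n. measure M (E n))"
  proof (rule summable_comparison_test')
    show "summable (\<lambda>n. 3 * (if n \<in> B then \<psi> (q n) else 0) + (3 + 2 * \<kappa> * Z) * real n powr (- 2))"
      by (intro summable_add summable_mult sm) (simp add: summable_real_powr_iff)
    fix n :: nat assume "0 \<le> n"
    have "0 \<le> (3 + 2 * \<kappa> * Z) * real n powr (- 2)" using kappa Z_nonneg by simp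
    then show "norm (measure M (E n)) \<le> 3 * (if n \<in> B then \<psi> (q n) else 0) + (3 + 2 * \<kappa> * Z) * real n powr (- 2)"
      using hit_probability[OF B, of n] by (simp add: E_def)
  qed
  then have "AE x in M. eventually (\<lambda>n. x \<in> space M - E n) sequentially"
    using E by (intro borel_cantelli_AE1) (auto simp: emeasure_eq_measure)
  then show ?thesis
  proof eventually_elim
    case (elim x)
    then obtain N where N: "\<And>n. N \<le> n \<Longrightarrow> x \<in> space M - E n" by (auto simp: eventually_sequentially)
    have "{n \<in> B. dist_nearest_int (real (q n) * x - \<gamma>) \<le> \<psi> (q n)} \<subseteq> {..<N}"
    proof
      fix n assume n: "n \<in> {n \<in> B. dist_nearest_int (real (q n) * x - \<gamma>) \<le> \<psi> (q n)}"
      then have "\<not> N \<le> n" using N[of n] by (auto simp: E_def)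
      then show "n \<in> {..<N}" by simp
    qed
    then show ?case using finite_subset by blast
  qed
qed

text \<open>With \<psi> = v^2 - u^2 = (v - u) * (v + u), the quotient by v is at most twice the
  increment of the square root, which telescopes. This is the total smoothing error caused by the
  slopes.\<close>

lemma sum_psi_over_sqrt:
  "(\<Sum>n=1..N. \<psi> (q n) / sqrt (1 + psi_sum q \<psi> n)) \<le> 2 * sqrt (1 + psi_sum q \<psi> N)"
proof (induction N)
  case 0
  then show ?case by (simp add: psi_sum_def)
next
  case (Suc N)
  define u v where "u = sqrt (1 + psi_sum q \<psi> N)" and "v = sqrt (1 + psi_sum q \<psi> (Suc N))"
  have s: "psi_sum q \<psi> (Suc N) = psi_sum q \<psi> N + \<psi> (q (Suc N))" by (simp add: psi_sum_def)
  have p: "0 < \<psi> (q (Suc N))" by (rule psi_pos) simp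
  have v: "0 < v" "u \<le> v" "0 \<le> u" using psi_sum_nonneg[of N] p by (auto simp: u_def v_def s)
  have "v\<^sup>2 - u\<^sup>2 = \<psi> (q (Suc N))" using psi_sum_nonneg[of N] psi_sum_nonneg[of "Suc N"] by (simp add: u_def v_def s)
  then have "\<psi> (q (Suc N)) = (v - u) * (v + u)" by (simp add: power2_eq_square algebra_simps)
  also have "\<dots> \<le> (v - u) * (2 * v)" using v by (intro mult_left_mono) auto
  finally have "\<psi> (q (Suc N)) / v \<le> 2 * (v - u)" using v by (simp add: divide_le_eq mult_ac)
  then show ?case using Suc by (simp add: u_def v_def)
qed

lemma hit_count_eq:
  "real (hit_count q \<gamma> \<psi> x N) = (\<Sum>n=1..N. if dist_nearest_int (real (q n) * x - \<gamma>) \<le> \<psi> (q n) then 1 else 0)"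
  unfolding hit_count_def by (subst sum.inter_filter[symmetric]) auto

text \<open>The summand 2 under the root keeps the scale bounded below, so that it can absorb
  constants; it is removed in \<open>deviation_bigo\<close>.\<close>

definition error_scale :: "nat \<Rightarrow> real" where
  "error_scale N = sqrt (psi_sum q \<psi> N + gcd_sum q \<psi> N + 2) * (ln (psi_sum q \<psi> N + gcd_sum q \<psi> N + 2))\<^sup>2"

lemma error_scale_ge: "1 / 4 * sqrt (psi_sum q \<psi> N + gcd_sum q \<psi> N + 2) \<le> error_scale N" "1 / 4 \<le> error_scale N"
proof -
  define X where "X = psi_sum q \<psi> N + gcd_sum q \<psi> N"
  have X: "0 \<le> X" using psi_sum_nonneg gcd_sum_nonneg by (simp add: X_def)
  have "1/2 \<le> ln (2::real)" using ln2_ge_two_thirds by simp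
  also have "\<dots> \<le> ln (X + 2)" using X by (subst ln_le_cancel_iff) auto
  finally have "(1/2)\<^sup>2 \<le> (ln (X + 2))\<^sup>2" by (intro power_mono) auto
  then have "sqrt (X + 2) * (1/4) \<le> sqrt (X + 2) * (ln (X + 2))\<^sup>2"
    using X by (intro mult_left_mono) (auto simp: power2_eq_square)
  then show 1: "1 / 4 * sqrt (psi_sum q \<psi> N + gcd_sum q \<psi> N + 2) \<le> error_scale N" by (simp add: error_scale_def X_def)
  have "1 \<le> sqrt (X + 2)" using X by simp
  then show "1 / 4 \<le> error_scale N" using 1 unfolding X_def[symmetric] by linarith
qed

text \<open>\<open>almost_everywhere_deviation\<close> asks for unbounded sums of \<psi>. If they
  are bounded, Borel-Cantelli leaves finitely many hits, and both counts are O(1).\<close>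

lemma deviation_bounded_case:
  assumes bd: "\<And>N. psi_sum q \<psi> N \<le> D"
  shows "AE x in M. \<exists>K. \<forall>N. \<bar>real (hit_count q \<gamma> \<psi> x N) - 2 * psi_sum q \<psi> N\<bar> \<le> K * error_scale N"
proof -
  have "summable (\<lambda>n. if n \<in> {n0..} then \<psi> (q n) else 0)"
  proof (rule summableI_nonneg_bounded)
    show "0 \<le> (if n \<in> {n0..} then \<psi> (q n) else 0)" for n using psi_pos[of n] n0 by auto
    show "(\<Sum>i<n. if i \<in> {n0..} then \<psi> (q i) else 0) \<le> D" for n
    proof -
      have "(\<Sum>i<n. if i \<in> {n0..} then \<psi> (q i) else 0) = (\<Sum>i\<in>{..<n} \<inter> {n0..}. \<psi> (q i))"
        by (rule sum.inter_restrict[symmetric]) simp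
      also have "\<dots> \<le> (\<Sum>i=1..n. \<psi> (q i))"
        using n0 psi_pos by (intro sum_mono2) (auto intro: less_imp_le)
      also have "\<dots> \<le> D" using bd[of n] by (simp add: psi_sum_def)
      finally show ?thesis .
    qed
  qed
  then have "AE x in M. finite {n \<in> {n0..}. dist_nearest_int (real (q n) * x - \<gamma>) \<le> \<psi> (q n)}"
    by (intro finite_hits) auto
  then show ?thesis
  proof eventually_elim
    case (elim x)
    define H where "H = {n \<in> {n0..}. dist_nearest_int (real (q n) * x - \<gamma>) \<le> \<psi> (q n)}"
    have D: "0 \<le> D" using bd[of 0] by (simp add: psi_sum_def)
    have "\<bar>real (hit_count q \<gamma> \<psi> x N) - 2 * psi_sum q \<psi> N\<bar> \<le> (4 * (real (card ({..<n0} \<union> H)) + 2 * D)) * error_scale N" for N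
    proof -
      have "hit_count q \<gamma> \<psi> x N \<le> card ({..<n0} \<union> H)"
        unfolding hit_count_def using elim by (intro card_mono) (auto simp: H_def)
      then have "\<bar>real (hit_count q \<gamma> \<psi> x N) - 2 * psi_sum q \<psi> N\<bar> \<le> real (card ({..<n0} \<union> H)) + 2 * D"
        using bd[of N] psi_sum_nonneg[of N] by linarith
      also have "\<dots> = (4 * (real (card ({..<n0} \<union> H)) + 2 * D)) * (1/4)" by simp
      also have "\<dots> \<le> (4 * (real (card ({..<n0} \<union> H)) + 2 * D)) * error_scale N"
        using error_scale_ge(2)[of N] D by (intro mult_left_mono) auto
      finally show ?thesis .
    qed
    then show ?case by blast
  qed
qed

lemma deviation_unbounded_case:
  assumes unb: "\<And>B. \<exists>N. B < psi_sum q \<psi> N"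
  shows "AE x in M. \<exists>K. \<forall>N. \<bar>real (hit_count q \<gamma> \<psi> x N) - 2 * psi_sum q \<psi> N\<bar> \<le> K * error_scale N"
proof -
  define G where "G = {n. n0 \<le> n \<and> real n powr (- 2) \<le> \<psi> (q n)}"
  define B where "B = {n. n0 \<le> n \<and> \<psi> (q n) < real n powr (- 2)}"
  define \<epsilon> where "\<epsilon> n = 1 / sqrt (1 + psi_sum q \<psi> n)" for n
  define \<zeta> where "\<zeta> = (\<Sum>k. real k powr (- 2))"
  have eps: "0 < \<epsilon> n" "\<epsilon> n \<le> 1" for n using psi_sum_nonneg[of n] by (auto simp: \<epsilon>_def add_pos_nonneg)
  have G1: "1 \<le> n" "2 \<le> n" if "n \<in> G" for n using that n0 by (auto simp: G_def)
  have width: "real n powr (- 4) \<le> \<epsilon> n * \<psi> (q n)" if n: "n \<in> G" for n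
  proof -
    have n2: "2 \<le> real n" using G1[OF n] by simp
    \<comment> \<open>From \<psi> <= 1 / 2 and n >= 2 follows 1 + \<open>psi_sum q \<psi> n\<close>
      <= 1 + n / 2 <= n. So the relative width is at least 1 / n^2, and the cutoff defining G
      supplies the other factor n powr (-2).\<close>
    have "psi_sum q \<psi> n \<le> real n * (1/2)"
      unfolding psi_sum_def using psi_le sum_bounded_above[of "{1..n}" "\<lambda>n. \<psi> (q n)" "1/2"] by simp
    then have "1 + psi_sum q \<psi> n \<le> real n" using n2 by simp
    also have "\<dots> \<le> (real n ^ 2) ^ 2"
      unfolding power_mult[symmetric] using n2 by (intro self_le_power) auto
    finally have "sqrt (1 + psi_sum q \<psi> n) \<le> real n ^ 2" by (intro real_le_lsqrt) auto
    then have "1 / real n ^ 2 \<le> \<epsilon> n"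
      unfolding \<epsilon>_def using n2 psi_sum_nonneg[of n] by (intro divide_left_mono mult_pos_pos) (auto simp: add_pos_nonneg)
    then have "real n powr (- 2) \<le> \<epsilon> n" using n2 by (simp add: powr_minus powr_realpow divide_inverse)
    moreover have "real n powr (- 2) \<le> \<psi> (q n)" using n by (simp add: G_def)
    ultimately have "real n powr (- 2) * real n powr (- 2) \<le> \<epsilon> n * \<psi> (q n)"
      using eps(1)[of n] by (intro mult_mono) auto
    then show ?thesis by (simp add: powr_add[symmetric])
  qed
  have ep: "0 < \<epsilon> n * \<psi> (q n)" "\<epsilon> n * \<psi> (q n) \<le> \<psi> (q n)" "\<psi> (q n) \<le> 1/2" if "n \<in> G" for n
    using eps[of n] psi_pos[OF G1(1)[OF that]] psi_le[OF G1(1)[OF that]] by (auto simp: mult_left_le_one_le)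
  define ind where "ind n x = (if dist_nearest_int (real (q n) * x - \<gamma>) \<le> \<psi> (q n) then 1 else (0::real))" for n x
  \<comment> \<open>Majorant from ap to bp, minorant from am to ap. They share the edge \<psi> (q n)
    <= 1 / 2, as \<open>trap_ge_1\<close> requires of the inner and \<open>trap_le_indicator\<close>
    of the outer radius.\<close>
  define ap bp am where "ap n = \<psi> (q n)" and "bp n = \<psi> (q n) + \<epsilon> n * \<psi> (q n)" and "am n = \<psi> (q n) - \<epsilon> n * \<psi> (q n)" for n
  have plus: "0 \<le> ap n" "ap n < bp n" "bp n \<le> 1" "real n powr (- 4) \<le> bp n - ap n" "ap n + bp n \<le> 3 * \<psi> (q n)"
    if "n \<in> G" for n
    using ep[OF that] width[OF that] by (auto simp: ap_def bp_def)
  have minus: "0 \<le> am n" "am n < ap n" "ap n \<le> 1" "real n powr (- 4) \<le> ap n - am n" "am n + ap n \<le> 3 * \<psi> (q n)"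
    if "n \<in> G" for n
    using ep[OF that] width[OF that] by (auto simp: ap_def am_def)
  have G0: "n0 \<le> n" if "n \<in> G" for n using that by (simp add: G_def)
  have up: "AE x in M. \<exists>K. \<forall>N. \<bar>\<Sum>n\<in>{1..N} \<inter> G. trap (ap n) (bp n) (real (q n) * x - \<gamma>) - (ap n + bp n)\<bar> \<le> K * error_scale N"
    unfolding error_scale_def by (rule almost_everywhere_deviation[OF G0 plus unb])
  have lo: "AE x in M. \<exists>K. \<forall>N. \<bar>\<Sum>n\<in>{1..N} \<inter> G. trap (am n) (ap n) (real (q n) * x - \<gamma>) - (am n + ap n)\<bar> \<le> K * error_scale N"
    unfolding error_scale_def by (rule almost_everywhere_deviation[OF G0 minus unb])
  have "summable (\<lambda>n. if n \<in> B then \<psi> (q n) else 0)"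
  proof (rule summable_comparison_test')
    show "summable (\<lambda>n. real n powr (- 2))" by (simp add: summable_real_powr_iff)
    show "norm (if n \<in> B then \<psi> (q n) else 0) \<le> real n powr (- 2)" for n
      using psi_pos[of n] n0 by (auto simp: B_def)
  qed
  then have fin: "AE x in M. finite {n \<in> B. dist_nearest_int (real (q n) * x - \<gamma>) \<le> \<psi> (q n)}"
    by (intro finite_hits) (auto simp: B_def)
  show ?thesis using up lo fin
  proof eventually_elim
    case (elim x)
    obtain K where K: "\<And>N. \<bar>\<Sum>n\<in>{1..N} \<inter> G. trap (ap n) (bp n) (real (q n) * x - \<gamma>) - (ap n + bp n)\<bar> \<le> K * error_scale N"
      using elim(1) by blast
    obtain K' where K': "\<And>N. \<bar>\<Sum>n\<in>{1..N} \<inter> G. trap (am n) (ap n) (real (q n) * x - \<gamma>) - (am n + ap n)\<bar> \<le> K' * error_scale N"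
      using elim(2) by blast
    define H where "H = {n \<in> B. dist_nearest_int (real (q n) * x - \<gamma>) \<le> \<psi> (q n)}"
    \<comment> \<open>Outside G lie the indices below n0 and those of B: c bounds their hits and c'
      their share of \<open>psi_sum\<close>, which enters the deviation with factor 2.\<close>
    define c where "c = real (card ({..<n0} \<union> H))"
    define c' where "c' = real n0 + \<zeta>"
    have zeta: "0 \<le> \<zeta>" unfolding \<zeta>_def by (intro suminf_nonneg) (auto simp: summable_real_powr_iff)
    have "\<bar>real (hit_count q \<gamma> \<psi> x N) - 2 * psi_sum q \<psi> N\<bar> \<le> (\<bar>K\<bar> + \<bar>K'\<bar> + 8 + 4 * (c + 2 * c')) * error_scale N" for N
    proof -
      define I where "I = {1..N} \<inter> G"
      define J where "J = {1..N} - G"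
      have IJ: "(\<Sum>n=1..N. g n) = (\<Sum>n\<in>I. g n) + (\<Sum>n\<in>J. g n)" for g :: "nat \<Rightarrow> real"
      proof -
        have "{1..N} = I \<union> J" "I \<inter> J = {}" by (auto simp: I_def J_def)
        then show ?thesis by (simp only:) (rule sum.union_disjoint, auto simp: I_def J_def)
      qed
      have hc: "real (hit_count q \<gamma> \<psi> x N) = (\<Sum>n\<in>I. ind n x) + (\<Sum>n\<in>J. ind n x)"
        unfolding hit_count_eq IJ ind_def ..
      have hJ: "0 \<le> (\<Sum>n\<in>J. ind n x)" by (intro sum_nonneg) (simp add: ind_def)
      have hJ': "(\<Sum>n\<in>J. ind n x) \<le> c"
      proof -
        have "(\<Sum>n\<in>J. ind n x) = real (card {n \<in> J. dist_nearest_int (real (q n) * x - \<gamma>) \<le> \<psi> (q n)})"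
          unfolding ind_def by (subst sum.inter_filter[symmetric]) (auto simp: J_def)
        also have "\<dots> \<le> c" unfolding c_def of_nat_le_iff
          using elim(3) by (intro card_mono) (auto simp: H_def J_def G_def B_def)
        finally show ?thesis .
      qed
      have psi0: "0 \<le> \<psi> (q n)" if "n \<in> {1..N}" for n using psi_pos[of n] that by (auto intro: less_imp_le)
      have pJ: "0 \<le> (\<Sum>n\<in>J. \<psi> (q n))" by (intro sum_nonneg psi0) (auto simp: J_def)
      have pJ': "(\<Sum>n\<in>J. \<psi> (q n)) \<le> c'"
      proof -
        have "(\<Sum>n\<in>J. \<psi> (q n)) \<le> (\<Sum>n\<in>J. (if n < n0 then 1 else 0) + real n powr (- 2))"
        proof (rule sum_mono)
          fix n assume n: "n \<in> J"
          then have "\<psi> (q n) \<le> 1" using psi_le[of n] by (auto simp: J_def)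
          then show "\<psi> (q n) \<le> (if n < n0 then 1 else 0) + real n powr (- 2)"
            using n by (auto simp: J_def G_def add_increasing2)
        qed
        also have "\<dots> = real (card {n \<in> J. n < n0}) + (\<Sum>n\<in>J. real n powr (- 2))"
          unfolding sum.distrib by (subst sum.inter_filter[symmetric]) (auto simp: J_def)
        also have "\<dots> \<le> real (card {..<n0}) + \<zeta>"
          unfolding \<zeta>_def
          by (intro add_mono sum_le_suminf of_nat_mono card_mono) (auto simp: J_def summable_real_powr_iff)
        finally show ?thesis by (simp add: c'_def)
      qed
      define P where "P = (\<Sum>n\<in>I. \<epsilon> n * \<psi> (q n))"
      have P: "P \<le> 8 * error_scale N"
      proof -
        have "P \<le> (\<Sum>n=1..N. \<epsilon> n * \<psi> (q n))"
          unfolding P_def I_def using eps psi0 by (intro sum_mono2 mult_nonneg_nonneg) (auto intro: less_imp_le)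
        also have "\<dots> \<le> 2 * sqrt (1 + psi_sum q \<psi> N)"
          using sum_psi_over_sqrt[of N] by (simp add: \<epsilon>_def)
        also have "\<dots> \<le> 2 * sqrt (psi_sum q \<psi> N + gcd_sum q \<psi> N + 2)"
          using gcd_sum_nonneg[of N] by simp
        also have "\<dots> \<le> 8 * error_scale N" using error_scale_ge(1)[of N] by simp
        finally show ?thesis .
      qed
      define PI where "PI = (\<Sum>n\<in>I. \<psi> (q n))"
      have psi: "psi_sum q \<psi> N = PI + (\<Sum>n\<in>J. \<psi> (q n))" unfolding psi_sum_def IJ PI_def ..
      have sp: "(\<Sum>n\<in>I. ap n + bp n) = 2 * PI + P" "(\<Sum>n\<in>I. am n + ap n) = 2 * PI - P"
        by (simp_all add: ap_def bp_def am_def PI_def P_def sum.distrib sum_subtractf sum_distrib_left)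
      have "(\<Sum>n\<in>I. ind n x) \<le> (\<Sum>n\<in>I. trap (ap n) (bp n) (real (q n) * x - \<gamma>))"
      proof (rule sum_mono)
        fix n assume "n \<in> I"
        then have n: "n \<in> G" by (simp add: I_def)
        have t: "0 \<le> ap n" "ap n < bp n" "bp n \<le> 1" "ap n \<le> 1/2" using ep[OF n] by (auto simp: ap_def bp_def)
        show "ind n x \<le> trap (ap n) (bp n) (real (q n) * x - \<gamma>)"
          using trap_nonneg[OF t(1-3)] trap_ge_1[OF t] by (auto simp: ind_def ap_def)
      qed
      also have "\<dots> \<le> 2 * PI + P + K * error_scale N" using K[of N] sp(1) unfolding I_def[symmetric] sum_subtractf by linarith
      finally have u: "(\<Sum>n\<in>I. ind n x) \<le> 2 * PI + P + K * error_scale N" .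
      have "(\<Sum>n\<in>I. trap (am n) (ap n) (real (q n) * x - \<gamma>)) \<le> (\<Sum>n\<in>I. ind n x)"
      proof (rule sum_mono)
        fix n assume "n \<in> I"
        then have n: "n \<in> G" by (simp add: I_def)
        have t: "0 \<le> am n" "am n < ap n" "ap n \<le> 1/2" using ep[OF n] by (auto simp: ap_def am_def)
        show "trap (am n) (ap n) (real (q n) * x - \<gamma>) \<le> ind n x"
          using trap_le_indicator[OF t] by (simp add: ind_def ap_def)
      qed
      moreover have "2 * PI - P - K' * error_scale N \<le> (\<Sum>n\<in>I. trap (am n) (ap n) (real (q n) * x - \<gamma>))"
        using K'[of N] sp(2) unfolding I_def[symmetric] sum_subtractf by linarith
      ultimately have l: "2 * PI - P - K' * error_scale N \<le> (\<Sum>n\<in>I. ind n x)" by linarith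
      have s0: "0 \<le> error_scale N" using error_scale_ge(2)[of N] by simp
      have KK: "K * error_scale N \<le> \<bar>K\<bar> * error_scale N" "K' * error_scale N \<le> \<bar>K'\<bar> * error_scale N" "0 \<le> \<bar>K\<bar> * error_scale N" "0 \<le> \<bar>K'\<bar> * error_scale N"
        using s0 by (auto intro!: mult_right_mono)
      have cc: "0 \<le> c" "0 \<le> c'" using zeta by (auto simp: c_def c'_def)
      have "(c + 2 * c') * (1/4) \<le> (c + 2 * c') * error_scale N" using cc error_scale_ge(2)[of N] by (intro mult_left_mono) auto
      then have ccs: "c + 2 * c' \<le> 4 * ((c + 2 * c') * error_scale N)" by simp
      have "\<bar>real (hit_count q \<gamma> \<psi> x N) - 2 * psi_sum q \<psi> N\<bar> \<le> \<bar>K\<bar> * error_scale N + \<bar>K'\<bar> * error_scale N + 8 * error_scale N + (c + 2 * c')"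
      proof -
        define S S' where "S = \<bar>K\<bar> * error_scale N" and "S' = \<bar>K'\<bar> * error_scale N"
        have S: "K * error_scale N \<le> S" "K' * error_scale N \<le> S'" "0 \<le> S" "0 \<le> S'"
          using KK by (simp_all add: S_def S'_def)
        define i j p where "i = (\<Sum>n\<in>I. ind n x)" and "j = (\<Sum>n\<in>J. ind n x)" and "p = (\<Sum>n\<in>J. \<psi> (q n))"
        note b = u l hJ hJ' pJ pJ' P S cc
        note b' = b[folded i_def j_def p_def]
        have "i + j - 2 * (PI + p) \<le> S + S' + 8 * error_scale N + (c + 2 * c')"
          using b' by argo
        moreover have "- (i + j - 2 * (PI + p)) \<le> S + S' + 8 * error_scale N + (c + 2 * c')"
          using b' by argo
        ultimately have "\<bar>i + j - 2 * (PI + p)\<bar> \<le> S + S' + 8 * error_scale N + (c + 2 * c')"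
          by (rule abs_leI)
        then show ?thesis unfolding hc psi i_def j_def p_def S_def S'_def .
      qed
      also have "\<dots> \<le> (\<bar>K\<bar> + \<bar>K'\<bar> + 8 + 4 * (c + 2 * c')) * error_scale N"
        using ccs by (simp add: algebra_simps)
      finally show ?thesis .
    qed
    then show ?case by blast
  qed
qed

text \<open>The target lacks the summand 2 under the root. For N >= 1 the sum X is at least d =
  \<psi> (q 1) > 0, so dropping it costs the factor sqrt (1 + 2 / d). The logarithm is at least ln
  2, so passing from exponent 2 to 2 + \<epsilon> costs ln 2 powr (- \<epsilon>).\<close>

lemma deviation_bigo:
  assumes eps: "0 < \<epsilon>"
  shows "AE x in M. (\<lambda>N. real (hit_count q \<gamma> \<psi> x N) - 2 * psi_sum q \<psi> N) \<in>
      O(\<lambda>N. (psi_sum q \<psi> N + gcd_sum q \<psi> N) powr (1 / 2) *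
             ln (psi_sum q \<psi> N + gcd_sum q \<psi> N + 2) powr (2 + \<epsilon>))"
proof -
  have "AE x in M. \<exists>K. \<forall>N. \<bar>real (hit_count q \<gamma> \<psi> x N) - 2 * psi_sum q \<psi> N\<bar> \<le> K * error_scale N"
  proof (cases "\<exists>D. \<forall>N. psi_sum q \<psi> N \<le> D")
    case True
    then show ?thesis using deviation_bounded_case by blast
  next
    case False
    then show ?thesis by (intro deviation_unbounded_case) (meson not_le)
  qed
  then show ?thesis
  proof eventually_elim
    case (elim x)
    then obtain K where K: "\<And>N. \<bar>real (hit_count q \<gamma> \<psi> x N) - 2 * psi_sum q \<psi> N\<bar> \<le> K * error_scale N" by blast
    define d where "d = \<psi> (q 1)"
    have d: "0 < d" unfolding d_def by (rule psi_pos) simp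
    define c where "c = \<bar>K\<bar> * (sqrt (1 + 2 / d) * ln 2 powr (- \<epsilon>))"
    show ?case
    proof (rule bigoI[where c=c], rule eventually_sequentiallyI[of 1])
      fix N :: nat assume N: "1 \<le> N"
      define X where "X = psi_sum q \<psi> N + gcd_sum q \<psi> N"
      have "d = (\<Sum>n=1..1. \<psi> (q n))" by (simp add: d_def)
      also have "\<dots> \<le> psi_sum q \<psi> N" unfolding psi_sum_def
        using N psi_pos by (intro sum_mono2) (auto intro: less_imp_le)
      also have "\<dots> \<le> X" using gcd_sum_nonneg by (simp add: X_def)
      finally have X: "d \<le> X" .
      have "X + 2 \<le> (1 + 2 / d) * X" using X d by (simp add: field_simps)
      then have "sqrt (X + 2) \<le> sqrt ((1 + 2 / d) * X)" by simp
      also have "\<dots> = sqrt (1 + 2 / d) * X powr (1 / 2)" using X d by (simp only: real_sqrt_mult) (simp add: powr_half_sqrt)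
      finally have s: "sqrt (X + 2) \<le> sqrt (1 + 2 / d) * X powr (1 / 2)" .
      define l where "l = ln (X + 2)"
      have l: "ln 2 \<le> l" using X d by (simp add: l_def)
      have l0: "(0::real) < ln 2" by simp
      have "l\<^sup>2 = l powr 2" using order_trans[OF less_imp_le[OF l0] l] by (subst powr_numeral) auto
      also have "\<dots> = l powr (2 + \<epsilon>) * l powr (- \<epsilon>)" by (simp add: powr_add[symmetric])
      also have "\<dots> \<le> l powr (2 + \<epsilon>) * ln 2 powr (- \<epsilon>)"
        using l l0 eps by (intro mult_left_mono powr_mono2') auto
      finally have l2: "l\<^sup>2 \<le> l powr (2 + \<epsilon>) * ln 2 powr (- \<epsilon>)" .
      have "norm (real (hit_count q \<gamma> \<psi> x N) - 2 * psi_sum q \<psi> N) \<le> \<bar>K\<bar> * error_scale N"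
      proof -
        have "K * error_scale N \<le> \<bar>K\<bar> * error_scale N"
          using error_scale_ge(2)[of N] by (intro mult_right_mono) auto
        then show ?thesis using K[of N] by (simp only: real_norm_def)
      qed
      also have "error_scale N = sqrt (X + 2) * l\<^sup>2" by (simp add: error_scale_def X_def l_def)
      also have "\<bar>K\<bar> * (sqrt (X + 2) * l\<^sup>2) \<le> \<bar>K\<bar> * ((sqrt (1 + 2 / d) * X powr (1 / 2)) * (l powr (2 + \<epsilon>) * ln 2 powr (- \<epsilon>)))"
        using s l2 d by (intro mult_left_mono mult_mono) auto
      also have "\<dots> = c * norm (X powr (1 / 2) * l powr (2 + \<epsilon>))" by (simp add: c_def abs_mult)
      finally show "norm (real (hit_count q \<gamma> \<psi> x N) - 2 * psi_sum q \<psi> N) \<le> c * norm ((psi_sum q \<psi> N + gcd_sum q \<psi> N) powr (1 / 2) *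
             ln (psi_sum q \<psi> N + gcd_sum q \<psi> N + 2) powr (2 + \<epsilon>))"
        unfolding X_def l_def .
    qed
  qed
qed

end

section \<open>Translation of the asymptotic hypotheses into the quantitative ones\<close>

theorem theorem4:
  fixes \<mu> :: "real measure" and F :: "real set"
    and q :: "nat \<Rightarrow> nat" and \<psi> :: "nat \<Rightarrow> real"
    and \<alpha> \<gamma> A B C \<epsilon> :: real
  assumes "prob_space \<mu>" and "sets \<mu> = sets borel"
    and "F \<subseteq> {0..1}" and "AE x in \<mu>. x \<in> F"
    and "\<forall>n\<ge>1. 1 \<le> q n" and "strict_mono_on {1..} q"
    and "B \<ge> 1" and "C > 0"
    and "\<forall>n\<ge>2. ln (real (q n)) > C * real n powr (1 / B)"
    and "0 < \<alpha>" and "\<alpha> < 1" and "alpha_separated \<alpha> q"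
    and "\<gamma> \<in> {0..1}"
    and "\<forall>k\<ge>1. 0 < \<psi> k \<and> \<psi> k \<le> 1"
    and "\<forall>n\<ge>1. \<psi> (q n) \<le> 1 / 2"
    and "A > 2 * B"
    and "(\<lambda>t. norm (fourier \<mu> t)) \<in> O[at_infinity](\<lambda>t. ln \<bar>t\<bar> powr (- A))"
    and "\<epsilon> > 0"
  shows "AE x in \<mu>. x \<in> F \<longrightarrow>
    (\<lambda>N. real (hit_count q \<gamma> \<psi> x N) - 2 * psi_sum q \<psi> N) \<in>
      O(\<lambda>N. (psi_sum q \<psi> N + gcd_sum q \<psi> N) powr (1 / 2) *
             ln (psi_sum q \<psi> N + gcd_sum q \<psi> N + 2) powr (2 + \<epsilon>))"
proof -
  note q_pos = \<open>\<forall>n\<ge>1. 1 \<le> q n\<close> and mono = \<open>strict_mono_on {1..} q\<close>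
  note B = \<open>B \<ge> 1\<close> and C = \<open>C > 0\<close> and A = \<open>A > 2 * B\<close> and al = \<open>0 < \<alpha>\<close> \<open>\<alpha> < 1\<close>
  note growth = \<open>\<forall>n\<ge>2. ln (real (q n)) > C * real n powr (1 / B)\<close>
  \<comment> \<open>An increasing sequence of positive integers dominates its index, so thresholds
    on q n can be imposed through n.\<close>
  have q_ge: "n \<le> q n" if "1 \<le> n" for n
    using that
  proof (induction n rule: dec_induct)
    case (step n)
    have "q n < q (Suc n)" using mono step by (auto simp: strict_mono_on_def)
    then show ?case using step by simp
  qed (use q_pos in simp)
  obtain m0 where sep: "\<And>m n s t. m0 \<le> m \<Longrightarrow> m < n \<Longrightarrow> 1 \<le> s \<Longrightarrow> 1 \<le> t \<Longrightarrow>
      1 \<le> \<bar>int s * int (q m) - int t * int (q n)\<bar> \<Longrightarrow>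
      real_of_int \<bar>int s * int (q m) - int t * int (q n)\<bar> < real (q m) powr \<alpha> \<Longrightarrow> m ^ 12 < s"
    using \<open>alpha_separated \<alpha> q\<close> unfolding alpha_separated_def by blast
  obtain c where c: "c > 0" "\<forall>\<^sub>F t in at_infinity. norm (norm (fourier \<mu> t)) \<le> c * norm (ln \<bar>t\<bar> powr (- A))"
    using landau_o.bigE[OF assms(17)] by blast
  then obtain t0 where t0: "\<And>t. t0 \<le> \<bar>t\<bar> \<Longrightarrow> norm (fourier \<mu> t) \<le> c * ln \<bar>t\<bar> powr (- A)"
    by (auto simp: eventually_at_infinity)
  \<comment> \<open>The cap at 3 keeps \<eta> = (\<tau> - 2) / 16 below 1.\<close>
  define \<tau> where "\<tau> = min (A / B) 3"
  have tau: "2 < \<tau>" "\<tau> \<le> 3" "\<tau> \<le> A / B" using A B by (auto simp: \<tau>_def field_simps)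
  \<comment> \<open>With ln |r| >= \<alpha> * C * n powr (1 / B), the decay c * ln |r| powr (- A) is
    at most \<kappa> * n powr (- (A / B)).\<close>
  define \<kappa> where "\<kappa> = c * (\<alpha> * C) powr (- A)"
  \<comment> \<open>m0 serves separation. The other two thresholds force (q n) powr \<alpha> >= max
    t0 1, where the decay bound holds and the logarithm is nonnegative, and (q n) powr (1 -
    \<alpha>) >= 2, which is the locale assumption \<open>half\<close>.\<close>
  define n0 where "n0 = max (max 2 m0) (max (nat \<lceil>max t0 1 powr (1 / \<alpha>)\<rceil>) (nat \<lceil>2 powr (1 / (1 - \<alpha>))\<rceil>))"
  interpret separated_decay \<mu> q \<psi> \<gamma> \<alpha> \<tau> \<kappa> n0
  proof (rule separated_decay.intro)
    show "2 \<le> n0" by (simp add: n0_def)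
    show "0 \<le> \<kappa>" using c by (simp add: \<kappa>_def)
    show "1 \<le> q n" "0 < \<psi> (q n)" "\<psi> (q n) \<le> 1 / 2" if "1 \<le> n" for n
      using that q_pos assms(14,15) by auto
    show "real (q n) powr \<alpha> \<le> real (q n) / 2" if n: "n0 \<le> n" for n
    proof -
      have "1 \<le> n" "2 powr (1 / (1 - \<alpha>)) \<le> real n" using n by (auto simp: n0_def)
      then have "2 powr (1 / (1 - \<alpha>)) \<le> real (q n)" "1 \<le> real (q n)" using q_ge[of n] by linarith+
      then have "(2 powr (1 / (1 - \<alpha>))) powr (1 - \<alpha>) \<le> real (q n) powr (1 - \<alpha>)" using al by (intro powr_mono2) auto
      then have "2 \<le> real (q n) powr (1 - \<alpha>)" using al by (simp add: powr_powr)
      then have "real (q n) powr \<alpha> * 2 \<le> real (q n) powr \<alpha> * real (q n) powr (1 - \<alpha>)" by (intro mult_left_mono) auto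
      also have "\<dots> = real (q n)" using \<open>1 \<le> real (q n)\<close> by (simp add: powr_add[symmetric])
      finally show ?thesis by simp
    qed
    show "norm (fourier \<mu> r) \<le> \<kappa> * real n powr (- \<tau>)" if n: "n0 \<le> n" and r: "real (q n) powr \<alpha> \<le> \<bar>r\<bar>" for n r
    proof -
      have n2: "2 \<le> n" "max t0 1 powr (1 / \<alpha>) \<le> real n" using n by (auto simp: n0_def)
      then have "max t0 1 powr (1 / \<alpha>) \<le> real (q n)" and q1: "1 \<le> real (q n)" using q_ge[of n] by linarith+
      then have "(max t0 1 powr (1 / \<alpha>)) powr \<alpha> \<le> real (q n) powr \<alpha>" using al by (intro powr_mono2) auto
      then have "max t0 1 \<le> real (q n) powr \<alpha>" using al by (simp add: powr_powr)
      then have r0: "t0 \<le> \<bar>r\<bar>" "1 \<le> \<bar>r\<bar>" using r by auto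
      have "\<alpha> * (C * real n powr (1 / B)) \<le> \<alpha> * ln (real (q n))" using growth n2 al by (intro mult_left_mono) (auto intro: less_imp_le)
      also have "\<dots> = ln (real (q n) powr \<alpha>)" using q1 by (simp add: ln_powr)
      also have "\<dots> \<le> ln \<bar>r\<bar>" using r r0 q1 by (subst ln_le_cancel_iff) auto
      finally have L: "\<alpha> * C * real n powr (1 / B) \<le> ln \<bar>r\<bar>" by simp
      have np: "0 < \<alpha> * C * real n powr (1 / B)" using al C n2 by simp
      have "norm (fourier \<mu> r) \<le> c * ln \<bar>r\<bar> powr (- A)" by (rule t0) fact
      also have "\<dots> \<le> c * (\<alpha> * C * real n powr (1 / B)) powr (- A)"
        using c L np A B by (intro mult_left_mono powr_mono2') auto
      also have "\<dots> = \<kappa> * real n powr (- (A / B))"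
        using al C by (simp add: \<kappa>_def powr_mult powr_powr)
      also have "\<dots> \<le> \<kappa> * real n powr (- \<tau>)"
        using c tau n2 by (intro mult_left_mono powr_mono) (auto simp: \<kappa>_def)
      finally show ?thesis .
    qed
    show "m ^ 12 < s" if "n0 \<le> m" "m < n" "1 \<le> s" "1 \<le> t" "s * q m \<noteq> t * q n"
      "of_int \<bar>int (s * q m) - int (t * q n)\<bar> < real (q m) powr \<alpha>" for m n s t
    proof (rule sep)
      show "m0 \<le> m" using that by (simp add: n0_def)
      have "int (s * q m) - int (t * q n) \<noteq> 0" using that(5) by linarith
      then show "1 \<le> \<bar>int s * int (q m) - int t * int (q n)\<bar>" unfolding of_nat_mult by linarith
      show "real_of_int \<bar>int s * int (q m) - int t * int (q n)\<bar> < real (q m) powr \<alpha>" using that(6) by (simp only: of_nat_mult)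
    qed (use that in auto)
  qed (fact assms tau)+
  show ?thesis using deviation_bigo[OF \<open>\<epsilon> > 0\<close>] by eventually_elim simp
qed

end
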